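(* Let $K:\mathbf{R}^d\times\mathbf{R}^d\to\mathbf{R}^d$ be continuous, with $K(z,z')+K(z',z)=0$ for all $z,z'$, and Lipschitz in each variable with constant $L$: $\sup_{z'}|K(z_1,z')-K(z_2,z')|\le L|z_1-z_2|$ and $\sup_{z}|K(z,z_1)-K(z,z_2)|\le L|z_1-z_2|$ for all $z_1,z_2\in\mathbf{R}^d$. Let $T^N_t$ be the associated $N$-particle flow on $(\mathbf{R}^d)^N$. Let $P_N^{in}\in\mathcal{P}_1((\mathbf{R}^d)^N)$ be symmetric, let $P_N(t):=T^N_t\#P_N^{in}$, and let $P_{N:m}(t)$ be its $m$-particle marginal. Let $f^{in}$ be a probability density on $\mathbf{R}^d$ with $\int_{\mathbf{R}^d}|z|f^{in}(z)\,dz<\infty$, and let $f$ be the solution of the Vlasov equation with initial data $f^{in}$ (all as defined in the context). Then: (a) For all $t\in\mathbf{R}$, all $N\ge1$ and all $m=1,\ldots,N$, $$\int_{(\mathbf{R}^d)^N}\mu_{T^N_tZ_N^{in}}^{\otimes m}\,P_N^{in}(dZ_N^{in})=\frac{N!}{(N-m)!\,N^m}P_{N:m}(t)+R_{N,m}(t),$$ where $R_{N,m}(t)$ is a positive Radon measure on $(\mathbf{R}^d)^m$ with total mass $$\langle R_{N,m}(t),1\rangle=1-\frac{N!}{(N-m)!\,N^m}\le\frac{m(m-1)}{2N}.$$ (b) For all $t\in\mathbf{R}$, all $N\ge1$, all $m=1,\ldots,N$, and all bounded and Lipschitz continuous $\phi_m$ on $(\mathbf{R}^d)^m$, $$|\langle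 P_{N:m}(t)-(f(t)\mathscr{L}^d)^{\otimes m},\phi_m\rangle|\le\|\phi_m\|_{L^\infty}\frac{m(m-1)}{N}+m e^{2L|t|}\operatorname{Lip}(\phi_m)\int_{(\mathbf{R}^d)^N}\operatorname{dist}_{MK,1}(\mu_{Z_N^{in}},f^{in}\mathscr{L}^d)\,P_N^{in}(dZ_N^{in}).$$ (c) Assume that $P_N^{in}=(f^{in}\mathscr{L}^d)^{\otimes N}$ and that $$a:=\int_{\mathbf{R}^d}|z|^{d+5}f^{in}(z)\,dz<\infty.$$ Then there is a constant $C(a,d)$ depending only on $a$ and $d$ such that $$\|P_{N:m}(t)-(f(t)\mathscr{L}^d)^{\otimes m}\|_{W^{-1,1}((\mathbf{R}^d)^m)}\le m\left(\frac{m-1}{N}+e^{2L|t|}\frac{C(a,d)}{N^{1/(d+4)}}\right)$$ for all $t\in\mathbf{R}$ and all $N\ge m\ge1$. In particular, for $m=1$, $$\operatorname{dist}_{MK,1}(P_{N:1}(t),f(t)\mathscr{L}^d)\le \frac{C(a,d)e^{2L|t|}}{N^{1/(d+4)}}.$$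
   Context: $\mathscr{L}^d$ is Lebesgue measure on $\mathbf{R}^d$; $|\cdot|$ is the Euclidean norm; $(\mathbf{R}^d)^m$ is identified with $\mathbf{R}^{dm}$ with its Euclidean norm. $\mathcal{P}_1(\mathbf{R}^n)$ is the set of Borel probability measures $\mu$ on $\mathbf{R}^n$ with $\int|z|\,\mu(dz)<\infty$. Monge–Kantorovich distance: for $\mu,\nu\in\mathcal{P}_1(\mathbf{R}^n)$, $\operatorname{dist}_{MK,1}(\mu,\nu)=\inf_{\pi\in\Pi(\mu,\nu)}\iint|x-y|\,\pi(dx\,dy)$, where $\Pi(\mu,\nu)$ is the set of Borel probability measures on $\mathbf{R}^n\times\mathbf{R}^n$ with marginals $\mu$ and $\nu$. $\operatorname{Lip}(\phi)=\sup_{x\ne y}|\phi(x)-\phi(y)|/|x-y|$. The norm $\|\cdot\|_{W^{-1,1}((\mathbf{R}^d)^m)}$ of a finite signed measure is the norm dual to $W^{1,\infty}$: $\|\lambda\|_{W^{-1,1}}=\sup\{|\langle\lambda,\phi\rangle|:\ \|\phi\|_{L^\infty}\le1,\ \operatorname{Lip}(\phi)\le1\}$. The symbol $\#$ denotes push-forward of measures, and $\langle\lambda,\phi\rangle=\int\phi\,d\lambda$. $N$-particle flow: $T^N_t(z_1^{in},\ldots,z_N^{in})=(z_1(t),\ldots,z_N(t))$, where $(z_1,\ldots,z_N)$ is the (global, unique) solution of $$\dot z_k(t)=\frac1N\sum_{l=1}^NK(z_k(t),z_l(t)),\qquad z_k(0)=z_k^{in},\qquad k=1,\ldots,N,\ t\in\mathbf{R}.$$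 Empirical measure: for $Z_N=(z_1,\ldots,z_N)\in(\mathbf{R}^d)^N$, $\mu_{Z_N}=\frac1N\sum_{k=1}^N\delta_{z_k}$. Symmetry: a probability measure $P$ on $(\mathbf{R}^d)^N$ is symmetric if $S_\sigma\#P=P$ for every permutation $\sigma\in\mathfrak{S}_N$, where $S_\sigma(x_1,\ldots,x_N)=(x_{\sigma(1)},\ldots,x_{\sigma(N)})$. Marginals: $P_{N:m}(t)=p_m\#P_N(t)$ for $1\le m\le N$, where $p_m(z_1,\ldots,z_N)=(z_1,\ldots,z_m)$. Vlasov equation: for $\mu\in\mathcal{P}_1(\mathbf{R}^d)$ set $\mathcal{K}\mu(z)=\int_{\mathbf{R}^d}K(z,z')\,\mu(dz')$. It is a known fact (Dobrushin) that for each $\mu^{in}\in\mathcal{P}_1(\mathbf{R}^d)$ the Cauchy problem $\partial_t\mu(t)+\operatorname{div}(\mu(t)\mathcal{K}\mu(t))=0$, $\mu(0)=\mu^{in}$, has a unique weak solution (i.e. in the sense of distributions) $\mu\in C(\mathbf{R};\mathcal{P}_1(\mathbf{R}^d))$, where $\mathcal{P}_1(\mathbf{R}^d)$ carries its weak topology (metrized by $\operatorname{dist}_{MK,1}$), and that if $\mu^{in}=f^{in}\mathscr{L}^d$ then $\mu(t)=f(t,\cdot)\mathscr{L}^d$ for all $t$; this defines $f$, and $f(t)=f(t,\cdot)$. *)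

theory Defs
  imports "HOL-Probability.Probability" "HOL-Combinatorics.Permutations"
begin

definition P1 :: "'a::euclidean_space measure set" where
  "P1 = {\<mu>. sets \<mu> = sets borel \<and> prob_space \<mu> \<and> (\<integral>\<^sup>+z. ennreal (norm z) \<partial>\<mu>) < \<infinity>}"

definition couplings ::
    "'a::euclidean_space measure \<Rightarrow> 'a measure \<Rightarrow> ('a \<times> 'a) measure set" where
  "couplings \<mu> \<nu> =
    {\<pi>. sets \<pi> = sets borel \<and> prob_space \<pi> \<and> distr \<pi> borel fst = \<mu> \<and> distr \<pi> borel snd = \<nu>}"

definition dist_MK :: "'a::euclidean_space measure \<Rightarrow> 'a measure \<Rightarrow> ennreal" where
  "dist_MK \<mu> \<nu> = (INF \<pi>\<in>couplings \<mu> \<nu>. \<integral>\<^sup>+p. ennreal (norm (fst p - snd p)) \<partial>\<pi>)"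

definition empirical_measure :: "nat \<Rightarrow> (nat \<Rightarrow> 'a::euclidean_space) \<Rightarrow> 'a measure" where
  "empirical_measure N z =
    measure_of UNIV (sets borel) (\<lambda>A. (\<Sum>k<N. emeasure (return borel (z k)) A) / of_nat N)"

text \<open>
  The n-fold power of \<^typ>\<open>'a\<close> is the set of extensional functions on \<open>{..<n}\<close>, so that n can be
  quantified; particles are numbered from 0. As \<^typ>\<open>'a\<close> is second countable, the product
  sigma-algebra below is the Borel sigma-algebra of this power.
\<close>

abbreviation config :: "nat \<Rightarrow> (nat \<Rightarrow> 'a) set" where
  "config n \<equiv> {..<n} \<rightarrow>\<^sub>E UNIV"

abbreviation config_borel :: "nat \<Rightarrow> (nat \<Rightarrow> 'a::euclidean_space) measure" where
  "config_borel n \<equiv> PiM {..<n} (\<lambda>_. borel)"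

abbreviation tensor_power :: "nat \<Rightarrow> 'a measure \<Rightarrow> (nat \<Rightarrow> 'a) measure" where
  "tensor_power n \<mu> \<equiv> PiM {..<n} (\<lambda>_. \<mu>)"

definition config_norm :: "nat \<Rightarrow> (nat \<Rightarrow> 'a::euclidean_space) \<Rightarrow> real" where
  "config_norm n z = L2_set (\<lambda>i. norm (z i)) {..<n}"

definition config_P1 :: "nat \<Rightarrow> (nat \<Rightarrow> 'a::euclidean_space) measure set" where
  "config_P1 n =
    {P. sets P = sets (config_borel n) \<and> prob_space P \<and>
        (\<integral>\<^sup>+z. ennreal (config_norm n z) \<partial>P) < \<infinity>}"

definition symmetric_measure :: "nat \<Rightarrow> (nat \<Rightarrow> 'a::euclidean_space) measure \<Rightarrow> bool" where
  "symmetric_measure n P \<longleftrightarrow>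
    (\<forall>\<sigma>. \<sigma> permutes {..<n} \<longrightarrow> distr P (config_borel n) (\<lambda>x. \<lambda>i\<in>{..<n}. x (\<sigma> i)) = P)"

definition marginal ::
    "nat \<Rightarrow> (nat \<Rightarrow> 'a::euclidean_space) measure \<Rightarrow> (nat \<Rightarrow> 'a) measure" where
  "marginal m P = distr P (config_borel m) (\<lambda>z. restrict z {..<m})"

text \<open>
  Observables on the m-particle space are functions on \<^term>\<open>config m\<close>; their values elsewhere do
  not enter any of the quantities below. The norms are extended-valued, so finiteness of
  \<open>Linf_norm\<close> and \<open>Lip_const\<close> expresses boundedness and Lipschitz continuity.
\<close>

definition Linf_norm :: "nat \<Rightarrow> ((nat \<Rightarrow> 'a::euclidean_space) \<Rightarrow> real) \<Rightarrow> ennreal" where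
  "Linf_norm m \<phi> = esssup (tensor_power m lborel) (\<lambda>z. ennreal \<bar>\<phi> z\<bar>)"

definition Lip_const :: "nat \<Rightarrow> ((nat \<Rightarrow> 'a::euclidean_space) \<Rightarrow> real) \<Rightarrow> ennreal" where
  "Lip_const m \<phi> =
    (SUP (x, y)\<in>{(x, y). x \<in> config m \<and> y \<in> config m \<and> x \<noteq> y}.
      ennreal (\<bar>\<phi> x - \<phi> y\<bar> / config_norm m (\<lambda>i. x i - y i)))"

text \<open>
  A finite signed measure \<open>\<lambda>\<close> is given to the following norm as its pairing
  \<open>\<phi> \<mapsto> \<langle>\<lambda>, \<phi>\<rangle>\<close>; for a difference \<open>P - Q\<close> of finite measures this is
  \<open>\<lambda>\<phi>. integral\<^sup>L P \<phi> - integral\<^sup>L Q \<phi>\<close>.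
\<close>

definition W_minus_1_1_norm ::
    "nat \<Rightarrow> (((nat \<Rightarrow> 'a::euclidean_space) \<Rightarrow> real) \<Rightarrow> real) \<Rightarrow> ennreal" where
  "W_minus_1_1_norm m \<Lambda> =
    (SUP \<phi>\<in>{\<phi>. Linf_norm m \<phi> \<le> 1 \<and> Lip_const m \<phi> \<le> 1}. ennreal \<bar>\<Lambda> \<phi>\<bar>)"

definition interaction_kernel ::
    "('a::euclidean_space \<Rightarrow> 'a \<Rightarrow> 'a) \<Rightarrow> real \<Rightarrow> bool" where
  "interaction_kernel K L \<longleftrightarrow>
    continuous_on UNIV (\<lambda>(z, z'). K z z') \<and>
    (\<forall>z z'. K z z' + K z' z = 0) \<and>
    (\<forall>z1 z2 z'. norm (K z1 z' - K z2 z') \<le> L * norm (z1 - z2)) \<and>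
    (\<forall>z z1 z2. norm (K z z1 - K z z2) \<le> L * norm (z1 - z2))"

text \<open>The conditions determine \<open>T t\<close> on \<^term>\<open>config N\<close> by uniqueness for the Cauchy problem.\<close>

definition particle_flow ::
    "('a::euclidean_space \<Rightarrow> 'a \<Rightarrow> 'a) \<Rightarrow> nat \<Rightarrow>
      (real \<Rightarrow> (nat \<Rightarrow> 'a) \<Rightarrow> (nat \<Rightarrow> 'a)) \<Rightarrow> bool" where
  "particle_flow K N T \<longleftrightarrow>
    (\<forall>z\<in>config N.
      T 0 z = z \<and>
      (\<forall>t. T t z \<in> config N \<and>
        (\<forall>k<N. ((\<lambda>s. T s z k) has_vector_derivative
           (1 / real N) *\<^sub>R (\<Sum>l<N. K (T t z k) (T t z l))) (at t))))"

text \<open>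
  \<open>Ck k\<close> is k-fold continuous differentiability, so the functions below are the smooth
  compactly supported ones.
\<close>

primrec Ck :: "nat \<Rightarrow> ('a::euclidean_space \<Rightarrow> real) \<Rightarrow> bool" where
  "Ck 0 \<phi> \<longleftrightarrow> continuous_on UNIV \<phi>"
| "Ck (Suc k) \<phi> \<longleftrightarrow>
    \<phi> differentiable_on UNIV \<and> (\<forall>v. Ck k (\<lambda>x. frechet_derivative \<phi> (at x) v))"

definition test_function :: "('a::euclidean_space \<Rightarrow> real) \<Rightarrow> bool" where
  "test_function \<phi> \<longleftrightarrow> (\<forall>k. Ck k \<phi>) \<and> compact (closure {x. \<phi> x \<noteq> 0})"

definition vlasov_field ::
    "('a::euclidean_space \<Rightarrow> 'a \<Rightarrow> 'a) \<Rightarrow> 'a measure \<Rightarrow> 'a \<Rightarrow> 'a" where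
  "vlasov_field K \<mu> z = (\<integral>z'. K z z' \<partial>\<mu>)"

text \<open>
  With \<open>v = vlasov_field K (\<mu> t) z\<close>, the derivative of \<open>\<phi>\<close> at \<open>(t, z)\<close> in the direction \<open>(1, v)\<close>
  is the time derivative of \<open>\<phi>\<close> plus the inner product of \<open>v\<close> with the gradient of \<open>\<phi>\<close> in \<open>z\<close>.
\<close>

definition vlasov_solution ::
    "('a::euclidean_space \<Rightarrow> 'a \<Rightarrow> 'a) \<Rightarrow> 'a measure \<Rightarrow> (real \<Rightarrow> 'a measure) \<Rightarrow> bool" where
  "vlasov_solution K \<mu>in \<mu> \<longleftrightarrow>
    (\<forall>t. \<mu> t \<in> P1) \<and>
    (\<forall>s. ((\<lambda>t. dist_MK (\<mu> t) (\<mu> s)) \<longlongrightarrow> 0) (at s)) \<and>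
    \<mu> 0 = \<mu>in \<and>
    (\<forall>\<phi> :: real \<times> 'a \<Rightarrow> real. test_function \<phi> \<longrightarrow>
      (\<integral>t. (\<integral>z. frechet_derivative \<phi> (at (t, z)) (1, vlasov_field K (\<mu> t) z) \<partial>\<mu> t) \<partial>lborel) = 0)"

abbreviation density_measure :: "('a::euclidean_space \<Rightarrow> real) \<Rightarrow> 'a measure" where
  "density_measure g \<equiv> density lborel (\<lambda>z. ennreal (g z))"

definition probability_density :: "('a::euclidean_space \<Rightarrow> real) \<Rightarrow> bool" where
  "probability_density g \<longleftrightarrow> (\<forall>z. 0 \<le> g z) \<and> has_bochner_integral lborel g 1"

end

theory Submission
  imports Defs
begin

text \<open>
  A weak solution of the Vlasov equation is a weak solution of a linear continuity equation whose field is Lipschitz in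
  space and continuous in time. It is transported by the flow of that field: a Lipschitz function carried by the flow is
  an admissible test function after mollification, and the commutator of mollification and transport tends to zero
  uniformly because the field is Lipschitz.

  For (a), the m-fold power of an empirical measure is the average of point masses over all maps from m indices
  to N indices. By symmetry every injective map contributes the m-particle marginal; the others form the remainder. For (b),
  couplings of the initial measures are transported by the two flows (Dobrushin) and then tensorized.

  Part (c) does not use the rate of convergence of empirical measures. The particles are coupled directly with the
  independent mean-field trajectories issued from the same points, and a law of large numbers in mean square, for
  the kernel evaluated along these trajectories, gives the better rate \<open>1 / sqrt N\<close>.
\<close>

section \<open>Ordinary differential equations with a Lipschitz field\<close>

text \<open>The Vlasov solution is an arbitrary weak solution, so neither its characteristics nor
  its uniqueness may be presupposed. Freezing the field along the given curve of measures leaves a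
  linear problem with an explicit flow, and a change of variables then expresses the field through
  the initial measure alone. The exponent \<open>2 * L\<close> counts the two arguments of
  \<open>K\<close>, each of which costs one \<open>L\<close> in Gronwall. In (b) the factor m(m-1)/N
  is twice the sup norm, the most an index map with a repetition can contribute, times the
  proportion m(m-1)/(2N) of such maps. In (c) the constant must not depend on L. Antisymmetry makes
  \<open>K\<close> vanish on the diagonal, so the fluctuation at time s carries the factor
  \<open>L * exp (L * \<bar>s\<bar>)\<close>; weighted by the Gronwall factor, its time integral is
  at most \<open>exp (2 * L * \<bar>t\<bar>)\<close>, and no 1/L survives. The passage from 1/sqrt N
  to the stated rate uses d + 4 \<ge> 2, and the moment of order d + 5 bounds the second moment by 1
  + a.\<close>

lemma has_vector_derivative_affine_comp:
  assumes "\<And>t. (G has_vector_derivative g t) (at t)"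
  shows "((\<lambda>x. G (s + \<sigma> * x)) has_vector_derivative \<sigma> *\<^sub>R g (s + \<sigma> * x)) (at x)"
proof -
  have "((\<lambda>x. s + \<sigma> * x) has_vector_derivative \<sigma>) (at x)"
    by (auto intro!: derivative_eq_intros simp: has_real_derivative_iff_has_vector_derivative[symmetric])
  from vector_diff_chain_at[OF this, of G "g (s + \<sigma> * x)"] assms show ?thesis
    by (simp add: o_def)
qed

lemma has_vector_derivative_imp_continuous_on:
  assumes "\<And>t. (G has_vector_derivative g t) (at t)"
  shows "continuous_on A G"
  using assms by (meson continuous_at_imp_continuous_on has_vector_derivative_continuous)

lemma antiderivative_exists:
  fixes g :: "real \<Rightarrow> 'a::euclidean_space"
  assumes "continuous_on UNIV g"
  obtains G where "\<And>t. (G has_vector_derivative g t) (at t)" "G (s :: real) = z"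
proof -
  obtain G where G: "\<And>t. (G has_vector_derivative g t) (at t)"
    using einterval_antiderivative[of "-\<infinity>" "\<infinity>" g] assms
    by (auto simp: continuous_on_eq_continuous_at)
  show ?thesis
  proof (rule that[of "\<lambda>t. G t - G s + z"])
    show "((\<lambda>t. G t - G s + z) has_vector_derivative g t) (at t)" for t
      by (auto intro!: derivative_eq_intros G)
  qed simp
qed

section \<open>Mean value and Gronwall inequalities for curves\<close>

lemma growth_bound_right:
  fixes G g :: "real \<Rightarrow> 'a::euclidean_space"
  assumes dG: "\<And>t. (G has_vector_derivative g t) (at t)"
    and dB: "\<And>r. (B has_real_derivative b r) (at r)"
    and bound: "\<And>x. 0 < x \<Longrightarrow> x < r \<Longrightarrow> norm (g x) \<le> b x"
    and r: "0 \<le> r"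
  shows "norm (G r - G 0) \<le> B r - B 0"
proof (cases "r = 0")
  case False
  show ?thesis
  proof (rule differentiable_bound_general[where f' = g and \<phi>' = b])
    show "0 < r" using False r by simp
    show "continuous_on {0..r} G"
      using dG by (rule has_vector_derivative_imp_continuous_on)
    show "continuous_on {0..r} B"
      using dB by (meson DERIV_isCont continuous_at_imp_continuous_on)
    show "(B has_vector_derivative b x) (at x)" for x
      using dB by (simp add: has_real_derivative_iff_has_vector_derivative)
  qed (use dG bound in auto)
qed simp

lemma growth_bound:
  fixes G g :: "real \<Rightarrow> 'a::euclidean_space"
  assumes dG: "\<And>t. (G has_vector_derivative g t) (at t)"
    and dB: "\<And>r. (B has_real_derivative b r) (at r)"
    and bound: "\<And>t. \<bar>t - s\<bar> \<le> R \<Longrightarrow> norm (g t) \<le> b \<bar>t - s\<bar>"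
    and t: "\<bar>t - s\<bar> \<le> R"
  shows "norm (G t - G s) \<le> B \<bar>t - s\<bar> - B 0"
proof -
  \<comment> \<open>Negative times are handled by reversing the curve around s, which changes only
    the sign of its derivative.\<close>
  define \<sigma> :: real where "\<sigma> = (if s \<le> t then 1 else -1)"
  have \<sigma>: "\<bar>\<sigma>\<bar> = 1" "t = s + \<sigma> * \<bar>t - s\<bar>" by (auto simp: \<sigma>_def)
  have "norm (G (s + \<sigma> * \<bar>t - s\<bar>) - G (s + \<sigma> * 0)) \<le> B \<bar>t - s\<bar> - B 0"
  proof (rule growth_bound_right[where g = "\<lambda>x. \<sigma> *\<^sub>R g (s + \<sigma> * x)" and G = "\<lambda>x. G (s + \<sigma> * x)"])
    show "((\<lambda>x. G (s + \<sigma> * x)) has_vector_derivative \<sigma> *\<^sub>R g (s + \<sigma> * x)) (at x)" for x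
      by (rule has_vector_derivative_affine_comp) (rule dG)
    show "norm (\<sigma> *\<^sub>R g (s + \<sigma> * x)) \<le> b x" if "0 < x" "x < \<bar>t - s\<bar>" for x
      using bound[of "s + \<sigma> * x"] that \<sigma>(1) t by (simp add: abs_mult)
  qed (use dB in auto)
  then show ?thesis using \<sigma>(2) by simp
qed

text \<open>A norm along a curve need not be differentiable, so each one is replaced by the majorant
  \<open>norm (G k s)\<close> plus an antiderivative of the speed. The sum \<open>Q\<close> of these
  majorants is differentiable, dominates the sum of norms, and satisfies Q' \<le> c Q + b, while
  \<open>B\<close> solves the same relation with equality. Hence exp(-c x)(Q - B) is nonincreasing
  and starts at or below 0. The growth bound is required only for the sum over \<open>I\<close>,
  which is what interacting particles provide.\<close>

lemma gronwall_sum_directed: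
  fixes G g :: "'i \<Rightarrow> real \<Rightarrow> 'a::euclidean_space" and \<sigma> :: real
  assumes dG: "\<And>k t. k \<in> I \<Longrightarrow> (G k has_vector_derivative g k t) (at t)"
    and cont: "\<And>k. k \<in> I \<Longrightarrow> continuous_on UNIV (g k)"
    and \<sigma>: "\<bar>\<sigma>\<bar> = 1" and r: "0 \<le> r"
    and bound: "\<And>x. 0 \<le> x \<Longrightarrow> x \<le> r \<Longrightarrow>
      (\<Sum>k\<in>I. norm (g k (s + \<sigma> * x))) \<le> c * (\<Sum>k\<in>I. norm (G k (s + \<sigma> * x))) + b x"
    and c: "0 \<le> c"
    and dB: "\<And>x. 0 \<le> x \<Longrightarrow> (B has_real_derivative c * B x + b x) (at x)"
    and B0: "(\<Sum>k\<in>I. norm (G k s)) \<le> B 0"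
  shows "(\<Sum>k\<in>I. norm (G k (s + \<sigma> * r))) \<le> B r"
proof -
  define q where "q x = (\<Sum>k\<in>I. norm (G k (s + \<sigma> * x)))" for x
  have aux: "((\<lambda>x. G k (s + \<sigma> * x)) has_vector_derivative \<sigma> *\<^sub>R g k (s + \<sigma> * x)) (at x)"
    if "k \<in> I" for x k
    by (rule has_vector_derivative_affine_comp) (rule dG[OF that])
  have "\<exists>H. \<forall>x. (H has_real_derivative norm (g k (s + \<sigma> * x))) (at x)" if "k \<in> I" for k
  proof -
    have "continuous_on UNIV (\<lambda>x. norm (g k (s + \<sigma> * x)))"
      by (intro continuous_intros continuous_on_compose2[OF cont[OF that]]) auto
    then show ?thesis
      by (rule antiderivative_exists)
        (auto simp: has_real_derivative_iff_has_vector_derivative)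
  qed
  then obtain H where H: "\<And>k x. k \<in> I \<Longrightarrow> (H k has_real_derivative norm (g k (s + \<sigma> * x))) (at x)"
    by metis
  define Q where "Q x = (\<Sum>k\<in>I. norm (G k s) + (H k x - H k 0))" for x
  have dQ: "(Q has_real_derivative (\<Sum>k\<in>I. norm (g k (s + \<sigma> * x)))) (at x)" for x
    unfolding Q_def by (auto intro!: derivative_eq_intros H)
  have qQ: "q x \<le> Q x" if x: "0 \<le> x" for x
    unfolding q_def Q_def
  proof (rule sum_mono)
    fix k assume k: "k \<in> I"
    have "norm (G k (s + \<sigma> * x) - G k (s + \<sigma> * 0)) \<le> H k \<bar>x - 0\<bar> - H k 0"
      using growth_bound_right[OF aux[OF k] H[OF k], of x] x \<sigma> by simp
    then show "norm (G k (s + \<sigma> * x)) \<le> norm (G k s) + (H k x - H k 0)"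
      using x norm_triangle_ineq2[of "G k (s + \<sigma> * x)" "G k s"] by simp
  qed
  define E where "E x = exp (- c * x) * (Q x - B x)" for x
  have dE: "(E has_real_derivative exp (- c * x) *
      ((\<Sum>k\<in>I. norm (g k (s + \<sigma> * x))) - (c * B x + b x) - c * (Q x - B x))) (at x)" if "0 \<le> x" for x
    unfolding E_def by (auto intro!: derivative_eq_intros dQ dB that simp: algebra_simps)
  have "E r \<le> E 0"
  proof (rule DERIV_nonpos_imp_nonincreasing[OF r])
    fix x assume x: "0 \<le> x" "x \<le> r"
    have "(\<Sum>k\<in>I. norm (g k (s + \<sigma> * x))) \<le> c * q x + b x"
      using bound[of x] x by (simp add: q_def)
    also have "\<dots> \<le> c * Q x + b x"
      using qQ[OF x(1)] c by (simp add: mult_left_mono)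
    finally have "(\<Sum>k\<in>I. norm (g k (s + \<sigma> * x))) - (c * B x + b x) - c * (Q x - B x) \<le> 0"
      by (simp add: algebra_simps)
    then show "\<exists>y. (E has_real_derivative y) (at x) \<and> y \<le> 0"
      using dE[OF x(1)] by (metis exp_ge_zero mult_nonneg_nonpos)
  qed
  also have "E 0 \<le> 0" using B0 by (simp add: E_def Q_def)
  finally have "Q r \<le> B r" by (simp add: E_def mult_le_0_iff)
  then show ?thesis using qQ[OF r] by (simp add: q_def)
qed

lemma gronwall_sum:
  fixes G g :: "'i \<Rightarrow> real \<Rightarrow> 'a::euclidean_space"
  assumes dG: "\<And>k t. k \<in> I \<Longrightarrow> (G k has_vector_derivative g k t) (at t)"
    and cont: "\<And>k. k \<in> I \<Longrightarrow> continuous_on UNIV (g k)"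
    and bound: "\<And>t. \<bar>t - s\<bar> \<le> R \<Longrightarrow> (\<Sum>k\<in>I. norm (g k t)) \<le> c * (\<Sum>k\<in>I. norm (G k t)) + b \<bar>t - s\<bar>"
    and c: "0 \<le> c"
    and dB: "\<And>r. 0 \<le> r \<Longrightarrow> (B has_real_derivative c * B r + b r) (at r)"
    and B0: "(\<Sum>k\<in>I. norm (G k s)) \<le> B 0"
    and t: "\<bar>t - s\<bar> \<le> R"
  shows "(\<Sum>k\<in>I. norm (G k t)) \<le> B \<bar>t - s\<bar>"
proof -
  define \<sigma> :: real where "\<sigma> = (if s \<le> t then 1 else -1)"
  have \<sigma>: "\<bar>\<sigma>\<bar> = 1" "s + \<sigma> * \<bar>t - s\<bar> = t" by (auto simp: \<sigma>_def)
  have "(\<Sum>k\<in>I. norm (G k (s + \<sigma> * \<bar>t - s\<bar>))) \<le> B \<bar>t - s\<bar>"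
  proof (rule gronwall_sum_directed[OF dG cont \<sigma>(1) _ _ c dB B0])
    fix x assume "0 \<le> x" "x \<le> \<bar>t - s\<bar>"
    then show "(\<Sum>k\<in>I. norm (g k (s + \<sigma> * x))) \<le> c * (\<Sum>k\<in>I. norm (G k (s + \<sigma> * x))) + b x"
      using bound[of "s + \<sigma> * x"] \<sigma>(1) t by (simp add: abs_mult)
  qed auto
  then show ?thesis by (simp add: \<sigma>(2))
qed

section \<open>Global flow of a Lipschitz field\<close>

text \<open>Continuity in time is uniform in z although the field may be unbounded: this is what a
  mean field with Lipschitz kernel satisfies when its measure moves continuously in the
  Monge-Kantorovich distance.\<close>

locale lipschitz_field =
  fixes v :: "real \<Rightarrow> 'a::euclidean_space \<Rightarrow> 'a" and L :: real
  assumes L_nonneg: "0 \<le> L"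
    and lipschitz: "norm (v t z - v t z') \<le> L * norm (z - z')"
    and time_continuous: "0 < e \<Longrightarrow> \<forall>\<^sub>F t in nhds s. \<forall>z. norm (v t z - v s z) \<le> e"
begin

lemma continuous_field: "continuous_on UNIV (\<lambda>p. v (fst p) (snd p))"
proof (rule continuous_at_imp_continuous_on, rule ballI)
  fix p0 :: "real \<times> 'a"
  obtain s z where p0: "p0 = (s, z)" by fastforce
  have "((\<lambda>p. v (fst p) (snd p)) \<longlongrightarrow> v s z) (nhds p0)"
  proof (rule tendstoI)
    fix e :: real assume e: "0 < e"
    have fst: "filterlim fst (nhds s) (nhds p0)" and snd: "filterlim snd (nhds z) (nhds p0)"
      using tendsto_fst[OF filterlim_ident, of p0] tendsto_snd[OF filterlim_ident, of p0] by (simp_all add: p0)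
    have "\<forall>\<^sub>F p in nhds p0. \<forall>z. norm (v (fst p) z - v s z) \<le> e / 2"
      using eventually_compose_filterlim[OF time_continuous[of "e / 2" s] fst] e by simp
    moreover have "((\<lambda>p. L * norm (snd p - z)) \<longlongrightarrow> L * norm (z - z)) (nhds p0)"
      by (intro tendsto_intros snd)
    then have "\<forall>\<^sub>F p in nhds p0. L * norm (snd p - z) < e / 2"
      by (rule order_tendstoD) (use e in simp)
    ultimately show "\<forall>\<^sub>F p in nhds p0. dist (v (fst p) (snd p)) (v s z) < e"
    proof eventually_elim
      case (elim p)
      have "norm (v (fst p) (snd p) - v s z) \<le> norm (v (fst p) (snd p) - v s (snd p)) + norm (v s (snd p) - v s z)"
        using norm_triangle_ineq[of "v (fst p) (snd p) - v s (snd p)" "v s (snd p) - v s z"] by simp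
      then show ?case
        using elim(1)[rule_format, of "snd p"] elim(2) lipschitz[of s "snd p" z] by (simp add: dist_norm)
    qed
  qed
  then show "isCont (\<lambda>p. v (fst p) (snd p)) p0"
    by (auto simp: p0 isCont_def intro: tendsto_mono[OF at_within_le_nhds])
qed

lemma continuous_along:
  assumes "continuous_on A u"
  shows "continuous_on A (\<lambda>t. v t (u t))"
  using continuous_on_compose2[OF continuous_field, of A "\<lambda>t. (t, u t)"]
    continuous_on_Pair[OF continuous_on_id assms] by simp

definition solves :: "(real \<Rightarrow> 'a) \<Rightarrow> bool" where
  "solves u \<longleftrightarrow> (\<forall>t. (u has_vector_derivative v t (u t)) (at t))"

lemma solvesD: "solves u \<Longrightarrow> (u has_vector_derivative v t (u t)) (at t)"
  by (simp add: solves_def)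

lemma solves_continuous: "solves u \<Longrightarrow> continuous_on A u"
  by (rule has_vector_derivative_imp_continuous_on, rule solvesD)

text \<open>Picard iteration, measured with the weight
  \<open>exp (\<alpha> * \<bar>t - s\<bar>)\<close>. With this weight each iteration at least halves
  the distance of successive iterates on every bounded interval around s, whatever its length. The
  solution is therefore global at once, without gluing local pieces.\<close>

lemma solution_exists: "\<exists>u. solves u \<and> u s = z"
proof -
  define J where "J g = (SOME G. (\<forall>t. (G has_vector_derivative g t) (at t)) \<and> G s = z)" for g :: "real \<Rightarrow> 'a"
  have J: "(\<forall>t. (J g has_vector_derivative g t) (at t)) \<and> J g s = z" if "continuous_on UNIV g" for g
  proof -
    have "\<exists>G. (\<forall>t. (G has_vector_derivative g t) (at t)) \<and> G s = z"
      by (rule antiderivative_exists[OF that, of s z]) blast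
    then show ?thesis unfolding J_def by (rule someI_ex)
  qed
  define u where "u = rec_nat (\<lambda>_. z) (\<lambda>_ w. J (\<lambda>t. v t (w t)))"
  have u_Suc: "u (Suc n) = J (\<lambda>t. v t (u n t))" and u_0: "u 0 = (\<lambda>_. z)" for n
    by (simp_all add: u_def)
  have contu: "continuous_on UNIV (u n)" for n
  proof (induction n)
    case (Suc n)
    show ?case unfolding u_Suc
      by (rule has_vector_derivative_imp_continuous_on[where g = "\<lambda>t. v t (u n t)"])
         (use J[OF continuous_along[OF Suc]] in auto)
  qed (simp add: u_0)
  have du: "(u (Suc n) has_vector_derivative v t (u n t)) (at t)" for n t
    using J[OF continuous_along[OF contu]] unfolding u_Suc by blast
  have us: "u n s = z" for n
    using J[OF continuous_along[OF contu]] u_Suc by (cases n) (auto simp: u_0)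
  \<comment> \<open>The limit is fixed before any interval is chosen, so the results for different
    radii \<open>R\<close> concern one and the same curve.\<close>
  define U where "U t = lim (\<lambda>n. u n t)" for t
  have main: "(\<lambda>n. u n t) \<longlonglongrightarrow> U t" "(U has_vector_derivative v t (U t)) (at t)"
    if R: "\<bar>t - s\<bar> < R" for t R
  proof -
    obtain M0 where M0: "\<And>t. \<bar>t - s\<bar> \<le> R \<Longrightarrow> norm (v t z) \<le> M0"
    proof -
      have "compact ((\<lambda>t. v t z) ` {s - R..s + R})"
        by (intro compact_continuous_image continuous_along continuous_on_const compact_Icc)
      then obtain b where b: "\<And>x. x \<in> (\<lambda>t. v t z) ` {s - R..s + R} \<Longrightarrow> norm x \<le> b"
        by (metis bounded_iff compact_imp_bounded)
      show ?thesis by (rule that[of b], rule b, rule imageI) auto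
    qed
    have M0': "0 \<le> M0" using M0[of s] R norm_ge_zero[of "v s z"] by linarith
    \<comment> \<open>Integrating the weight gains 1/\<alpha>, and
      \<open>2 * L \<le> \<alpha>\<close> turns the Lipschitz constant into the factor 1/2. The
      summand 1 gives \<alpha> \<ge> 1, needed for the first iterate and safe when L = 0.\<close>
    define \<alpha> where "\<alpha> = 2 * L + 1"
    have \<alpha>: "1 \<le> \<alpha>" "2 * L \<le> \<alpha>" using L_nonneg by (auto simp: \<alpha>_def)
    have step: "norm (u (Suc n) t - u n t) \<le> M0 / 2 ^ n * exp (\<alpha> * \<bar>t - s\<bar>)" if "\<bar>t - s\<bar> \<le> R" for n t
      using that
    proof (induction n arbitrary: t)
      case 0
      have "norm (u (Suc 0) t - u (Suc 0) s) \<le> M0 * exp (\<alpha> * \<bar>t - s\<bar>) - M0 * exp (\<alpha> * 0)"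
      proof (rule growth_bound[OF du _ _ 0])
        show "((\<lambda>r. M0 * exp (\<alpha> * r)) has_real_derivative M0 * (\<alpha> * exp (\<alpha> * r))) (at r)" for r
          by (auto intro!: derivative_eq_intros)
        fix t assume "\<bar>t - s\<bar> \<le> R"
        then have "norm (v t (u 0 t)) \<le> M0 * (1 * 1)" using M0 by (simp add: u_0)
        also have "\<dots> \<le> M0 * (\<alpha> * exp (\<alpha> * \<bar>t - s\<bar>))"
          using M0' \<alpha> by (intro mult_left_mono mult_mono) auto
        finally show "norm (v t (u 0 t)) \<le> M0 * (\<alpha> * exp (\<alpha> * \<bar>t - s\<bar>))" .
      qed
      then show ?case using M0' us by (simp add: u_0)
    next
      case (Suc n)
      let ?C = "M0 / 2 ^ Suc n"
      have "norm ((u (Suc (Suc n)) t - u (Suc n) t) - (u (Suc (Suc n)) s - u (Suc n) s))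
          \<le> ?C * exp (\<alpha> * \<bar>t - s\<bar>) - ?C * exp (\<alpha> * 0)"
      proof (rule growth_bound[where b = "\<lambda>r. ?C * (\<alpha> * exp (\<alpha> * r))" and B = "\<lambda>r. ?C * exp (\<alpha> * r)"
            and G = "\<lambda>t. u (Suc (Suc n)) t - u (Suc n) t", OF _ _ _ Suc.prems])
        show "((\<lambda>t. u (Suc (Suc n)) t - u (Suc n) t) has_vector_derivative v t (u (Suc n) t) - v t (u n t)) (at t)" for t
          by (intro has_vector_derivative_diff du)
        show "((\<lambda>r. ?C * exp (\<alpha> * r)) has_real_derivative ?C * (\<alpha> * exp (\<alpha> * r))) (at r)" for r
          by (auto intro!: derivative_eq_intros)
        fix t assume t: "\<bar>t - s\<bar> \<le> R"
        have "norm (v t (u (Suc n) t) - v t (u n t)) \<le> L * (M0 / 2 ^ n * exp (\<alpha> * \<bar>t - s\<bar>))"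
          by (rule order_trans[OF lipschitz mult_left_mono[OF Suc.IH[OF t] L_nonneg]])
        also have "\<dots> = (2 * L) * (?C * exp (\<alpha> * \<bar>t - s\<bar>))" by simp
        also have "\<dots> \<le> \<alpha> * (?C * exp (\<alpha> * \<bar>t - s\<bar>))"
          using \<alpha> M0' by (intro mult_right_mono) auto
        finally show "norm (v t (u (Suc n) t) - v t (u n t)) \<le> ?C * (\<alpha> * exp (\<alpha> * \<bar>t - s\<bar>))"
          by (simp add: mult_ac)
      qed
      then have "norm (u (Suc (Suc n)) t - u (Suc n) t) \<le> ?C * exp (\<alpha> * \<bar>t - s\<bar>) - ?C"
        by (simp only: us diff_self diff_zero mult_zero_right exp_zero mult_1_right)
      moreover have "0 \<le> ?C" using M0' by simp
      ultimately show ?case by linarith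
    qed
    define M where "M = M0 * exp (\<alpha> * R)"
    have M: "0 \<le> M" by (simp add: M_def M0')
    have step': "norm (u (Suc n) t - u n t) \<le> M / 2 ^ n" if "\<bar>t - s\<bar> \<le> R" for n t
    proof -
      have "M0 / 2 ^ n * exp (\<alpha> * \<bar>t - s\<bar>) \<le> M0 / 2 ^ n * exp (\<alpha> * R)"
        using that M0' \<alpha> by (intro mult_left_mono) auto
      then show ?thesis using step[OF that, of n] by (simp add: M_def)
    qed
    have tele: "norm (u (n + k) t - u n t) \<le> 2 * M * (1 / 2 ^ n - 1 / 2 ^ (n + k))"
      if t: "\<bar>t - s\<bar> \<le> R" for n k t
    proof (induction k)
      case (Suc k)
      have "norm (u (n + Suc k) t - u n t) \<le> norm (u (Suc (n + k)) t - u (n + k) t) + norm (u (n + k) t - u n t)"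
        using norm_triangle_ineq[of "u (Suc (n + k)) t - u (n + k) t" "u (n + k) t - u n t"] by simp
      also have "\<dots> \<le> M / 2 ^ (n + k) + 2 * M * (1 / 2 ^ n - 1 / 2 ^ (n + k))"
        by (intro add_mono step' Suc t)
      finally show ?case by (simp add: field_simps)
    qed simp
    have tele': "norm (u m t - u n t) \<le> 2 * M / 2 ^ n" if t: "\<bar>t - s\<bar> \<le> R" and "n \<le> m" for m n t
    proof -
      have "2 * M * (1 / 2 ^ n - 1 / 2 ^ m) \<le> 2 * M * (1 / 2 ^ n)"
        using M by (intro mult_left_mono) auto
      then show ?thesis using tele[OF t, of n "m - n"] \<open>n \<le> m\<close> by simp
    qed
    have small: "(\<lambda>n. c * (1 / 2) ^ n) \<longlonglongrightarrow> 0" for c :: real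
      by (intro tendsto_mult_right_zero LIMSEQ_power_zero) simp
    have conv: "(\<lambda>n. u n t) \<longlonglongrightarrow> U t" if t: "\<bar>t - s\<bar> \<le> R" for t
    proof -
      have "Cauchy (\<lambda>n. u n t)"
      proof (rule CauchyI')
        fix e :: real assume "0 < e"
        then obtain N where N: "\<And>n. n \<ge> N \<Longrightarrow> 2 * M * (1 / 2) ^ n < e"
          using order_tendstoD(2)[OF small, of e "2 * M"] unfolding eventually_sequentially by blast
        show "\<exists>N. \<forall>m\<ge>N. \<forall>n>m. dist (u m t) (u n t) < e"
        proof (intro exI allI impI)
          fix m n assume "N \<le> m" "m < n"
          then show "dist (u m t) (u n t) < e"
            using tele'[OF t, of m n] N[of m] by (simp add: dist_norm norm_minus_commute power_divide)
        qed
      qed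
      then show ?thesis unfolding U_def
        by (simp add: Cauchy_convergent convergent_LIMSEQ_iff[symmetric])
    qed
    have unif: "norm (u n t - U t) \<le> 2 * M * (1 / 2) ^ n" if t: "\<bar>t - s\<bar> \<le> R" for n t
    proof -
      have "(\<lambda>m. norm (u n t - u m t)) \<longlonglongrightarrow> norm (u n t - U t)"
        by (intro tendsto_intros conv t)
      then show ?thesis
        by (rule tendsto_upperbound) (auto simp: eventually_sequentially norm_minus_commute power_divide intro!: exI[of _ n] tele' t)
    qed
    let ?S = "{s - R<..<s + R}"
    \<comment> \<open>The index is shifted because the derivative of iterate n + 1 is the field
      along iterate n. These derivatives converge uniformly, so the limit is differentiable with the
      limiting derivative; afterwards it is identified with \<open>U\<close> by uniqueness of
      limits.\<close>
    have "\<exists>g. \<forall>x\<in>?S. (\<lambda>n. u (Suc n) x) \<longlonglongrightarrow> g x \<and> (g has_derivative (\<lambda>h. h *\<^sub>R v x (U x))) (at x within ?S)"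
    proof (rule has_derivative_sequence[where f' = "\<lambda>n x h. h *\<^sub>R v x (u n x)" and l = z and ?x0.0 = s])
      show "(u (Suc n) has_derivative (\<lambda>h. h *\<^sub>R v x (u n x))) (at x within ?S)" for n x
        using du[of n x] by (auto simp: has_vector_derivative_def intro: has_derivative_at_withinI)
      fix e :: real assume e: "0 < e"
      have "\<forall>\<^sub>F n in sequentially. (L * (2 * M)) * (1 / 2) ^ n < e"
        by (rule order_tendstoD(2)[OF small e])
      then show "\<forall>\<^sub>F n in sequentially. \<forall>x\<in>?S. \<forall>h. norm (h *\<^sub>R v x (u n x) - h *\<^sub>R v x (U x)) \<le> e * norm h"
      proof eventually_elim
        case (elim n)
        show ?case
        proof (intro ballI allI)
          fix x h assume "x \<in> ?S"
          then have "norm (v x (u n x) - v x (U x)) \<le> L * (2 * M * (1 / 2) ^ n)"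
            by (intro order_trans[OF lipschitz mult_left_mono[OF unif L_nonneg]]) auto
          also have "\<dots> \<le> e" using elim by simp
          finally show "norm (h *\<^sub>R v x (u n x) - h *\<^sub>R v x (U x)) \<le> e * norm h"
            by (simp add: scaleR_diff_right[symmetric] mult.commute[of e] mult_left_mono)
        qed
      qed
    qed (use R us in auto)
    then obtain g where g: "\<And>x. x \<in> ?S \<Longrightarrow> (\<lambda>n. u (Suc n) x) \<longlonglongrightarrow> g x"
      "\<And>x. x \<in> ?S \<Longrightarrow> (g has_derivative (\<lambda>h. h *\<^sub>R v x (U x))) (at x within ?S)"
      by blast
    have gU: "g x = U x" if "x \<in> ?S" for x
      using LIMSEQ_unique[OF g(1)[OF that] LIMSEQ_Suc[OF conv]] that by auto
    have tS: "t \<in> ?S" using R by auto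
    have "(U has_derivative (\<lambda>h. h *\<^sub>R v t (U t))) (at t within ?S)"
      by (rule has_derivative_transform[OF tS gU[symmetric] g(2)[OF tS]])
    then show "(U has_vector_derivative v t (U t)) (at t)"
      using at_within_open[OF tS] by (simp add: has_vector_derivative_def)
    show "(\<lambda>n. u n t) \<longlonglongrightarrow> U t" using conv R by simp
  qed
  have "solves U" unfolding solves_def
  proof
    fix t show "(U has_vector_derivative v t (U t)) (at t)"
      by (rule main(2)[of t "\<bar>t - s\<bar> + 1"]) simp
  qed
  moreover have "U s = z"
    using LIMSEQ_unique[OF main(1)[of s 1]] us by simp
  ultimately show ?thesis by blast
qed

lemma solutions_stable:
  assumes u: "solves u" and w: "solves w"
  shows "norm (u t - w t) \<le> exp (L * \<bar>t - s\<bar>) * norm (u s - w s)"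
proof -
  \<comment> \<open>A one-point index set reduces the summed Gronwall inequality to a single
    curve.\<close>
  have "(\<Sum>k\<in>{()}. norm (u t - w t)) \<le> exp (L * \<bar>t - s\<bar>) * norm (u s - w s)"
  proof (rule gronwall_sum[where G = "\<lambda>_ t. u t - w t" and g = "\<lambda>_ t. v t (u t) - v t (w t)" and c = L
        and b = "\<lambda>_. 0" and R = "\<bar>t - s\<bar>" and B = "\<lambda>r. exp (L * r) * norm (u s - w s)"])
    show "((\<lambda>t. u t - w t) has_vector_derivative v t (u t) - v t (w t)) (at t)" for t
      by (intro has_vector_derivative_diff solvesD u w)
    show "continuous_on UNIV (\<lambda>t. v t (u t) - v t (w t))"
      by (intro continuous_intros continuous_along solves_continuous u w)
    show "((\<lambda>r. exp (L * r) * norm (u s - w s)) has_real_derivative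
        L * (exp (L * r) * norm (u s - w s)) + 0) (at r)" for r
      by (auto intro!: derivative_eq_intros)
  qed (use lipschitz L_nonneg in auto)
  then show ?thesis by simp
qed

definition flow :: "real \<Rightarrow> 'a \<Rightarrow> real \<Rightarrow> 'a" where
  "flow s z = (SOME u. solves u \<and> u s = z)"

lemma solves_flow: "solves (flow s z)" and flow_start [simp]: "flow s z s = z"
  using someI_ex[OF solution_exists[of s z]] by (auto simp: flow_def)

lemma flow_unique:
  assumes "solves u" shows "u t = flow s (u s) t"
  using solutions_stable[OF assms solves_flow, of t s "u s" s] by simp

lemma flow_flow: "flow r (flow s z r) t = flow s z t"
  using flow_unique[OF solves_flow, of s z t r] by simp

lemma flow_stable: "norm (flow s z t - flow s z' t) \<le> exp (L * \<bar>t - s\<bar>) * norm (z - z')"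
  using solutions_stable[OF solves_flow solves_flow, of s z t s z' s] by simp

end

section \<open>Mollification by test functions\<close>

lemma Ck_SucI:
  assumes "\<And>x. (\<phi> has_derivative D x) (at x)" "\<And>v. Ck k (\<lambda>x. D x v)"
  shows "Ck (Suc k) \<phi>"
proof -
  have "frechet_derivative \<phi> (at x) = D x" for x
    using frechet_derivative_at[OF assms(1)[of x]] by simp
  moreover have "\<phi> differentiable_on UNIV"
    using assms(1) by (auto simp: differentiable_on_def differentiable_def)
  ultimately show ?thesis using assms(2) by simp
qed

lemma Ck_SucD:
  assumes "Ck (Suc k) \<phi>"
  shows "(\<phi> has_derivative frechet_derivative \<phi> (at x)) (at x)"
    and "Ck k (\<lambda>x. frechet_derivative \<phi> (at x) v)"
  using assms frechet_derivative_works[of \<phi> "at x"] by (auto simp: differentiable_on_def)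

lemma Ck_Suc_imp: "Ck (Suc k) \<phi> \<Longrightarrow> Ck k \<phi>"
proof (induction k arbitrary: \<phi>)
  case 0
  then show ?case by (auto intro: differentiable_imp_continuous_on)
next
  case (Suc k)
  show ?case by (rule Ck_SucI[OF Ck_SucD(1)[OF Suc.prems] Suc.IH[OF Ck_SucD(2)[OF Suc.prems]]])
qed

lemma Ck_continuous: "Ck k \<phi> \<Longrightarrow> continuous_on UNIV \<phi>"
  by (induction k) (auto intro: differentiable_imp_continuous_on)

lemma Ck_const: "Ck k (\<lambda>_. c)"
proof (induction k arbitrary: c)
  case (Suc k)
  show ?case by (rule Ck_SucI[of _ "\<lambda>_ _. 0"]) (auto intro: Suc)
qed simp

lemma Ck_inner: "Ck k (\<lambda>x. x \<bullet> v)"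
proof (cases k)
  case (Suc n)
  show ?thesis unfolding Suc
    by (rule Ck_SucI[of _ "\<lambda>_ h. h \<bullet> v"]) (auto intro!: derivative_eq_intros Ck_const)
qed (auto intro!: continuous_intros)

lemma Ck_add: "Ck k \<phi> \<Longrightarrow> Ck k \<psi> \<Longrightarrow> Ck k (\<lambda>x. \<phi> x + \<psi> x)"
proof (induction k arbitrary: \<phi> \<psi>)
  case 0
  then show ?case by (auto intro!: continuous_intros)
next
  case (Suc k)
  show ?case
    by (rule Ck_SucI[OF has_derivative_add[OF Ck_SucD(1)[OF Suc.prems(1)] Ck_SucD(1)[OF Suc.prems(2)]]])
       (intro Suc.IH Ck_SucD(2)[OF Suc.prems(1)] Ck_SucD(2)[OF Suc.prems(2)])
qed

lemma Ck_mult: "Ck k \<phi> \<Longrightarrow> Ck k \<psi> \<Longrightarrow> Ck k (\<lambda>x. \<phi> x * \<psi> x)"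
proof (induction k arbitrary: \<phi> \<psi>)
  case 0
  then show ?case by (auto intro!: continuous_intros)
next
  case (Suc k)
  show ?case
    by (rule Ck_SucI[OF has_derivative_mult[OF Ck_SucD(1)[OF Suc.prems(1)] Ck_SucD(1)[OF Suc.prems(2)]]])
       (intro Ck_add Suc.IH Ck_Suc_imp[OF Suc.prems(1)] Ck_Suc_imp[OF Suc.prems(2)]
          Ck_SucD(2)[OF Suc.prems(1)] Ck_SucD(2)[OF Suc.prems(2)])
qed

text \<open>Every derivative of \<open>flat P\<close> is again of the form \<open>flat Q\<close>, so \<open>flat 1\<close> composed with a quadratic is smooth.\<close>

definition flat :: "real poly \<Rightarrow> real \<Rightarrow> real" where
  "flat P s = (if 0 < s then poly P (1 / s) * exp (- (1 / s)) else 0)"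

lemma tendsto_poly_exp: "((\<lambda>y. poly P y * exp (- y)) \<longlongrightarrow> (0::real)) at_top"
proof -
  have "((\<lambda>y. \<Sum>i\<le>degree P. coeff P i * (y ^ i / exp y)) \<longlongrightarrow> (\<Sum>i\<le>degree P. coeff P i * 0)) at_top"
    by (intro tendsto_intros tendsto_power_div_exp_0)
  moreover have "(\<lambda>y. poly P y * exp (- y)) = (\<lambda>y. \<Sum>i\<le>degree P. coeff P i * (y ^ i / exp y))"
    by (simp add: poly_altdef sum_distrib_right exp_minus divide_inverse mult_ac fun_eq_iff sum_distrib_left)
  ultimately show ?thesis by simp
qed

lemma flat_tendsto_0: "(flat P \<longlongrightarrow> 0) (at 0)"
proof (rule filterlim_split_at)
  show "(flat P \<longlongrightarrow> 0) (at_left 0)"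
    by (rule tendsto_eventually) (auto simp: flat_def eventually_at_filter)
  have "((\<lambda>s. poly P (inverse s) * exp (- inverse s)) \<longlongrightarrow> 0) (at_right (0::real))"
    by (rule filterlim_compose[OF tendsto_poly_exp filterlim_inverse_at_top_right])
  then show "(flat P \<longlongrightarrow> 0) (at_right 0)"
    by (rule Lim_transform_eventually) (auto simp: flat_def eventually_at_filter inverse_eq_divide)
qed

text \<open>With y = 1/s one has dy/ds = -y^2, so P(y) exp(-y) has derivative y^2 (P - P')(y)
  exp(-y); the polynomial \<open>[:0, 0, 1:]\<close> is y^2. Only s = 0 needs a limit.\<close>

lemma flat_has_derivative:
  "(flat P has_real_derivative flat ([:0, 0, 1:] * (P - pderiv P)) s) (at s)"
proof -
  consider "s < 0" | "s > 0" | "s = 0" by linarith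
  then show ?thesis
  proof cases
    case 1
    have "((\<lambda>_. 0) has_real_derivative 0) (at s)" by simp
    moreover have "eventually (\<lambda>x. x < 0) (nhds s)" by (rule eventually_nhds_in_open[of "{..<0}", simplified]) (use 1 in auto)
    then have "eventually (\<lambda>x. flat P x = 0) (nhds s)"
      by eventually_elim (simp add: flat_def)
    ultimately show ?thesis
      using 1 by (subst DERIV_cong_ev[OF refl _ refl]) (auto simp: flat_def)
  next
    case 2
    have "((\<lambda>s. poly P (1 / s) * exp (- (1 / s))) has_real_derivative
       flat ([:0, 0, 1:] * (P - pderiv P)) s) (at s)"
      using 2 by (auto intro!: derivative_eq_intros DERIV_chain2[OF poly_DERIV]
          simp: flat_def field_simps power2_eq_square)
    moreover have "eventually (\<lambda>x. x > 0) (nhds s)" by (rule eventually_nhds_in_open[of "{0<..}", simplified]) (use 2 in auto)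
    then have "eventually (\<lambda>x. flat P x = poly P (1 / x) * exp (- (1 / x))) (nhds s)"
      by eventually_elim (simp add: flat_def)
    ultimately show ?thesis
      by (subst DERIV_cong_ev[OF refl _ refl]) auto
  next
    case 3
    \<comment> \<open>Dividing by h multiplies the polynomial by y = 1/h, so the difference quotient
      at 0 is again a \<open>flat\<close> function and tends to 0.\<close>
    have "((\<lambda>h. (flat P (0 + h) - flat P 0) / h) \<longlongrightarrow> 0) (at 0)"
      by (rule Lim_transform_eventually[OF flat_tendsto_0[of "[:0, 1:] * P"]])
         (auto simp: flat_def eventually_at_filter)
    then show ?thesis using 3 by (simp add: DERIV_def flat_def)
  qed
qed

lemma Ck_flat: "Ck k (\<lambda>x. flat P (c - x \<bullet> x))"
proof (induction k arbitrary: P)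
  case 0
  have "continuous_on UNIV (flat P)"
    by (meson DERIV_isCont continuous_at_imp_continuous_on flat_has_derivative)
  then show ?case
    by (auto intro!: continuous_on_compose2[of UNIV "flat P"] continuous_intros)
next
  case (Suc k)
  let ?P = "[:0, 0, 1:] * (P - pderiv P)"
  show ?case
  proof (rule Ck_SucI)
    show "((\<lambda>x. flat P (c - x \<bullet> x)) has_derivative (\<lambda>v. flat ?P (c - x \<bullet> x) * (- 2 * (x \<bullet> v)))) (at x)" for x :: 'a
    proof -
      have "((\<lambda>x. c - x \<bullet> x) has_derivative (\<lambda>v. - 2 * (x \<bullet> v))) (at x)"
        by (auto intro!: derivative_eq_intros simp: inner_commute)
      from DERIV_compose_FDERIV[OF flat_has_derivative this] show ?thesis
        by (simp add: mult.commute)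
    qed
    show "Ck k (\<lambda>x. flat ?P (c - x \<bullet> x) * (- 2 * (x \<bullet> v)))" for v :: 'a
      by (intro Ck_mult Suc Ck_const Ck_inner)
  qed
qed

section \<open>Convolution with a smooth kernel and mollification\<close>

text \<open>Every derivative falls on the smooth factor, and \<open>H\<close> need only be
  continuous. Over a fixed compact box the Leibniz rule applies with the derivative regarded as a
  continuous map into bounded linear operators.\<close>

lemma Ck_convolution:
  fixes H \<rho> :: "'a::euclidean_space \<Rightarrow> real"
  assumes H: "continuous_on UNIV H" and \<rho>: "\<And>k. Ck k \<rho>"
  shows "Ck k (\<lambda>p. integral (cbox a b) (\<lambda>q. H q * \<rho> (p - q)))"
proof -
  have step: "((\<lambda>p. integral (cbox a b) (\<lambda>q. H q * \<rho> (p - q))) has_derivative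
        (\<lambda>v. integral (cbox a b) (\<lambda>q. H q * frechet_derivative \<rho> (at (p - q)) v))) (at p)"
    if \<rho>: "\<And>k. Ck k \<rho>" for p and \<rho> :: "'a \<Rightarrow> real"
  proof -
    define D where "D x = Blinfun (frechet_derivative \<rho> (at x))" for x
    have D: "blinfun_apply (D x) = frechet_derivative \<rho> (at x)" for x
      using Ck_SucD(1)[OF \<rho>[of "Suc 0"]] unfolding D_def
      by (intro bounded_linear_Blinfun_apply) (rule has_derivative_bounded_linear)
    have contD: "continuous_on UNIV D"
      by (rule continuous_on_blinfun_componentwise)
        (use Ck_SucD(2)[OF \<rho>[of "Suc 0"]] in \<open>simp add: D\<close>)
    have cont\<rho>: "continuous_on UNIV \<rho>" by (rule Ck_continuous[OF \<rho>])
    have cD: "continuous_on S (\<lambda>z. D (f z))" if "continuous_on S f" for S and f :: "'c::topological_space \<Rightarrow> 'a"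
      by (rule continuous_on_compose2[OF contD that]) auto
    have cH: "continuous_on S (\<lambda>z. H (f z))" if "continuous_on S f" for S and f :: "'c::topological_space \<Rightarrow> 'a"
      by (rule continuous_on_compose2[OF H that]) auto
    have c\<rho>: "continuous_on S (\<lambda>z. \<rho> (f z))" if "continuous_on S f" for S and f :: "'c::topological_space \<Rightarrow> 'a"
      by (rule continuous_on_compose2[OF cont\<rho> that]) auto
    have "((\<lambda>p. integral (cbox a b) (\<lambda>q. H q * \<rho> (p - q))) has_derivative
        integral (cbox a b) (\<lambda>q. H q *\<^sub>R D (p - q))) (at p within UNIV)"
    proof (rule leibniz_rule)
      show "((\<lambda>x. H t * \<rho> (x - t)) has_derivative blinfun_apply (H t *\<^sub>R D (x - t))) (at x within UNIV)" for x t
      proof -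
        have "((\<lambda>x. x - t) has_derivative (\<lambda>h. h)) (at x)"
          by (auto intro!: derivative_eq_intros)
        from has_derivative_compose[OF this Ck_SucD(1)[OF \<rho>[of "Suc 0"]]]
        show ?thesis by (auto intro!: derivative_eq_intros simp: D blinfun.scaleR_left)
      qed
      show "(\<lambda>q. H q * \<rho> (x - q)) integrable_on cbox a b" for x
        by (intro integrable_continuous continuous_intros cH c\<rho>)
      show "continuous_on (UNIV \<times> cbox a b) (\<lambda>(x, t). H t *\<^sub>R D (x - t))"
        unfolding case_prod_beta by (intro continuous_intros cH cD)
    qed auto
    moreover have "blinfun_apply (integral (cbox a b) (\<lambda>q. H q *\<^sub>R D (p - q))) v =
       integral (cbox a b) (\<lambda>q. H q * frechet_derivative \<rho> (at (p - q)) v)" for v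
      by (subst blinfun_apply_integral)
        (auto intro!: integrable_continuous continuous_intros cH cD simp: D blinfun.scaleR_left)
    then have "(\<lambda>v. integral (cbox a b) (\<lambda>q. H q * frechet_derivative \<rho> (at (p - q)) v)) =
        blinfun_apply (integral (cbox a b) (\<lambda>q. H q *\<^sub>R D (p - q)))"
      by (intro ext) simp
    ultimately show ?thesis by simp
  qed
  \<comment> \<open>Starting the induction at order 1 yields continuity of the first derivative for
    free: it is a convolution of the same kind, hence itself differentiable.\<close>
  have "Ck (Suc k) (\<lambda>p. integral (cbox a b) (\<lambda>q. H q * \<rho> (p - q)))" for k
    using \<rho>
  proof (induction k arbitrary: \<rho>)
    case 0
    show ?case
    proof (rule Ck_SucI[OF step[OF 0]])
      fix v
      have "Ck k (\<lambda>x. frechet_derivative \<rho> (at x) v)" for k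
        by (rule Ck_SucD(2)[OF 0])
      from has_derivative_continuous_on[OF step[OF this, THEN has_derivative_at_withinI]]
      show "Ck 0 (\<lambda>x. integral (cbox a b) (\<lambda>q. H q * frechet_derivative \<rho> (at (x - q)) v))"
        by simp
    qed
  next
    case (Suc k)
    show ?case
      by (rule Ck_SucI[OF step[OF Suc.prems]], rule Suc.IH, rule Ck_SucD(2)[OF Suc.prems])
  qed
  then show ?thesis by (rule Ck_Suc_imp)
qed

text \<open>The quantity \<epsilon>^2 - |x|^2 is positive exactly inside the ball, so composing
  \<open>flat 1\<close> with it gives an even smooth bump. It is then divided by its integral, which
  is nonzero because the bump is positive on a ball of positive volume.\<close>

lemma mollifier_exists:
  assumes "0 < \<epsilon>"
  obtains \<rho> :: "'a::euclidean_space \<Rightarrow> real"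
  where "\<And>k. Ck k \<rho>" "\<And>x. 0 \<le> \<rho> x" "\<And>x. \<epsilon> < norm x \<Longrightarrow> \<rho> x = 0" "\<And>x. \<rho> (- x) = \<rho> x"
    "has_bochner_integral lborel \<rho> 1"
proof -
  define \<eta> :: "'a \<Rightarrow> real" where "\<eta> x = flat 1 (\<epsilon>\<^sup>2 - x \<bullet> x)" for x
  have ck: "Ck k \<eta>" for k unfolding \<eta>_def by (rule Ck_flat)
  have nn: "0 \<le> \<eta> x" for x by (simp add: \<eta>_def flat_def)
  have pos: "0 < \<eta> x" if "norm x < \<epsilon>" for x
  proof -
    have "(norm x)\<^sup>2 < \<epsilon>\<^sup>2" using that by (intro power_strict_mono) auto
    then show ?thesis by (simp add: \<eta>_def flat_def power2_norm_eq_inner)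
  qed
  have zero: "\<eta> x = 0" if "\<epsilon> < norm x" for x
  proof -
    have "\<epsilon>\<^sup>2 \<le> (norm x)\<^sup>2" using that assms by (intro power_mono) auto
    then show ?thesis by (simp add: \<eta>_def flat_def power2_norm_eq_inner)
  qed
  have int: "integrable lborel \<eta>"
  proof -
    have "integrable lborel (\<lambda>x. indicator (cball 0 \<epsilon>) x *\<^sub>R \<eta> x)"
      by (intro borel_integrable_compact continuous_on_subset[OF Ck_continuous[OF ck]]) auto
    moreover have "(\<lambda>x. indicator (cball 0 \<epsilon>) x *\<^sub>R \<eta> x) = \<eta>"
      using zero by (auto simp: fun_eq_iff indicator_def)
    ultimately show ?thesis by simp
  qed
  define c where "c = (\<integral>x. \<eta> x \<partial>lborel)"
  have "c \<noteq> 0"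
  proof
    assume "c = 0"
    then have "AE x in lborel. \<eta> x = 0"
      using integral_nonneg_eq_0_iff_AE[OF int] nn by (simp add: c_def)
    then have "AE x in lborel. (x :: 'a) \<notin> ball 0 \<epsilon>"
      by eventually_elim (use pos in force)
    then have "emeasure lborel (ball (0::'a) \<epsilon>) = 0"
      by (subst (asm) AE_iff_measurable[OF _ refl]) (auto simp: ball_def)
    then show False using emeasure_lborel_ball_finite content_ball_pos[of \<epsilon> "0::'a"] assms
      by (simp add: measure_def)
  qed
  moreover have "0 \<le> c" unfolding c_def by (intro integral_nonneg_AE) (simp add: nn)
  ultimately have c: "0 < c" by simp
  show ?thesis
  proof (rule that[of "\<lambda>x. (1 / c) * \<eta> x"])
    show "Ck k (\<lambda>x. (1 / c) * \<eta> x)" for k by (intro Ck_mult Ck_const ck)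
    show "has_bochner_integral lborel (\<lambda>x. (1 / c) * \<eta> x) 1"
      using has_bochner_integral_mult_right[OF has_bochner_integral_integrable[OF int], of "1 / c"] c
      by (simp add: c_def)
    show "(1 / c) * \<eta> (- x) = (1 / c) * \<eta> x" for x by (simp add: \<eta>_def)
  qed (use nn zero c in auto)
qed

lemma lborel_integral_shift:
  fixes f :: "'a::euclidean_space \<Rightarrow> real"
  assumes [measurable]: "f \<in> borel_measurable borel"
  shows "(\<integral>x. f (c + x) \<partial>lborel) = (\<integral>x. f x \<partial>lborel)"
proof -
  have "(\<integral>x. f x \<partial>lborel) = (\<integral>x. f x \<partial>distr lborel borel ((+) c))"
    by (simp add: lborel_distr_plus)
  also have "\<dots> = (\<integral>x. f (c + x) \<partial>lborel)" by (subst integral_distr) auto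
  finally show ?thesis by simp
qed

text \<open>The derivative of the mollified function at p in direction w is the limit of averages,
  over the ball of radius \<epsilon>, of difference quotients of \<open>H\<close> in that same
  direction w. An estimate for these quotients, uniform over the ball, therefore passes to the
  derivative even if \<open>H\<close> is not differentiable. Keeping w constant while the base point
  q varies isolates the commutator of mollification and transport. A single \<phi> serves all p, w,
  c and \<kappa>.\<close>

lemma smooth_approximation:
  fixes H :: "'a::euclidean_space \<Rightarrow> real"
  assumes H: "continuous_on UNIV H" and supp: "\<And>p. R < norm p \<Longrightarrow> H p = 0" and \<epsilon>: "0 < \<epsilon>"
  shows "\<exists>\<phi>. test_function \<phi> \<and> (\<forall>p. R + \<epsilon> < norm p \<longrightarrow> \<phi> p = 0) \<and>
    (\<forall>p w c \<kappa>. (\<forall>\<^sub>F \<tau> in at_right 0. \<forall>q\<in>cball p \<epsilon>. \<bar>H (q + \<tau> *\<^sub>R w) - H q - \<tau> * c\<bar> \<le> \<tau> * \<kappa>)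
       \<longrightarrow> \<bar>frechet_derivative \<phi> (at p) w - c\<bar> \<le> \<kappa>)"
proof -
  obtain \<rho> :: "'a \<Rightarrow> real" where \<rho>: "\<And>k. Ck k \<rho>" "\<And>x. 0 \<le> \<rho> x" "\<And>x. \<epsilon> < norm x \<Longrightarrow> \<rho> x = 0"
    "\<And>x. \<rho> (- x) = \<rho> x" "has_bochner_integral lborel \<rho> 1"
    using mollifier_exists[OF \<epsilon>] by blast
  obtain a where a: "cball (0::'a) R \<subseteq> cbox (- a) a"
    using bounded_subset_cbox_symmetric[OF bounded_cball] by blast
  define \<phi> where "\<phi> p = integral (cbox (- a) a) (\<lambda>q. H q * \<rho> (p - q))" for p
  have ck: "Ck k \<phi>" for k unfolding \<phi>_def by (rule Ck_convolution[OF H \<rho>(1)])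
  have Hm[measurable]: "H \<in> borel_measurable borel" using H by (rule borel_measurable_continuous_onI)
  have \<rho>c: "continuous_on UNIV \<rho>" by (rule Ck_continuous[OF \<rho>(1)])
  have \<rho>m[measurable]: "\<rho> \<in> borel_measurable borel" using \<rho>c by (rule borel_measurable_continuous_onI)
  have \<phi>0: "\<phi> p = 0" if p: "R + \<epsilon> < norm p" for p
  proof -
    have "H q * \<rho> (p - q) = 0" for q
      using supp[of q] \<rho>(3)[of "p - q"] norm_triangle_ineq2[of p q] p by (cases "R < norm q") auto
    then have "(\<lambda>q. H q * \<rho> (p - q)) = (\<lambda>_. 0)" by (intro ext)
    then show ?thesis by (simp add: \<phi>_def)
  qed
  have int: "integrable lborel (\<lambda>q. H (p + q) * \<rho> q)" for p
  proof -
    have "integrable lborel (\<lambda>x. indicator (cball 0 \<epsilon>) x *\<^sub>R (H (p + x) * \<rho> x))"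
      by (intro borel_integrable_compact continuous_intros continuous_on_compose2[OF H] continuous_on_subset[OF \<rho>c]) auto
    moreover have "(\<lambda>x. indicator (cball 0 \<epsilon>) x *\<^sub>R (H (p + x) * \<rho> x)) = (\<lambda>x. H (p + x) * \<rho> x)"
      using \<rho>(3) by (auto simp: fun_eq_iff indicator_def)
    ultimately show ?thesis by simp
  qed
  have \<phi>: "\<phi> p = (\<integral>q. H (p + q) * \<rho> q \<partial>lborel)" for p
  proof -
    have "integrable lborel (\<lambda>x. indicator (cbox (- a) a) x *\<^sub>R (H x * \<rho> (p - x)))"
      by (intro borel_integrable_compact continuous_intros continuous_on_subset[OF H] continuous_on_compose2[OF \<rho>c]) auto
    from set_borel_integral_eq_integral(2)[unfolded set_integrable_def, OF this]
    have "\<phi> p = (\<integral>x. indicator (cbox (- a) a) x *\<^sub>R (H x * \<rho> (p - x)) \<partial>lborel)"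
      by (simp add: \<phi>_def set_lebesgue_integral_def)
    also have "(\<lambda>x. indicator (cbox (- a) a) x *\<^sub>R (H x * \<rho> (p - x))) = (\<lambda>x. H x * \<rho> (x - p))"
    proof
      fix x
      \<comment> \<open>Evenness turns the convolution into an average of \<open>H\<close> over
        shifts p + q, a form in which differences in p act on \<open>H\<close> alone.\<close>
      have "\<rho> (p - x) = \<rho> (x - p)" using \<rho>(4)[of "x - p"] by simp
      moreover have "H x = 0" if "x \<notin> cbox (- a) a" using that a supp[of x] by (auto simp: not_le subset_eq)
      ultimately show "indicator (cbox (- a) a) x *\<^sub>R (H x * \<rho> (p - x)) = H x * \<rho> (x - p)"
        by (auto simp: indicator_def)
    qed
    also have "(\<integral>x. H x * \<rho> (x - p) \<partial>lborel) = (\<integral>x. H (p + x) * \<rho> x \<partial>lborel)"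
      using lborel_integral_shift[of "\<lambda>x. H x * \<rho> (x - p)" p] by simp
    finally show ?thesis .
  qed
  have diff: "\<bar>frechet_derivative \<phi> (at p) w - c\<bar> \<le> \<kappa>"
    if ev: "\<forall>\<^sub>F \<tau> in at_right 0. \<forall>q\<in>cball p \<epsilon>. \<bar>H (q + \<tau> *\<^sub>R w) - H q - \<tau> * c\<bar> \<le> \<tau> * \<kappa>" for p w c \<kappa>
  proof -
    have "((\<lambda>\<tau>. p + \<tau> *\<^sub>R w) has_derivative (\<lambda>h. h *\<^sub>R w)) (at 0)"
      by (auto intro!: derivative_eq_intros)
    moreover have D: "(\<phi> has_derivative frechet_derivative \<phi> (at p)) (at p)"
      by (rule Ck_SucD(1)[OF ck])
    ultimately have "((\<lambda>\<tau>. \<phi> (p + \<tau> *\<^sub>R w)) has_derivative (\<lambda>h. frechet_derivative \<phi> (at p) (h *\<^sub>R w))) (at 0)"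
      using has_derivative_compose[of "\<lambda>\<tau>. p + \<tau> *\<^sub>R w" "\<lambda>h. h *\<^sub>R w" 0 UNIV \<phi>] by simp
    moreover have "frechet_derivative \<phi> (at p) (h *\<^sub>R w) = frechet_derivative \<phi> (at p) w * h" for h
      using linear_cmul[OF has_derivative_linear[OF D]] by simp
    ultimately have "((\<lambda>\<tau>. \<phi> (p + \<tau> *\<^sub>R w)) has_real_derivative frechet_derivative \<phi> (at p) w) (at 0)"
      by (simp add: has_field_derivative_def)
    \<comment> \<open>Since \<phi> is known to be differentiable, the quotients with \<tau> > 0
      already determine the derivative, and the estimate on \<open>H\<close> is asked only for
      those.\<close>
    then have "((\<lambda>\<tau>. (\<phi> (p + \<tau> *\<^sub>R w) - \<phi> p) / \<tau>) \<longlongrightarrow> frechet_derivative \<phi> (at p) w) (at_right 0)"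
      by (simp add: DERIV_def filterlim_at_split)
    then have lim: "((\<lambda>\<tau>. \<bar>(\<phi> (p + \<tau> *\<^sub>R w) - \<phi> p) / \<tau> - c\<bar>) \<longlongrightarrow> \<bar>frechet_derivative \<phi> (at p) w - c\<bar>) (at_right 0)"
      by (intro tendsto_intros)
    have "\<forall>\<^sub>F \<tau> in at_right 0. \<bar>(\<phi> (p + \<tau> *\<^sub>R w) - \<phi> p) / \<tau> - c\<bar> \<le> \<kappa>"
      using ev eventually_at_right_less[of "0::real"]
    proof eventually_elim
      case (elim \<tau>)
      have int\<rho>: "integrable lborel (\<lambda>q. \<tau> * c * \<rho> q)" "(\<integral>q. \<tau> * c * \<rho> q \<partial>lborel) = \<tau> * c" for c
        using \<rho>(5) by (auto simp: has_bochner_integral_iff)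
      have "\<phi> (p + \<tau> *\<^sub>R w) - \<phi> p - \<tau> * c =
          (\<integral>q. H (p + \<tau> *\<^sub>R w + q) * \<rho> q - H (p + q) * \<rho> q - \<tau> * c * \<rho> q \<partial>lborel)"
        by (simp only: \<phi> Bochner_Integration.integral_diff Bochner_Integration.integrable_diff int int\<rho>)
      also have "\<bar>\<dots>\<bar> \<le> (\<integral>q. \<tau> * \<kappa> * \<rho> q \<partial>lborel)"
      proof (rule integral_abs_bound_integral)
        fix q
        show "\<bar>H (p + \<tau> *\<^sub>R w + q) * \<rho> q - H (p + q) * \<rho> q - \<tau> * c * \<rho> q\<bar> \<le> \<tau> * \<kappa> * \<rho> q"
        proof (cases "\<epsilon> < norm q")
          case False
          then have "\<bar>H ((p + q) + \<tau> *\<^sub>R w) - H (p + q) - \<tau> * c\<bar> \<le> \<tau> * \<kappa>"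
            using elim(1) by (auto simp: dist_norm)
          from mult_right_mono[OF this \<rho>(2)[of q]]
          have "\<bar>(H ((p + q) + \<tau> *\<^sub>R w) - H (p + q) - \<tau> * c) * \<rho> q\<bar> \<le> \<tau> * \<kappa> * \<rho> q"
            using \<rho>(2)[of q] by (simp add: abs_mult)
          then show ?thesis by (simp add: algebra_simps)
        qed (simp add: \<rho>(3))
      qed (use int int\<rho> in auto)
      also have "\<dots> = \<tau> * \<kappa>" by (rule int\<rho>)
      finally have "\<bar>\<phi> (p + \<tau> *\<^sub>R w) - \<phi> p - \<tau> * c\<bar> \<le> \<tau> * \<kappa>" .
      moreover have "(\<phi> (p + \<tau> *\<^sub>R w) - \<phi> p) / \<tau> - c = (\<phi> (p + \<tau> *\<^sub>R w) - \<phi> p - \<tau> * c) / \<tau>"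
        using elim(2) by (simp add: field_simps)
      ultimately show ?case
        using elim(2) by (simp add: abs_divide pos_divide_le_eq mult.commute)
    qed
    then show ?thesis by (rule tendsto_upperbound[OF lim]) simp
  qed
  show ?thesis
  proof (intro exI[of _ \<phi>] conjI allI impI)
    have "{x. \<phi> x \<noteq> 0} \<subseteq> cball 0 (R + \<epsilon>)" using \<phi>0 by (force simp: not_le)
    then have "bounded {x. \<phi> x \<noteq> 0}" by (rule bounded_subset[OF bounded_cball])
    then show "test_function \<phi>" using ck by (simp add: test_function_def compact_closure)
  qed (use \<phi>0 diff in auto)
qed

section \<open>Uniqueness for the linear continuity equation\<close>

lemma couplingD:
  assumes "\<pi> \<in> couplings \<mu> \<nu>"
  shows "sets \<pi> = sets borel" "prob_space \<pi>" "distr \<pi> borel fst = \<mu>" "distr \<pi> borel snd = \<nu>"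
    "space \<pi> = UNIV" "sets \<mu> = sets borel" "sets \<nu> = sets borel"
  using assms sets_eq_imp_space_eq[of \<pi> borel] by (auto simp: couplings_def)

lemma dist_MK_lessE:
  assumes "dist_MK \<mu> \<nu> < c"
  obtains \<pi> where "\<pi> \<in> couplings \<mu> \<nu>" "(\<integral>\<^sup>+p. ennreal (norm (fst p - snd p)) \<partial>\<pi>) < c"
  using assms by (auto simp: dist_MK_def INF_less_iff)

lemma coupling_integral:
  fixes f :: "'a::euclidean_space \<Rightarrow> 'b::{banach, second_countable_topology}"
  assumes \<pi>: "\<pi> \<in> couplings \<mu> \<nu>"
  shows "integrable \<mu> f \<Longrightarrow> integrable \<pi> (\<lambda>p. f (fst p))"
    and "integrable \<mu> f \<Longrightarrow> (\<integral>x. f x \<partial>\<mu>) = (\<integral>p. f (fst p) \<partial>\<pi>)"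
    and "integrable \<nu> f \<Longrightarrow> integrable \<pi> (\<lambda>p. f (snd p))"
    and "integrable \<nu> f \<Longrightarrow> (\<integral>x. f x \<partial>\<nu>) = (\<integral>p. f (snd p) \<partial>\<pi>)"
proof -
  have [measurable]: "fst \<in> \<pi> \<rightarrow>\<^sub>M borel" "snd \<in> \<pi> \<rightarrow>\<^sub>M borel"
    by (simp_all add: couplingD[OF \<pi>] measurable_cong_sets[OF couplingD(1)[OF \<pi>] refl]
        borel_measurable_continuous_onI continuous_on_fst continuous_on_snd)
  {
    assume "integrable \<mu> f"
    then have *: "integrable (distr \<pi> borel fst) f" by (simp add: couplingD[OF \<pi>])
    then have [measurable]: "f \<in> borel_measurable borel" by simp
    show "integrable \<pi> (\<lambda>p. f (fst p))" using * by (simp add: integrable_distr_eq)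
    show "(\<integral>x. f x \<partial>\<mu>) = (\<integral>p. f (fst p) \<partial>\<pi>)"
      by (subst couplingD(3)[OF \<pi>, symmetric]) (simp add: integral_distr)
  }
  {
    assume "integrable \<nu> f"
    then have *: "integrable (distr \<pi> borel snd) f" by (simp add: couplingD[OF \<pi>])
    then have [measurable]: "f \<in> borel_measurable borel" by simp
    show "integrable \<pi> (\<lambda>p. f (snd p))" using * by (simp add: integrable_distr_eq)
    show "(\<integral>x. f x \<partial>\<nu>) = (\<integral>p. f (snd p) \<partial>\<pi>)"
      by (subst couplingD(4)[OF \<pi>, symmetric]) (simp add: integral_distr)
  }
qed

lemma coupling_cost:
  assumes \<pi>: "\<pi> \<in> couplings \<mu> \<nu>" and cost: "(\<integral>\<^sup>+p. ennreal (norm (fst p - snd p)) \<partial>\<pi>) \<le> ennreal d" and "0 \<le> d"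
  shows "integrable \<pi> (\<lambda>p. norm (fst p - snd p))" "(\<integral>p. norm (fst p - snd p) \<partial>\<pi>) \<le> d"
proof -
  have [measurable]: "fst \<in> \<pi> \<rightarrow>\<^sub>M borel" "snd \<in> \<pi> \<rightarrow>\<^sub>M borel"
    by (simp_all add: couplingD[OF \<pi>] measurable_cong_sets[OF couplingD(1)[OF \<pi>] refl]
        borel_measurable_continuous_onI continuous_on_fst continuous_on_snd)
  show *: "integrable \<pi> (\<lambda>p. norm (fst p - snd p))"
    by (rule integrableI_bounded) (use cost in \<open>auto intro: le_less_trans\<close>)
  show "(\<integral>p. norm (fst p - snd p) \<partial>\<pi>) \<le> d"
    using cost \<open>0 \<le> d\<close> by (subst (asm) nn_integral_eq_integral[OF *]) auto
qed

text \<open>Two different integrands with an additive error \<eta> are allowed. The case \<eta> = 0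
  gives continuity of the mean field in time; a positive \<eta> allows integrands that vary with
  time and are merely uniformly continuous.\<close>

lemma coupling_integral_diff:
  fixes f g :: "'a::euclidean_space \<Rightarrow> 'b::{banach, second_countable_topology}"
  assumes \<pi>: "\<pi> \<in> couplings \<mu> \<nu>" and cost: "(\<integral>\<^sup>+p. ennreal (norm (fst p - snd p)) \<partial>\<pi>) \<le> ennreal d" and d: "0 \<le> d"
    and f: "integrable \<mu> f" and g: "integrable \<nu> g"
    and fg: "\<And>x y. norm (f x - g y) \<le> \<eta> + C * norm (x - y)" and C: "0 \<le> C"
  shows "norm ((\<integral>x. f x \<partial>\<mu>) - (\<integral>x. g x \<partial>\<nu>)) \<le> \<eta> + C * d"
proof -
  interpret prob_space \<pi> by (rule couplingD(2)[OF \<pi>])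
  note int = coupling_cost[OF \<pi> cost d]
  have "(\<integral>x. f x \<partial>\<mu>) - (\<integral>x. g x \<partial>\<nu>) = (\<integral>p. f (fst p) - g (snd p) \<partial>\<pi>)"
    by (simp add: coupling_integral(2)[OF \<pi> f] coupling_integral(4)[OF \<pi> g]
        coupling_integral(1)[OF \<pi> f] coupling_integral(3)[OF \<pi> g])
  also have "norm \<dots> \<le> (\<integral>p. norm (f (fst p) - g (snd p)) \<partial>\<pi>)"
    by (rule integral_norm_bound)
  also have "\<dots> \<le> (\<integral>p. \<eta> + C * norm (fst p - snd p) \<partial>\<pi>)"
    using coupling_integral(1)[OF \<pi> f] coupling_integral(3)[OF \<pi> g] int fg
    by (intro integral_mono) auto
  also have "\<dots> = \<eta> + C * (\<integral>p. norm (fst p - snd p) \<partial>\<pi>)"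
    using int by (simp add: prob_space)
  also have "\<dots> \<le> \<eta> + C * d" using int C by (simp add: mult_left_mono)
  finally show ?thesis .
qed

lemma uniformly_continuous_compact_support:
  fixes f :: "'a::euclidean_space \<Rightarrow> real"
  assumes f: "continuous_on UNIV f" and supp: "\<And>p. R < norm p \<Longrightarrow> f p = 0" and e: "0 < e"
  obtains d where "0 < d" "\<And>p q. dist p q < d \<Longrightarrow> \<bar>f p - f q\<bar> < e"
proof -
  have "uniformly_continuous_on (cball 0 (R + 1)) f"
    by (intro compact_uniformly_continuous continuous_on_subset[OF f]) auto
  then obtain d where d: "0 < d"
    "\<And>p q. p \<in> cball 0 (R + 1) \<Longrightarrow> q \<in> cball 0 (R + 1) \<Longrightarrow> dist q p < d \<Longrightarrow> dist (f q) (f p) < e"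
    using e unfolding uniformly_continuous_on_def by meson
  \<comment> \<open>With distance below 1, if one of the points leaves the ball of radius R + 1 then
    both norms exceed R, and both values are 0.\<close>
  show ?thesis
  proof (rule that[of "min d 1"])
    fix p q :: 'a assume pq: "dist p q < min d 1"
    have n: "norm p \<le> norm q + dist p q" "norm q \<le> norm p + dist p q"
      using norm_triangle_ineq2[of p q] norm_triangle_ineq2[of q p] by (auto simp: dist_norm norm_minus_commute)
    show "\<bar>f p - f q\<bar> < e"
    proof (cases "norm p \<le> R + 1 \<and> norm q \<le> R + 1")
      case True
      then show ?thesis using d(2)[of q p] pq by (simp add: dist_real_def)
    next
      case False
      then have "R < norm p" "R < norm q" using n pq by linarith+
      then show ?thesis using supp e by simp
    qed
  qed (use d in auto)
qed

lemma bounded_compact_support: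
  fixes f :: "'a::euclidean_space \<Rightarrow> real"
  assumes f: "continuous_on UNIV f" and supp: "\<And>p. R < norm p \<Longrightarrow> f p = 0"
  obtains B where "0 \<le> B" "\<And>p. \<bar>f p\<bar> \<le> B"
proof -
  have "compact (f ` cball 0 R)"
    by (intro compact_continuous_image continuous_on_subset[OF f]) auto
  then obtain b where b: "\<And>x. x \<in> f ` cball 0 R \<Longrightarrow> norm x \<le> b"
    by (metis bounded_iff compact_imp_bounded)
  show ?thesis
  proof (rule that[of "max b 0"])
    show "\<bar>f p\<bar> \<le> max b 0" for p
      using b[of "f p"] supp[of p] by (cases "norm p \<le> R") (auto simp: max_def)
  qed simp
qed

text \<open>The indicator of an open box is the limit of \<open>real (Suc n) * \<psi> n\<close>,
  where \<psi> n is the distance to the complement truncated at 1/(n+1). The factor stays outside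
  the test function, so every \<psi> n is 1-Lipschitz with bounded support; open boxes generate the
  Borel sets and are stable under intersection.\<close>

lemma measure_eqI_lipschitz:
  fixes \<mu> \<nu> :: "'a::euclidean_space measure"
  assumes sets: "sets \<mu> = sets borel" "sets \<nu> = sets borel" and fin: "finite_measure \<mu>" "finite_measure \<nu>"
    and eq: "\<And>\<psi> r. (\<And>x y. \<bar>\<psi> x - \<psi> y\<bar> \<le> norm (x - y)) \<Longrightarrow> (\<And>x. r < norm x \<Longrightarrow> \<psi> x = 0)
      \<Longrightarrow> (\<integral>x. \<psi> x \<partial>\<mu>) = (\<integral>x. \<psi> x \<partial>\<nu> :: real)"
  shows "\<mu> = \<nu>"
proof (rule measure_eqI_generator_eq)
  let ?E = "range (\<lambda>(a, b). box a b :: 'a set)"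
  show "Int_stable ?E"
    by (auto simp: Int_stable_def box_Int_box)
  show "?E \<subseteq> Pow UNIV" "sets \<mu> = sigma_sets UNIV ?E" "sets \<nu> = sigma_sets UNIV ?E"
    by (simp_all add: sets borel_eq_box)
  let ?A = "\<lambda>n::nat. box (- (real n *\<^sub>R One)) (real n *\<^sub>R One) :: 'a set"
  show "range ?A \<subseteq> ?E" "(\<Union>i. ?A i) = UNIV"
    unfolding UN_box_eq_UNIV by auto
  show "emeasure \<mu> (?A i) \<noteq> \<infinity>" for i
    using fin(1) by (simp add: finite_measure.emeasure_finite)
  fix X assume "X \<in> ?E"
  then obtain a b where X: "X = box a b" by auto
  obtain r where r: "X \<subseteq> cball 0 r" using bounded_box[of a b] X bounded_subset_ballD[of X 0] by (meson ball_subset_cball order_trans)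
  define \<psi> where "\<psi> n x = min (1 / real (Suc n)) (infdist x (- X))" for n x
  have ne: "- X \<noteq> {}" using bounded_box[of a b] X not_bounded_UNIV by (metis Compl_empty_eq double_compl)
  have cl: "closed (- X)" using X closed_Compl[OF open_box] by blast
  have lip: "\<bar>\<psi> n x - \<psi> n y\<bar> \<le> norm (x - y)" for n x y
    using infdist_triangle_abs[of x "- X" y] by (auto simp: \<psi>_def dist_norm min_def abs_if split: if_splits)
  have supp: "\<psi> n x = 0" if "r < norm x" for n x
  proof -
    have "x \<in> - X" using that r by (auto simp: subset_eq)
    then show ?thesis by (simp add: \<psi>_def)
  qed
  have lim: "(\<lambda>n. \<integral>x. real (Suc n) * \<psi> n x \<partial>M) \<longlonglongrightarrow> measure M X"
    if M: "sets M = sets borel" "finite_measure M" for M :: "'a measure"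
  proof -
    have sp: "space M = UNIV" using sets_eq_imp_space_eq[OF M(1)] by simp
    interpret finite_measure M by fact
    have [measurable]: "X \<in> sets M" using X M by simp
    have "(\<lambda>n. \<integral>x. real (Suc n) * \<psi> n x \<partial>M) \<longlonglongrightarrow> (\<integral>x. indicator X x \<partial>M)"
    proof (rule integral_dominated_convergence[where w = "\<lambda>_. 1"])
      show "(\<lambda>x. real (Suc n) * \<psi> n x) \<in> borel_measurable M" for n
        unfolding \<psi>_def
        by (subst measurable_cong_sets[OF M(1) refl])
           (intro borel_measurable_continuous_onI continuous_intros)
      show "AE x in M. norm (real (Suc n) * \<psi> n x) \<le> 1" for n
        by (auto simp: \<psi>_def abs_mult infdist_nonneg min_def field_simps)
      show "AE x in M. (\<lambda>n. real (Suc n) * \<psi> n x) \<longlonglongrightarrow> indicator X x"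
      proof (rule AE_I2)
        fix x
        show "(\<lambda>n. real (Suc n) * \<psi> n x) \<longlonglongrightarrow> indicator X x"
        proof (cases "x \<in> X")
          case True
          then have "infdist x (- X) \<noteq> 0"
            using in_closed_iff_infdist_zero[OF cl ne] by auto
          then have pos: "0 < infdist x (- X)" using infdist_nonneg[of x "- X"] by linarith
          have "(\<lambda>n. 1 / real (Suc n)) \<longlonglongrightarrow> 0" by (rule LIMSEQ_Suc[OF lim_1_over_n])
          from order_tendstoD(2)[OF this pos]
          have "\<forall>\<^sub>F n in sequentially. real (Suc n) * \<psi> n x = 1"
            by eventually_elim (simp add: \<psi>_def min_def)
          then show ?thesis using True by (simp add: tendsto_eventually)
        next
          case False
          then show ?thesis by (simp add: \<psi>_def)
        qed
      qed
    qed auto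
    then show ?thesis by (simp add: sp)
  qed
  have "(\<integral>x. real (Suc n) * \<psi> n x \<partial>\<mu>) = (\<integral>x. real (Suc n) * \<psi> n x \<partial>\<nu>)" for n
    using eq[of "\<psi> n" r] lip supp by simp
  then have "measure \<mu> X = measure \<nu> X"
    using LIMSEQ_unique[OF lim[OF sets(1) fin(1)]] lim[OF sets(2) fin(2)] by simp
  then show "emeasure \<mu> X = emeasure \<nu> X"
    using fin by (simp add: finite_measure.emeasure_eq_measure)
qed


section \<open>Joint continuity, displacement and support of the flow\<close>

context lipschitz_field begin

text \<open>A Lebesgue number for the cover of the compact interval by balls on which the field
  moves by at most e/2. Only s is confined to the interval; t may leave it.\<close>

lemma time_uniformly_continuous:
  assumes "0 < e"
  obtains d where "0 < d" "\<And>s t z. \<bar>s\<bar> \<le> R \<Longrightarrow> \<bar>t - s\<bar> < d \<Longrightarrow> norm (v t z - v s z) \<le> e"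
proof -
  have "\<exists>d>0. \<forall>t. dist t s < d \<longrightarrow> (\<forall>z. norm (v t z - v s z) \<le> e / 2)" for s
    using time_continuous[of "e / 2" s] assms by (simp add: eventually_nhds_metric)
  then obtain \<delta> where \<delta>: "\<And>s. 0 < \<delta> s"
    "\<And>s t z. dist t s < \<delta> s \<Longrightarrow> norm (v t z - v s z) \<le> e / 2" by metis
  obtain d where d: "0 < d" "\<And>x. x \<in> {-R..R} \<Longrightarrow> \<exists>G\<in>(\<lambda>s. ball s (\<delta> s)) ` {-R..R}. ball x d \<subseteq> G"
    by (rule Heine_Borel_lemma[of "{-R..R}" "(\<lambda>s. ball s (\<delta> s)) ` {-R..R}"]) (use \<delta>(1) in auto)
  show ?thesis
  proof (rule that[OF d(1)])
    fix s t z assume s: "\<bar>s\<bar> \<le> R" and t: "\<bar>t - s\<bar> < d"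
    obtain r where r: "ball s d \<subseteq> ball r (\<delta> r)" using d(2)[of s] s by (auto simp: abs_le_iff)
    have "dist s r < \<delta> r" "dist t r < \<delta> r"
      using subsetD[OF r, of s] subsetD[OF r, of t] d(1) t by (auto simp: dist_commute dist_real_def)
    from \<delta>(2)[OF this(1), of z] \<delta>(2)[OF this(2), of z]
    have "norm ((v t z - v r z) - (v s z - v r z)) \<le> e / 2 + e / 2"
      by (intro order_trans[OF norm_triangle_ineq4]) simp
    then show "norm (v t z - v s z) \<le> e" by simp
  qed
qed

lemma continuous_flow_end: "continuous_on UNIV (\<lambda>p. flow 0 (snd p) (fst p))"
proof (rule continuous_at_imp_continuous_on, rule ballI)
  fix p0 :: "real \<times> 'a"
  let ?X = "\<lambda>p. flow 0 (snd p) (fst p)"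
  have "isCont (flow 0 (snd p0)) (fst p0)"
    using solves_continuous[OF solves_flow, of UNIV 0 "snd p0"] continuous_on_eq_continuous_at by blast
  from isCont_tendsto_compose[OF this tendsto_fst[OF tendsto_ident_at]]
  have "((\<lambda>p. flow 0 (snd p0) (fst p)) \<longlongrightarrow> ?X p0) (at p0)" .
  then have "((\<lambda>p. norm (flow 0 (snd p0) (fst p) - ?X p0)) \<longlongrightarrow> 0) (at p0)"
    by (simp add: LIM_zero tendsto_norm_zero)
  moreover have "((\<lambda>p. exp (L * \<bar>fst p\<bar>) * norm (snd p - snd p0)) \<longlongrightarrow> exp (L * \<bar>fst p0\<bar>) * norm (snd p0 - snd p0)) (at p0)"
    by (intro tendsto_intros)
  then have "((\<lambda>p. exp (L * \<bar>fst p\<bar>) * norm (snd p - snd p0)) \<longlongrightarrow> 0) (at p0)"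
    by (simp only: diff_self norm_zero mult_zero_right)
  ultimately have lim: "((\<lambda>p. exp (L * \<bar>fst p\<bar>) * norm (snd p - snd p0) + norm (flow 0 (snd p0) (fst p) - ?X p0)) \<longlongrightarrow> 0) (at p0)"
    using tendsto_add_zero by blast
  have bound: "norm (?X p - ?X p0) \<le> exp (L * \<bar>fst p\<bar>) * norm (snd p - snd p0) + norm (flow 0 (snd p0) (fst p) - ?X p0)" for p
    using norm_triangle_ineq[of "?X p - flow 0 (snd p0) (fst p)" "flow 0 (snd p0) (fst p) - ?X p0"]
      flow_stable[of 0 "snd p" "fst p" "snd p0"] by simp
  have "((\<lambda>p. ?X p - ?X p0) \<longlongrightarrow> 0) (at p0)"
    by (rule Lim_null_comparison[OF always_eventually lim]) (use bound in blast)
  then show "isCont ?X p0" by (simp add: isCont_def LIM_zero_cancel)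
qed

text \<open>Here the initial time varies. The cocycle identity lets the curve through p0 be
  restarted at time \<open>fst p\<close>, so both curves start at the same time and stability
  applies; their initial distance tends to 0 because the curve through p0 is continuous.\<close>

lemma continuous_flow_start: "continuous_on UNIV (\<lambda>p. flow (fst p) (snd p) 0)"
proof (rule continuous_at_imp_continuous_on, rule ballI)
  fix p0 :: "real \<times> 'a"
  let ?Y = "\<lambda>p. flow (fst p) (snd p) 0"
  have "isCont (flow (fst p0) (snd p0)) (fst p0)"
    using solves_continuous[OF solves_flow, of UNIV "fst p0" "snd p0"] continuous_on_eq_continuous_at by blast
  from isCont_tendsto_compose[OF this tendsto_fst[OF tendsto_ident_at]]
  have "((\<lambda>p. flow (fst p0) (snd p0) (fst p)) \<longlongrightarrow> snd p0) (at p0)"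
    by (simp only: flow_start)
  then have "((\<lambda>p. exp (L * \<bar>0 - fst p\<bar>) * norm (snd p - flow (fst p0) (snd p0) (fst p))) \<longlongrightarrow>
      exp (L * \<bar>0 - fst p0\<bar>) * norm (snd p0 - snd p0)) (at p0)"
    by (intro tendsto_intros)
  then have lim: "((\<lambda>p. exp (L * \<bar>0 - fst p\<bar>) * norm (snd p - flow (fst p0) (snd p0) (fst p))) \<longlongrightarrow> 0) (at p0)"
    by (simp only: diff_self norm_zero mult_zero_right)
  have bound: "norm (?Y p - ?Y p0) \<le> exp (L * \<bar>0 - fst p\<bar>) * norm (snd p - flow (fst p0) (snd p0) (fst p))" for p
    using flow_stable[of "fst p" "snd p" 0 "flow (fst p0) (snd p0) (fst p)"] by (simp add: flow_flow)
  have "((\<lambda>p. ?Y p - ?Y p0) \<longlongrightarrow> 0) (at p0)"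
    by (rule Lim_null_comparison[OF always_eventually lim]) (use bound in blast)
  then show "isCont ?Y p0" by (simp add: isCont_def LIM_zero_cancel)
qed

text \<open>If \<psi> is nonzero at y = \<open>flow t z 0\<close>, then y lies in the ball of radius
  r and z = \<open>flow 0 y t\<close>. Stability keeps z within a bounded distance of the reference
  curve \<open>flow 0 0\<close>, which is bounded on compact time intervals.\<close>

lemma flow_start_support:
  assumes \<psi>: "\<And>x :: 'a. r < norm x \<Longrightarrow> \<psi> x = (0::real)"
  obtains r' where "0 \<le> r'" "\<And>t (z :: 'a). \<bar>t\<bar> \<le> R \<Longrightarrow> r' < norm z \<Longrightarrow> \<psi> (flow t z 0) = 0"
proof -
  have "compact ((\<lambda>t. flow 0 0 t) ` {-R..R})"
    by (intro compact_continuous_image solves_continuous solves_flow) auto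
  then obtain b where b: "\<And>x. x \<in> flow 0 0 ` {-R..R} \<Longrightarrow> norm x \<le> b"
    by (metis bounded_iff compact_imp_bounded)
  define r' where "r' = max 0 (b + exp (L * R) * max r 0)"
  show ?thesis
  proof (rule that[of r'])
    fix t and z :: 'a assume t: "\<bar>t\<bar> \<le> R" and z: "r' < norm z"
    show "\<psi> (flow t z 0) = 0"
    proof (rule ccontr)
      assume "\<psi> (flow t z 0) \<noteq> 0"
      then have y: "norm (flow t z 0) \<le> r" using \<psi>[of "flow t z 0"] by force
      have "norm (flow 0 0 t) \<le> b" using b t by (auto simp: abs_le_iff)
      moreover have "norm (flow 0 (flow t z 0) t - flow 0 0 t) \<le> exp (L * \<bar>t - 0\<bar>) * norm (flow t z 0 - 0)"
        by (rule flow_stable)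
      then have "norm (z - flow 0 0 t) \<le> exp (L * \<bar>t\<bar>) * norm (flow t z 0)"
        by (simp add: flow_flow)
      moreover have "exp (L * \<bar>t\<bar>) * norm (flow t z 0) \<le> exp (L * R) * max r 0"
        using y t L_nonneg by (intro mult_mono) (auto intro: mult_left_mono)
      ultimately have "norm z \<le> b + exp (L * R) * max r 0"
        using norm_triangle_ineq2[of z "flow 0 0 t"] by linarith
      then show False using z by (simp add: r'_def)
    qed
  qed (simp add: r'_def)
qed

text \<open>The field is bounded only at the fixed point z, not along the trajectory; the Lipschitz
  property makes up the difference through Gronwall.\<close>

lemma flow_displacement:
  assumes B: "\<And>t'. \<bar>t' - t\<bar> \<le> \<tau> \<Longrightarrow> norm (v t' z) \<le> B" and r: "\<bar>r - t\<bar> \<le> \<tau>"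
  shows "norm (flow t z r - z) \<le> B * \<bar>r - t\<bar> * exp (L * \<bar>r - t\<bar>)"
proof -
  have "(\<Sum>k\<in>{()}. norm (flow t z r - z)) \<le> B * \<bar>r - t\<bar> * exp (L * \<bar>r - t\<bar>)"
  proof (rule gronwall_sum[where G = "\<lambda>_ r. flow t z r - z" and g = "\<lambda>_ r. v r (flow t z r)" and c = L
        and b = "\<lambda>x. B * exp (L * x)" and R = \<tau> and B = "\<lambda>x. B * x * exp (L * x)"])
    show "((\<lambda>r. flow t z r - z) has_vector_derivative v r (flow t z r)) (at r)" for r
      using solvesD[OF solves_flow] by (auto intro!: derivative_eq_intros)
    show "continuous_on UNIV (\<lambda>r. v r (flow t z r))"
      by (intro continuous_along solves_continuous solves_flow)
    have B0: "0 \<le> B" using B[of t] r norm_ge_zero[of "v t z"] by linarith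
    fix r assume r: "\<bar>r - t\<bar> \<le> \<tau>"
    have "norm (v r (flow t z r)) \<le> norm (v r (flow t z r) - v r z) + norm (v r z)"
      using norm_triangle_ineq[of "v r (flow t z r) - v r z" "v r z"] by simp
    also have "\<dots> \<le> L * norm (flow t z r - z) + B * 1"
      using lipschitz B[OF r] by (intro add_mono) auto
    \<comment> \<open>The constant forcing is enlarged to \<open>B * exp (L * x)\<close>, for which
      the comparison equation has the closed solution \<open>B * x * exp (L * x)\<close>.\<close>
    also have "\<dots> \<le> L * norm (flow t z r - z) + B * exp (L * \<bar>r - t\<bar>)"
      using B0 L_nonneg by (intro add_mono mult_left_mono) auto
    finally show "(\<Sum>k\<in>{()}. norm (v r (flow t z r))) \<le> L * (\<Sum>k\<in>{()}. norm (flow t z r - z)) + B * exp (L * \<bar>r - t\<bar>)"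
      by simp
  next
    show "((\<lambda>x. B * x * exp (L * x)) has_real_derivative L * (B * x * exp (L * x)) + B * exp (L * x)) (at x)" for x
      by (auto intro!: derivative_eq_intros simp: algebra_simps)
  qed (use L_nonneg r in auto)
  then show ?thesis by simp
qed

end


section \<open>Weak solutions of the continuity equation and transported functions\<close>

locale weak_transport = lipschitz_field v L for v :: "real \<Rightarrow> 'a::euclidean_space \<Rightarrow> 'a" and L +
  fixes \<mu> :: "real \<Rightarrow> 'a measure"
  assumes sets_\<mu>: "sets (\<mu> t) = sets borel"
    and prob_\<mu>: "prob_space (\<mu> t)"
    and curve: "((\<lambda>t. dist_MK (\<mu> t) (\<mu> s)) \<longlongrightarrow> 0) (at s)"
    and weak: "test_function \<phi> \<Longrightarrow>
      (\<integral>t. (\<integral>z. frechet_derivative \<phi> (at (t, z)) (1, v t z) \<partial>\<mu> t) \<partial>lborel) = 0"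
begin

lemma integrable_bounded_continuous:
  assumes "continuous_on UNIV f" "\<And>x. \<bar>f x\<bar> \<le> (B::real)"
  shows "integrable (\<mu> t) f"
proof -
  interpret prob_space "\<mu> t" by (rule prob_\<mu>)
  have "f \<in> borel_measurable (\<mu> t)"
    using borel_measurable_continuous_onI[OF assms(1)] measurable_cong_sets[OF sets_\<mu> refl] by blast
  then show ?thesis using assms(2) by (intro integrable_const_bound[where B = B]) auto
qed

text \<open>Both the integrand and the measure vary. The measures are compared through a nearly
  optimal coupling, so the integrand must be controlled by \<eta> + C|x - y|; boundedness together
  with uniform continuity suffices for that.\<close>

lemma continuous_integral:
  fixes g :: "real \<times> 'a \<Rightarrow> real"
  assumes g: "continuous_on UNIV g" and supp: "\<And>p. R < norm p \<Longrightarrow> g p = 0"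
  shows "continuous_on UNIV (\<lambda>t. \<integral>z. g (t, z) \<partial>\<mu> t)"
proof (rule continuous_at_imp_continuous_on, rule ballI)
  fix s
  obtain B where B: "0 \<le> B" "\<And>p. \<bar>g p\<bar> \<le> B" using bounded_compact_support[OF g supp] by blast
  have int: "integrable (\<mu> t) (\<lambda>z. g (t', z))" for t t'
    by (rule integrable_bounded_continuous[OF continuous_on_compose2[OF g]]) (auto intro!: continuous_intros B)
  have "((\<lambda>t. \<integral>z. g (t, z) \<partial>\<mu> t) \<longlongrightarrow> (\<integral>z. g (s, z) \<partial>\<mu> s)) (at s)"
  proof (rule tendstoI)
    fix e :: real assume e: "0 < e"
    obtain d where d: "0 < d" "\<And>p q. dist p q < d \<Longrightarrow> \<bar>g p - g q\<bar> < e / 3"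
      by (rule uniformly_continuous_compact_support[where e = "e / 3", OF g supp]) (use e in auto)
    \<comment> \<open>This slope makes C|x - y| at least 2B as soon as |x - y| \<ge> d/2, where
      uniform continuity gives nothing.\<close>
    define C where "C = 2 * B / (d / 2)"
    have C: "0 \<le> C" using B(1) d(1) by (simp add: C_def)
    define \<eta> where "\<eta> = e / 3 / (C + 1)"
    have \<eta>: "0 < \<eta>" "C * \<eta> \<le> e / 3" using C e by (auto simp: \<eta>_def field_simps)
    have "\<forall>\<^sub>F t in at s. dist_MK (\<mu> t) (\<mu> s) < ennreal \<eta>"
      by (rule order_tendstoD(2)[OF curve]) (use \<eta> in simp)
    moreover have "\<forall>\<^sub>F t in at s. dist t s < d / 2" using d(1) by (auto simp: eventually_at intro!: exI[of _ "d / 2"])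
    ultimately show "\<forall>\<^sub>F t in at s. dist (\<integral>z. g (t, z) \<partial>\<mu> t) (\<integral>z. g (s, z) \<partial>\<mu> s) < e"
    proof eventually_elim
      case (elim t)
      obtain \<pi> where \<pi>: "\<pi> \<in> couplings (\<mu> t) (\<mu> s)" "(\<integral>\<^sup>+p. ennreal (norm (fst p - snd p)) \<partial>\<pi>) < ennreal \<eta>"
        using dist_MK_lessE[OF elim(1)] .
      have "norm ((\<integral>z. g (t, z) \<partial>\<mu> t) - (\<integral>z. g (s, z) \<partial>\<mu> s)) \<le> e / 3 + C * \<eta>"
      proof (rule coupling_integral_diff[OF \<pi>(1) less_imp_le[OF \<pi>(2)] _ int int _ C])
        fix x y
        show "norm (g (t, x) - g (s, y)) \<le> e / 3 + C * norm (x - y)"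
        proof (cases "norm (x - y) < d / 2")
          case True
          have "dist (t, x) (s, y) \<le> dist t s + dist x y"
            by (simp add: dist_Pair_Pair sqrt_sum_squares_le_sum)
          then have "\<bar>g (t, x) - g (s, y)\<bar> < e / 3" using True elim(2) by (intro d) (simp add: dist_norm)
          moreover have "0 \<le> C * norm (x - y)" using C by simp
          ultimately show ?thesis by simp
        next
          case False
          have "norm (g (t, x) - g (s, y)) \<le> B + B"
            by (intro order_trans[OF norm_triangle_ineq4] add_mono) (simp_all add: B)
          also have "\<dots> = C * (d / 2)" using d(1) by (simp add: C_def)
          also have "\<dots> \<le> C * norm (x - y)" using False C by (intro mult_left_mono) auto
          finally show ?thesis using e by simp
        qed
      qed (use \<eta> in auto)
      then show ?case using \<eta>(2) e by (simp add: dist_norm)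
    qed
  qed
  then show "isCont (\<lambda>t. \<integral>z. g (t, z) \<partial>\<mu> t) s" by (simp add: isCont_def)
qed

context
  fixes \<psi> :: "'a \<Rightarrow> real" and r :: real
  assumes lip: "\<bar>\<psi> x - \<psi> y\<bar> \<le> norm (x - y)"
    and supp: "r < norm x \<Longrightarrow> \<psi> x = 0"
begin

text \<open>The solution of the backward transport equation with value \<psi> at time 0: it is
  constant along trajectories, and only Lipschitz in space, hence not yet a test function.\<close>

definition transported :: "real \<times> 'a \<Rightarrow> real" where
  "transported p = \<psi> (flow (fst p) (snd p) 0)"

definition transported_integral :: "real \<Rightarrow> real" where
  "transported_integral t = (\<integral>z. transported (t, z) \<partial>\<mu> t)"

lemma continuous_\<psi>: "continuous_on UNIV \<psi>"
proof -
  have "1-lipschitz_on UNIV \<psi>" by (rule lipschitz_onI) (auto simp: dist_norm lip)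
  then show ?thesis by (rule lipschitz_on_continuous_on)
qed

lemma continuous_transported: "continuous_on UNIV transported"
  unfolding transported_def by (rule continuous_on_compose2[OF continuous_\<psi> continuous_flow_start]) auto

lemma transported_along_flow: "transported (t, flow s z t) = transported (s, z)"
  by (simp add: transported_def flow_flow)

lemma cutoff_support:
  assumes "\<And>t. R < \<bar>t\<bar> \<Longrightarrow> k t = (0::real)"
  obtains R' where "R \<le> R'" "0 \<le> R'" "\<And>p. R' < norm p \<Longrightarrow> k (fst p) * transported p = 0"
proof -
  obtain r' where r': "0 \<le> r'" "\<And>t z. \<bar>t\<bar> \<le> R \<Longrightarrow> r' < norm z \<Longrightarrow> \<psi> (flow t z 0) = 0"
    by (rule flow_start_support[of r \<psi> R, OF supp]) auto
  show ?thesis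
  proof (rule that[of "max R 0 + r'"])
    fix p :: "real \<times> 'a" assume p: "max R 0 + r' < norm p"
    have "norm p \<le> \<bar>fst p\<bar> + norm (snd p)" using norm_Pair_le[of "fst p" "snd p"] by simp
    then have "R < \<bar>fst p\<bar> \<or> r' < norm (snd p)" using p by linarith
    then show "k (fst p) * transported p = 0"
      using assms[of "fst p"] r'(2)[of "fst p" "snd p"] by (cases "R < \<bar>fst p\<bar>") (auto simp: transported_def)
  qed (use r' in auto)
qed

text \<open>The transported function has bounded support at each time but not in space-time.
  Multiplying by a time cutoff \<open>k\<close> that is nonzero at s gives a compactly supported
  integrand; near s the cutoff is divided out again.\<close>

lemma continuous_transported_integral: "continuous_on UNIV transported_integral"
proof (rule continuous_at_imp_continuous_on, rule ballI)
  fix s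
  define k where "k t = max 0 (\<bar>s\<bar> + 2 - \<bar>t\<bar>)" for t :: real
  obtain R' where R': "\<And>p. R' < norm p \<Longrightarrow> k (fst p) * transported p = 0"
    by (rule cutoff_support[of "\<bar>s\<bar> + 2" k]) (auto simp: k_def)
  have "continuous_on UNIV (\<lambda>p. k (fst p) * transported p)"
    unfolding k_def by (intro continuous_intros continuous_transported)
  from continuous_integral[OF this R'] have "continuous_on UNIV (\<lambda>t. k t * transported_integral t)"
    by (simp add: transported_integral_def)
  then have "isCont (\<lambda>t. k t * transported_integral t) s" by (simp add: continuous_on_eq_continuous_at)
  moreover have "isCont k s" unfolding k_def by (intro continuous_intros)
  moreover have "k s \<noteq> 0" by (simp add: k_def)
  ultimately have "isCont (\<lambda>t. k t * transported_integral t / k t) s" by (rule isCont_divide)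
  moreover have "\<forall>\<^sub>F t in nhds s. k t \<noteq> 0"
    using \<open>isCont k s\<close> \<open>k s \<noteq> 0\<close> by (intro tendsto_imp_eventually_ne[where c = "k s"]) (auto simp: isCont_def tendsto_at_iff_tendsto_nhds)
  then have "\<forall>\<^sub>F t in nhds s. k t * transported_integral t / k t = transported_integral t" by eventually_elim simp
  then have "isCont (\<lambda>t. k t * transported_integral t / k t) s = isCont transported_integral s" by (rule isCont_cong)
  ultimately show "isCont transported_integral s" by blast
qed

text \<open>The commutator estimate. From q near p the function \<theta> times the transported
  \<psi> is followed along the true trajectory, where only \<theta> changes, and then compared with
  the straight line of direction (1, v(p)). The two end points differ by at most \<kappa>' \<tau>,
  and the function is Lipschitz in space with constant C. The radius \<epsilon> is uniform in p, as
  one mollifier must serve everywhere; how small \<tau> must be may depend on p.\<close>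

lemma transport_estimate:
  assumes d\<theta>: "\<And>t. (\<theta> has_real_derivative \<theta>' t) (at t)" and c\<theta>': "continuous_on UNIV \<theta>'"
    and \<theta>0: "\<And>t. R < \<bar>t\<bar> \<Longrightarrow> \<theta> t = 0" and \<theta>'0: "\<And>t. R < \<bar>t\<bar> \<Longrightarrow> \<theta>' t = 0" and \<kappa>: "0 < \<kappa>"
  shows "\<exists>\<epsilon>>0. \<epsilon> \<le> 1/4 \<and> (\<forall>p. \<forall>\<^sub>F \<tau> in at_right 0. \<forall>q\<in>cball p \<epsilon>.
       \<bar>\<theta> (fst (q + \<tau> *\<^sub>R (1, v (fst p) (snd p)))) * transported (q + \<tau> *\<^sub>R (1, v (fst p) (snd p))) - \<theta> (fst q) * transported q
         - \<tau> * (\<theta>' (fst p) * transported p)\<bar> \<le> \<tau> * \<kappa>)"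
proof -
  define G where "G p = \<theta>' (fst p) * transported p" for p
  have contG: "continuous_on UNIV G"
    unfolding G_def by (intro continuous_intros continuous_transported continuous_on_compose2[OF c\<theta>']) auto
  obtain R' where R': "\<And>p. R' < norm p \<Longrightarrow> G p = 0"
    by (rule cutoff_support[of R \<theta>']) (use \<theta>'0 in \<open>auto simp: G_def\<close>)
  obtain \<epsilon>1 where \<epsilon>1: "0 < \<epsilon>1" "\<And>p q. dist p q < \<epsilon>1 \<Longrightarrow> \<bar>G p - G q\<bar> < \<kappa> / 2"
    by (rule uniformly_continuous_compact_support[where e = "\<kappa> / 2", OF contG R']) (use \<kappa> in auto)
  have cont\<theta>: "continuous_on UNIV \<theta>"
    by (meson DERIV_isCont continuous_at_imp_continuous_on d\<theta>)
  obtain B where B: "0 \<le> B" "\<And>t. \<bar>\<theta> t\<bar> \<le> B"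
    by (rule bounded_compact_support[OF cont\<theta>, of R]) (use \<theta>0 in auto)
  define C where "C = B * exp (L * \<bar>R\<bar>)"
  have C: "0 \<le> C" using B by (simp add: C_def)
  have lipH: "\<bar>\<theta> t * transported (t, z1) - \<theta> t * transported (t, z2)\<bar> \<le> C * norm (z1 - z2)" for t z1 z2
  proof (cases "\<bar>t\<bar> \<le> R")
    case True
    have "\<bar>transported (t, z1) - transported (t, z2)\<bar> \<le> exp (L * \<bar>0 - t\<bar>) * norm (z1 - z2)"
      unfolding transported_def by (simp, rule order_trans[OF lip], use flow_stable[of t z1 0 z2] in simp)
    also have "\<dots> \<le> exp (L * \<bar>R\<bar>) * norm (z1 - z2)"
      using True L_nonneg by (intro mult_right_mono) (auto intro: mult_left_mono)
    finally have "\<bar>\<theta> t\<bar> * \<bar>transported (t, z1) - transported (t, z2)\<bar> \<le> B * (exp (L * \<bar>R\<bar>) * norm (z1 - z2))"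
      by (intro mult_mono B) auto
    then show ?thesis by (simp add: C_def abs_mult[symmetric] right_diff_distrib mult.assoc)
  qed (use \<theta>0 C in simp)
  define \<kappa>' where "\<kappa>' = \<kappa> / 2 / (C + 1)"
  have \<kappa>': "0 < \<kappa>'" "C * \<kappa>' \<le> \<kappa> / 2" using C \<kappa> by (auto simp: \<kappa>'_def field_simps)
  obtain \<epsilon>2 where \<epsilon>2: "0 < \<epsilon>2" "\<And>s t z. \<bar>s\<bar> \<le> R + 1 \<Longrightarrow> \<bar>t - s\<bar> < \<epsilon>2 \<Longrightarrow> norm (v t z - v s z) \<le> \<kappa>' / 2"
    by (rule time_uniformly_continuous[of "\<kappa>' / 2" "R + 1"]) (use \<kappa>' in auto)
  \<comment> \<open>The bound 1/4 keeps times within the cutoff zone when |t| > R + 1. The other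
    three make \<open>G\<close> vary by less than \<kappa>/2 over distance 4\<epsilon>, and the
    field by at most \<kappa>'/2 over a time lapse 2\<epsilon> and by at most \<kappa>'/2 over a
    space displacement 2\<epsilon>. The divisors 5 and 3 give strict inequalities.\<close>
  define \<epsilon> where "\<epsilon> = min (min (1/4) (\<epsilon>1 / 5)) (min (\<epsilon>2 / 3) (\<kappa>' / (4 * (L + 1))))"
  have \<epsilon>: "0 < \<epsilon>" "\<epsilon> \<le> 1/4" "4 * \<epsilon> < \<epsilon>1" "2 * \<epsilon> < \<epsilon>2" "L * (2 * \<epsilon>) \<le> \<kappa>' / 2"
  proof -
    show "0 < \<epsilon>" using \<epsilon>1 \<epsilon>2 \<kappa>' L_nonneg by (simp add: \<epsilon>_def)
    show "\<epsilon> \<le> 1/4" unfolding \<epsilon>_def by linarith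
    have "\<epsilon> \<le> \<epsilon>1 / 5" "\<epsilon> \<le> \<epsilon>2 / 3" "\<epsilon> \<le> \<kappa>' / (4 * (L + 1))" unfolding \<epsilon>_def by linarith+
    then show "4 * \<epsilon> < \<epsilon>1" "2 * \<epsilon> < \<epsilon>2" using \<epsilon>1 \<epsilon>2 by linarith+
    have "L * (2 * \<epsilon>) \<le> (L + 1) * (2 * (\<kappa>' / (4 * (L + 1))))"
      using \<open>\<epsilon> \<le> \<kappa>' / (4 * (L + 1))\<close> \<open>0 < \<epsilon>\<close> L_nonneg by (intro mult_mono) auto
    also have "\<dots> = \<kappa>' / 2" using L_nonneg by (simp add: field_simps)
    finally show "L * (2 * \<epsilon>) \<le> \<kappa>' / 2" .
  qed
  have est: "\<forall>\<^sub>F \<tau> in at_right 0. \<forall>q\<in>cball p \<epsilon>.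
       \<bar>\<theta> (fst (q + \<tau> *\<^sub>R (1, v (fst p) (snd p)))) * transported (q + \<tau> *\<^sub>R (1, v (fst p) (snd p))) - \<theta> (fst q) * transported q
         - \<tau> * (\<theta>' (fst p) * transported p)\<bar> \<le> \<tau> * \<kappa>" for p
  proof -
    obtain t z where p: "p = (t, z)" by fastforce
    have near: "\<bar>t' - t\<bar> \<le> \<epsilon>" "norm (z' - z) \<le> \<epsilon>" if "(t', z') \<in> cball p \<epsilon>" for t' z'
      using that norm_fst_le[of "t - t'" "z - z'"] norm_snd_le[of "z - z'" "t - t'"]
      by (auto simp: p dist_norm norm_minus_commute abs_minus_commute)
    show ?thesis
    proof (cases "\<bar>t\<bar> \<le> R + 1")
      case False
      have "\<forall>\<^sub>F \<tau> in at_right 0. \<tau> < (1/4 :: real)"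
        using eventually_at_right[of 0 "1 :: real"] by (auto intro!: exI[of _ "1/4"])
      then show ?thesis using eventually_at_right_less[of "0::real"]
      proof eventually_elim
        case (elim \<tau>)
        show ?case
        proof
          fix q assume q: "q \<in> cball p \<epsilon>"
          obtain t' z' where q': "q = (t', z')" by fastforce
          have "R < \<bar>t'\<bar>" "R < \<bar>t' + \<tau>\<bar>" "R < \<bar>t\<bar>" using near[of t' z'] q q' False \<epsilon>(2) elim by auto
          then show "\<bar>\<theta> (fst (q + \<tau> *\<^sub>R (1, v (fst p) (snd p)))) * transported (q + \<tau> *\<^sub>R (1, v (fst p) (snd p))) - \<theta> (fst q) * transported q
              - \<tau> * (\<theta>' (fst p) * transported p)\<bar> \<le> \<tau> * \<kappa>"
            using \<kappa> elim by (simp add: q' p \<theta>0 \<theta>'0)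
        qed
      qed
    next
      case True
      have "compact ((\<lambda>q. v (fst q) (snd q)) ` cball p 4)"
        by (intro compact_continuous_image continuous_on_subset[OF continuous_field]) auto
      then obtain b where b: "\<And>x. x \<in> (\<lambda>q. v (fst q) (snd q)) ` cball p 4 \<Longrightarrow> norm x \<le> b"
        by (metis bounded_iff compact_imp_bounded)
      have vb: "norm (v s x) \<le> b" if "\<bar>s - t\<bar> \<le> 2" "norm (x - z) \<le> 2" for s x
      proof -
        have "dist p (s, x) \<le> \<bar>s - t\<bar> + norm (x - z)"
          using norm_Pair_le[of "t - s" "z - x"] by (simp add: p dist_norm norm_minus_commute abs_minus_commute)
        then have "(s, x) \<in> cball p 4" using that by simp
        then have "v (fst (s, x)) (snd (s, x)) \<in> (\<lambda>q. v (fst q) (snd q)) ` cball p 4" by (rule imageI)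
        then show ?thesis using b by simp
      qed
      have b0: "0 \<le> b" using order_trans[OF norm_ge_zero vb[of t z]] by simp
      \<comment> \<open>Up to time \<tau>0 a trajectory starting in the ball moves by at most
        \<epsilon>. The bound b on the field near p depends on p, and so does \<tau>0.\<close>
      define \<tau>0 where "\<tau>0 = min \<epsilon> (\<epsilon> / ((b + 1) * exp L))"
      have \<tau>0: "0 < \<tau>0" using \<epsilon>(1) b0 by (simp add: \<tau>0_def)
      have "\<forall>\<^sub>F \<tau> in at_right 0. \<tau> < \<tau>0"
        using eventually_at_right[of 0 "\<tau>0"] \<tau>0 by (auto intro!: exI[of _ \<tau>0])
      then show ?thesis using eventually_at_right_less[of "0::real"]
      proof eventually_elim
        case (elim \<tau>)
        have \<tau>: "0 < \<tau>" "\<tau> \<le> \<epsilon>" "b * \<tau> * exp L \<le> \<epsilon>"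
        proof -
          show "0 < \<tau>" "\<tau> \<le> \<epsilon>" using elim by (auto simp: \<tau>0_def)
          have D: "0 < (b + 1) * exp L" using b0 by simp
          have "b * \<tau> * exp L \<le> \<tau> * ((b + 1) * exp L)" using elim by (simp add: algebra_simps)
          also have "\<dots> \<le> \<epsilon>" using elim D by (simp add: \<tau>0_def pos_less_divide_eq less_imp_le)
          finally show "b * \<tau> * exp L \<le> \<epsilon>" .
        qed
        show ?case
        proof
          fix q assume q: "q \<in> cball p \<epsilon>"
          obtain t' z' where q': "q = (t', z')" by fastforce
          note nq = near[OF q[unfolded q']]
          define \<Phi> where "\<Phi> s = flow t' z' s" for s
          have disp: "norm (\<Phi> s - z') \<le> \<epsilon>" if s: "t' \<le> s" "s \<le> t' + \<tau>" for s
          proof -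
            have "norm (flow t' z' s - z') \<le> b * \<bar>s - t'\<bar> * exp (L * \<bar>s - t'\<bar>)"
              by (rule flow_displacement[where \<tau> = 1], rule vb) (use nq \<epsilon>(2) s \<tau> in auto)
            also have "L * \<bar>s - t'\<bar> \<le> L * 1" using s \<tau> \<epsilon>(2) L_nonneg by (intro mult_left_mono) auto
            then have "b * \<bar>s - t'\<bar> * exp (L * \<bar>s - t'\<bar>) \<le> b * \<tau> * exp (L * 1)"
              using s \<tau>(1) b0 by (intro mult_mono) auto
            finally show ?thesis using \<tau>(3) by (simp add: \<Phi>_def)
          qed
          have \<Phi>z: "norm (\<Phi> s - z) \<le> 2 * \<epsilon>" if s: "t' \<le> s" "s \<le> t' + \<tau>" for s
            using norm_triangle_ineq[of "\<Phi> s - z'" "z' - z"] disp[OF s] nq(2) by simp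
          \<comment> \<open>The velocity along the trajectory differs from v(p) by at most
            \<kappa>', half from the change of time and half from the change of place.\<close>
          have drift: "norm (\<Phi> (t' + \<tau>) - z' - \<tau> *\<^sub>R v t z) \<le> \<kappa>' * \<tau>"
          proof -
            have "norm ((\<Phi> (t' + 1 * \<tau>) - \<tau> *\<^sub>R v t z) - (\<Phi> (t' + 1 * 0) - 0 *\<^sub>R v t z)) \<le> \<kappa>' * \<tau> - \<kappa>' * 0"
            proof (rule growth_bound_right[where G = "\<lambda>x. \<Phi> (t' + 1 * x) - x *\<^sub>R v t z"
                  and g = "\<lambda>x. 1 *\<^sub>R v (t' + 1 * x) (\<Phi> (t' + 1 * x)) - v t z" and b = "\<lambda>_. \<kappa>'"])
              show "((\<lambda>x. \<Phi> (t' + 1 * x) - x *\<^sub>R v t z) has_vector_derivative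
                  1 *\<^sub>R v (t' + 1 * x) (\<Phi> (t' + 1 * x)) - v t z) (at x)" for x
                unfolding \<Phi>_def
                by (intro has_vector_derivative_diff has_vector_derivative_affine_comp solvesD[OF solves_flow])
                  (auto intro!: derivative_eq_intros)
              show "((\<lambda>x. \<kappa>' * x) has_real_derivative \<kappa>') (at r)" for r
                by (auto intro!: derivative_eq_intros)
              fix x assume x: "0 < x" "x < \<tau>"
              let ?s = "t' + x"
              have "norm (v ?s (\<Phi> ?s) - v t z) \<le> norm (v ?s (\<Phi> ?s) - v t (\<Phi> ?s)) + norm (v t (\<Phi> ?s) - v t z)"
                using norm_triangle_ineq[of "v ?s (\<Phi> ?s) - v t (\<Phi> ?s)" "v t (\<Phi> ?s) - v t z"] by simp
              also have "norm (v ?s (\<Phi> ?s) - v t (\<Phi> ?s)) \<le> \<kappa>' / 2"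
                by (rule \<epsilon>2(2)) (use True nq x \<tau> \<epsilon>(4) in auto)
              also have "norm (v t (\<Phi> ?s) - v t z) \<le> L * (2 * \<epsilon>)"
                using x by (intro order_trans[OF lipschitz] mult_left_mono \<Phi>z L_nonneg) auto
              finally show "norm (1 *\<^sub>R v (t' + 1 * x) (\<Phi> (t' + 1 * x)) - v t z) \<le> \<kappa>'"
                using \<epsilon>(5) by simp
            qed (use \<tau> in auto)
            then show ?thesis by (simp add: \<Phi>_def algebra_simps)
          qed
          have "\<exists>\<xi>. t' < \<xi> \<and> \<xi> < t' + \<tau> \<and> \<theta> (t' + \<tau>) - \<theta> t' = (t' + \<tau> - t') * \<theta>' \<xi>"
            by (rule MVT2) (use \<tau> d\<theta> in auto)
          then obtain \<xi> where \<xi>: "t' < \<xi>" "\<xi> < t' + \<tau>" "\<theta> (t' + \<tau>) - \<theta> t' = \<tau> * \<theta>' \<xi>" by auto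
          have "dist (\<xi>, \<Phi> \<xi>) p \<le> \<bar>\<xi> - t\<bar> + norm (\<Phi> \<xi> - z)"
            using norm_Pair_le[of "\<xi> - t" "\<Phi> \<xi> - z"] by (simp add: p dist_norm)
          also have "\<dots> < \<epsilon>1" using \<Phi>z[of \<xi>] nq(1) \<xi> \<tau> \<epsilon>(3) by auto
          finally have G: "\<bar>G (\<xi>, \<Phi> \<xi>) - G p\<bar> < \<kappa> / 2" by (rule \<epsilon>1)
          \<comment> \<open>Along the trajectory the transported factor has one value, also at the
            intermediate time \<xi> of the mean value theorem, so it factors out of the increment of
            \<theta>.\<close>
          have "\<theta> (t' + \<tau>) * transported (t' + \<tau>, \<Phi> (t' + \<tau>)) - \<theta> t' * transported (t', z') - \<tau> * G p = \<tau> * (G (\<xi>, \<Phi> \<xi>) - G p)"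
            using \<xi>(3) unfolding \<Phi>_def G_def by (simp add: transported_along_flow algebra_simps flip: distrib_right)
          then have A: "\<bar>\<theta> (t' + \<tau>) * transported (t' + \<tau>, \<Phi> (t' + \<tau>)) - \<theta> t' * transported (t', z') - \<tau> * G p\<bar> \<le> \<tau> * (\<kappa> / 2)"
            using G \<tau>(1) by (simp add: abs_mult)
          have "\<bar>\<theta> (t' + \<tau>) * transported (t' + \<tau>, z' + \<tau> *\<^sub>R v t z) - \<theta> (t' + \<tau>) * transported (t' + \<tau>, \<Phi> (t' + \<tau>))\<bar>
              \<le> C * norm (z' + \<tau> *\<^sub>R v t z - \<Phi> (t' + \<tau>))" by (rule lipH)
          also have "norm (z' + \<tau> *\<^sub>R v t z - \<Phi> (t' + \<tau>)) = norm (\<Phi> (t' + \<tau>) - z' - \<tau> *\<^sub>R v t z)"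
            by (subst norm_minus_commute) (simp add: algebra_simps)
          also have "C * \<dots> \<le> C * (\<kappa>' * \<tau>)" using drift C by (rule mult_left_mono)
          also have "\<dots> \<le> \<kappa> / 2 * \<tau>" using mult_right_mono[OF \<kappa>'(2), of \<tau>] \<tau> by (simp add: mult.assoc)
          finally have "\<bar>\<theta> (t' + \<tau>) * transported (t' + \<tau>, z' + \<tau> *\<^sub>R v t z) - \<theta> t' * transported (t', z') - \<tau> * G p\<bar> \<le> \<tau> * \<kappa>"
            using A by (simp only: mult.commute[of \<tau>] abs_le_iff times_divide_eq_left) linarith
          then show "\<bar>\<theta> (fst (q + \<tau> *\<^sub>R (1, v (fst p) (snd p)))) * transported (q + \<tau> *\<^sub>R (1, v (fst p) (snd p))) - \<theta> (fst q) * transported q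
              - \<tau> * (\<theta>' (fst p) * transported p)\<bar> \<le> \<tau> * \<kappa>"
            by (simp add: q' p G_def)
        qed
      qed
    qed
  qed
  show ?thesis using \<epsilon>(1,2) est by blast
qed

end

end

section \<open>Constancy of transported integrals and representation by the flow\<close>

context weak_transport begin

lemma frechet_derivative_field:
  assumes "test_function \<phi>"
  shows "continuous_on UNIV (\<lambda>p. frechet_derivative \<phi> (at p) (1, v (fst p) (snd p)))"
proof -
  have ck: "Ck k \<phi>" for k using assms by (simp add: test_function_def)
  define D where "D p = Blinfun (frechet_derivative \<phi> (at p))" for p
  have D: "blinfun_apply (D p) = frechet_derivative \<phi> (at p)" for p
    using Ck_SucD(1)[OF ck[of "Suc 0"]] unfolding D_def
    by (intro bounded_linear_Blinfun_apply) (rule has_derivative_bounded_linear)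
  have "continuous_on UNIV D"
    by (rule continuous_on_blinfun_componentwise)
      (use Ck_SucD(2)[OF ck[of "Suc 0"]] in \<open>simp add: D\<close>)
  then have "continuous_on UNIV (\<lambda>p. blinfun_apply (D p) (1, v (fst p) (snd p)))"
    by (intro continuous_intros continuous_field)
  then show ?thesis by (simp add: D)
qed

text \<open>
  The pairings with \<open>\<mu> t\<close> are shown to be continuous in t: a non-integrable function would make the weak formulation
  hold vacuously.
\<close>

lemma weak_time_derivative:
  assumes lip: "\<And>x y. \<bar>\<psi> x - \<psi> y\<bar> \<le> norm (x - y)" and supp: "\<And>x. r < norm x \<Longrightarrow> \<psi> x = 0"
    and d\<theta>: "\<And>t. (\<theta> has_real_derivative \<theta>' t) (at t)" and c\<theta>': "continuous_on UNIV \<theta>'"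
    and \<theta>0: "\<And>t. R < \<bar>t\<bar> \<Longrightarrow> \<theta> t = 0" and \<theta>'0: "\<And>t. R < \<bar>t\<bar> \<Longrightarrow> \<theta>' t = 0"
  shows "(\<integral>t. \<theta>' t * transported_integral \<psi> t \<partial>lborel) = 0"
proof -
  note ch = continuous_transported[where \<psi> = \<psi> and r = r, OF lip supp] and cF = continuous_transported_integral[where \<psi> = \<psi> and r = r, OF lip supp]
  obtain R' where R': "R \<le> R'" "0 \<le> R'" "\<And>p. R' < norm p \<Longrightarrow> \<theta> (fst p) * transported \<psi> p = 0"
    by (rule cutoff_support[of \<psi> r R \<theta>, OF lip supp]) (use \<theta>0 in auto)
  \<comment> \<open>The mollified function vanishes beyond radius R' + \<epsilon> with \<epsilon>
    \<le> 1/4, so its derivative vanishes beyond A. This A is chosen before \<kappa>, which lets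
    \<kappa> tend to 0 at the end.\<close>
  define A where "A = R' + 1"
  have cont\<theta>: "continuous_on UNIV \<theta>"
    by (meson DERIV_isCont continuous_at_imp_continuous_on d\<theta>)
  have cH: "continuous_on UNIV (\<lambda>p. \<theta> (fst p) * transported \<psi> p)"
    by (intro continuous_intros ch continuous_on_compose2[OF cont\<theta>]) auto
  have int_cpt: "integrable lborel f" if "continuous_on UNIV f" "\<And>t. A < \<bar>t\<bar> \<Longrightarrow> f t = (0::real)" for f
  proof -
    have "integrable lborel (\<lambda>t. indicator {-A..A} t *\<^sub>R f t)"
      by (intro borel_integrable_compact continuous_on_subset[OF that(1)]) auto
    moreover have "(\<lambda>t. indicator {-A..A} t *\<^sub>R f t) = f"
    proof
      fix t show "indicator {-A..A} t *\<^sub>R f t = f t"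
        using that(2)[of t] by (cases "\<bar>t\<bar> \<le> A") (auto simp: indicator_def)
    qed
    ultimately show ?thesis by simp
  qed
  have est: "\<bar>\<integral>t. \<theta>' t * transported_integral \<psi> t \<partial>lborel\<bar> \<le> \<kappa> * (2 * A)" if \<kappa>: "0 < \<kappa>" for \<kappa>
  proof -
    obtain \<epsilon> where \<epsilon>: "0 < \<epsilon>" "\<epsilon> \<le> 1/4"
      "\<And>p. \<forall>\<^sub>F \<tau> in at_right 0. \<forall>q\<in>cball p \<epsilon>.
       \<bar>\<theta> (fst (q + \<tau> *\<^sub>R (1, v (fst p) (snd p)))) * transported \<psi> (q + \<tau> *\<^sub>R (1, v (fst p) (snd p))) - \<theta> (fst q) * transported \<psi> q
         - \<tau> * (\<theta>' (fst p) * transported \<psi> p)\<bar> \<le> \<tau> * \<kappa>"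
      using transport_estimate[where R = R and \<psi> = \<psi> and r = r, OF lip supp d\<theta> c\<theta>' \<theta>0 \<theta>'0 \<kappa>] by blast
    obtain \<phi> where \<phi>: "test_function \<phi>" "\<And>p. R' + \<epsilon> < norm p \<Longrightarrow> \<phi> p = 0"
      and approx: "\<And>p w c \<kappa>. \<forall>\<^sub>F \<tau> in at_right 0. \<forall>q\<in>cball p \<epsilon>.
         \<bar>\<theta> (fst (q + \<tau> *\<^sub>R w)) * transported \<psi> (q + \<tau> *\<^sub>R w) - \<theta> (fst q) * transported \<psi> q - \<tau> * c\<bar> \<le> \<tau> * \<kappa>
       \<Longrightarrow> \<bar>frechet_derivative \<phi> (at p) w - c\<bar> \<le> \<kappa>"
      using smooth_approximation[of "\<lambda>p. \<theta> (fst p) * transported \<psi> p" R' \<epsilon>, OF cH R'(3) \<epsilon>(1)] by blast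
    define D where "D p = frechet_derivative \<phi> (at p) (1, v (fst p) (snd p))" for p
    have cD: "continuous_on UNIV D" unfolding D_def by (rule frechet_derivative_field[OF \<phi>(1)])
    have D: "\<bar>D p - \<theta>' (fst p) * transported \<psi> p\<bar> \<le> \<kappa>" for p
      unfolding D_def by (rule approx[OF \<epsilon>(3)])
    have D0: "D p = 0" if p: "A < norm p" for p
    proof -
      have "open {p. R' + \<epsilon> < norm p}" by (intro open_Collect_less continuous_intros)
      then have "(\<phi> has_derivative (\<lambda>_. 0)) (at p)"
        by (rule has_derivative_transform_within_open[of "\<lambda>_. 0", rotated])
          (use p \<epsilon>(2) \<phi>(2) in \<open>auto simp: A_def\<close>)
      from frechet_derivative_at[OF this] show ?thesis by (simp add: D_def fun_eq_iff)
    qed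
    define J where "J t = (\<integral>z. D (t, z) \<partial>\<mu> t)" for t
    have "(\<integral>t. J t \<partial>lborel) = 0" using weak[OF \<phi>(1)] by (simp add: J_def D_def)
    moreover have intJ: "integrable lborel J"
    proof (rule int_cpt)
      show "continuous_on UNIV J" unfolding J_def by (rule continuous_integral[OF cD D0])
      fix t :: real assume "A < \<bar>t\<bar>"
      then have "D (t, z) = 0" for z using norm_fst_le[of t z] by (intro D0) simp
      then show "J t = 0" by (simp add: J_def)
    qed
    moreover have int\<theta>: "integrable lborel (\<lambda>t. \<theta>' t * transported_integral \<psi> t)"
      by (rule int_cpt) (use R'(1) \<theta>'0 in \<open>auto intro!: continuous_intros c\<theta>' cF simp: A_def\<close>)
    ultimately have "\<bar>\<integral>t. \<theta>' t * transported_integral \<psi> t \<partial>lborel\<bar> = \<bar>\<integral>t. \<theta>' t * transported_integral \<psi> t - J t \<partial>lborel\<bar>" by simp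
    also have "\<dots> \<le> (\<integral>t. \<kappa> * indicator {-A..A} t \<partial>lborel)"
    proof (rule integral_abs_bound_integral)
      show "integrable lborel (\<lambda>t. \<kappa> * indicator {-A..A} t)"
        by (intro integrable_mult_right integrable_real_indicator) (auto simp: emeasure_lborel_Icc_eq)
      fix t
      interpret prob_space "\<mu> t" by (rule prob_\<mu>)
      show "\<bar>\<theta>' t * transported_integral \<psi> t - J t\<bar> \<le> \<kappa> * indicator {-A..A} t"
      proof (cases "\<bar>t\<bar> \<le> A")
        case True
        obtain B where B: "\<And>p. \<bar>D p\<bar> \<le> B" using bounded_compact_support[OF cD D0] by blast
        have iD: "integrable (\<mu> t) (\<lambda>z. D (t, z))"
          by (rule integrable_bounded_continuous[OF continuous_on_compose2[OF cD]]) (auto intro!: continuous_intros B)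
        have ih: "integrable (\<mu> t) (\<lambda>z. \<theta>' t * transported \<psi> (t, z))"
        proof (rule integrable_bounded_continuous)
          show "continuous_on UNIV (\<lambda>z. \<theta>' t * transported \<psi> (t, z))"
            by (intro continuous_intros continuous_on_compose2[OF ch]) auto
          show "\<bar>\<theta>' t * transported \<psi> (t, z)\<bar> \<le> \<kappa> + B" for z using D[of "(t, z)"] B[of "(t, z)"] by simp
        qed
        have "\<theta>' t * transported_integral \<psi> t - J t = (\<integral>z. \<theta>' t * transported \<psi> (t, z) - D (t, z) \<partial>\<mu> t)"
          using iD ih by (simp add: transported_integral_def[where \<psi> = \<psi> and r = r, OF lip supp] J_def)
        also have "\<bar>\<dots>\<bar> \<le> (\<integral>z. \<kappa> \<partial>\<mu> t)"
        proof (rule integral_abs_bound_integral)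
          show "\<bar>\<theta>' t * transported \<psi> (t, z) - D (t, z)\<bar> \<le> \<kappa>" for z
            using D[of "(t, z)"] by (simp only: abs_minus_commute fst_conv)
        qed (use iD ih in auto)
        also have "\<dots> = \<kappa>" by (simp add: prob_space)
        finally show ?thesis using True by (simp add: indicator_def abs_le_iff)
      next
        case False
        then have "D (t, z) = 0" for z using norm_fst_le[of t z] by (intro D0) simp
        then show ?thesis using False \<theta>'0[of t] R'(1) \<kappa> by (simp add: J_def A_def)
      qed
    qed (use intJ int\<theta> in auto)
    also have "\<dots> = \<kappa> * (2 * A)" using R'(2) by (simp add: A_def)
    finally show ?thesis .
  qed
  have "((\<lambda>\<kappa>. \<kappa> * (2 * A)) \<longlongrightarrow> 0 * (2 * A)) (at_right 0)" by (intro tendsto_intros)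
  then have "\<bar>\<integral>t. \<theta>' t * transported_integral \<psi> t \<partial>lborel\<bar> \<le> 0 * (2 * A)"
    by (rule tendsto_lowerbound) (auto simp: eventually_at_right_less intro: eventually_mono[OF eventually_at_right_less] est)
  then show ?thesis by simp
qed

text \<open>A continuous function with zero weak derivative is constant. The test derivative is a
  hat around a minus the same hat around 0, so the averages of the transported integral around both
  points agree. Each average is within e of the value at its centre, while the values differ by
  3e.\<close>

lemma transported_integral_constant:
  assumes lip: "\<And>x y. \<bar>\<psi> x - \<psi> y\<bar> \<le> norm (x - y)" and supp: "\<And>x. r < norm x \<Longrightarrow> \<psi> x = 0"
  shows "transported_integral \<psi> a = transported_integral \<psi> 0"
proof (rule ccontr)
  note cF = continuous_transported_integral[where \<psi> = \<psi> and r = r, OF lip supp]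
  assume ne: "transported_integral \<psi> a \<noteq> transported_integral \<psi> 0"
  define e where "e = \<bar>transported_integral \<psi> a - transported_integral \<psi> 0\<bar> / 3"
  have e: "0 < e" using ne by (simp add: e_def)
  have "isCont (transported_integral \<psi>) a" "isCont (transported_integral \<psi>) 0" using cF by (auto simp: continuous_on_eq_continuous_at)
  then obtain d1 d2 where d: "0 < d1" "\<And>t. \<bar>t - a\<bar> < d1 \<Longrightarrow> \<bar>transported_integral \<psi> t - transported_integral \<psi> a\<bar> < e"
    "0 < d2" "\<And>t. \<bar>t\<bar> < d2 \<Longrightarrow> \<bar>transported_integral \<psi> t - transported_integral \<psi> 0\<bar> < e"
    using e unfolding continuous_at_eps_delta dist_real_def by (metis diff_zero)
  define \<delta> where "\<delta> = min d1 d2 / 2"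
  have \<delta>: "0 < \<delta>" "\<delta> < d1" "\<delta> < d2" using d by (auto simp: \<delta>_def)
  define s where "s t = max 0 (\<delta> - \<bar>t\<bar>)" for t :: real
  have cs: "continuous_on S s" for S unfolding s_def by (intro continuous_intros)
  have s0: "0 \<le> s t" "\<delta> \<le> \<bar>t\<bar> \<Longrightarrow> s t = 0" for t by (auto simp: s_def)
  obtain S where "\<And>t. (S has_vector_derivative s t) (at t)"
    using antiderivative_exists[OF cs] by blast
  then have S: "\<And>t. (S has_real_derivative s t) (at t)"
    by (simp add: has_real_derivative_iff_has_vector_derivative)
  have contS: "continuous_on A S" for A
    by (meson DERIV_isCont continuous_at_imp_continuous_on S)
  have S0: "DERIV S t :> 0" if "\<delta> \<le> \<bar>t\<bar>" for t using S[of t] s0(2)[OF that] by simp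
  have Sl: "S t = S (- \<delta>)" if "t \<le> - \<delta>" for t
  proof (cases "t = - \<delta>")
    case False
    then have "t < - \<delta>" using that by simp
    then have "S (- \<delta>) = S t"
      by (rule DERIV_isconst_end[OF _ contS S0]) auto
    then show ?thesis ..
  qed simp
  have Sr: "S t = S \<delta>" if "\<delta> \<le> t" for t
  proof (cases "t = \<delta>")
    case False
    then have "\<delta> < t" using that by simp
    then show ?thesis
      by (rule DERIV_isconst_end[OF _ contS S0]) auto
  qed simp
  have int_s: "integrable lborel (\<lambda>t. s (t + b) * k t)" if k: "continuous_on UNIV k" for b and k :: "real \<Rightarrow> real"
  proof -
    have "integrable lborel (\<lambda>t. indicator (cball (-b) \<delta>) t *\<^sub>R (s (t + b) * k t))"
      by (intro borel_integrable_compact continuous_intros continuous_on_subset[OF k] continuous_on_compose2[OF cs]) auto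
    moreover have "(\<lambda>t. indicator (cball (-b) \<delta>) t *\<^sub>R (s (t + b) * k t)) = (\<lambda>t. s (t + b) * k t)"
      using s0 by (auto simp: fun_eq_iff indicator_def dist_real_def abs_if split: if_splits)
    ultimately show ?thesis by simp
  qed
  define c where "c = (\<integral>t. s t \<partial>lborel)"
  have sm: "s \<in> borel_measurable borel" by (rule borel_measurable_continuous_onI[OF cs])
  have c_shift: "(\<integral>t. s (t + b) \<partial>lborel) = c" for b
    using lborel_integral_shift[OF sm, of b] by (simp add: c_def add.commute)
  have int_s1: "integrable lborel (\<lambda>t. s (t + b))" for b using int_s[of "\<lambda>_. 1" b] by simp
  have c: "0 < c"
  proof -
    have "c \<noteq> 0"
    proof
      assume "c = 0"
      then have "AE t in lborel. s t = 0"
        using integral_nonneg_eq_0_iff_AE[of lborel s] int_s1[of 0] s0 by (simp add: c_def)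
      then have "AE t in lborel. (t::real) \<notin> ball 0 \<delta>"
        by eventually_elim (auto simp: s_def)
      then have "emeasure lborel (ball (0::real) \<delta>) = 0"
        by (subst (asm) AE_iff_measurable[OF _ refl]) (auto simp: ball_def)
      then show False using content_ball_pos[of \<delta> "0::real"] \<delta>(1)
        by (simp add: measure_def)
    qed
    moreover have "0 \<le> c" unfolding c_def by (intro integral_nonneg_AE) (simp add: s0)
    ultimately show ?thesis by simp
  qed
  \<comment> \<open>A hat has nonzero integral, so its antiderivative \<open>S\<close> ends at a
    nonzero constant. In the difference of two translates these end values cancel, which gives
    \<theta> bounded support.\<close>
  have zero: "(\<integral>t. (s (t + - a) - s (t + 0)) * transported_integral \<psi> t \<partial>lborel) = 0"
  proof (rule weak_time_derivative[where \<psi> = \<psi> and r = r, OF lip supp, where \<theta> = "\<lambda>t. S (t + - a) - S (t + 0)" and R = "\<bar>a\<bar> + \<delta>"])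
    show "((\<lambda>t. S (t + - a) - S (t + 0)) has_real_derivative s (t + - a) - s (t + 0)) (at t)" for t
      by (intro DERIV_diff DERIV_shift[THEN iffD1] S)
    show "continuous_on UNIV (\<lambda>t. s (t + - a) - s (t + 0))"
      by (intro continuous_intros continuous_on_compose2[OF cs]) auto
    fix t assume t: "\<bar>a\<bar> + \<delta> < \<bar>t\<bar>"
    show "s (t + - a) - s (t + 0) = 0" using t by (simp add: s_def)
    consider "t < 0" "t \<le> - \<delta>" "t - a \<le> - \<delta>" | "0 \<le> t" "\<delta> \<le> t" "\<delta> \<le> t - a" using t \<delta> by linarith
    then show "S (t + - a) - S (t + 0) = 0"
      by cases (use Sl[of t] Sl[of "t - a"] Sr[of t] Sr[of "t - a"] in auto)
  qed
  have near: "\<bar>(\<integral>t. s (t + b) * transported_integral \<psi> t \<partial>lborel) - c * transported_integral \<psi> (-b)\<bar> \<le> e * c"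
    if b: "\<And>t. \<bar>t + b\<bar> < \<delta> \<Longrightarrow> \<bar>transported_integral \<psi> t - transported_integral \<psi> (-b)\<bar> < e" for b
  proof -
    have "(\<integral>t. s (t + b) * transported_integral \<psi> t \<partial>lborel) - c * transported_integral \<psi> (-b) = (\<integral>t. s (t + b) * transported_integral \<psi> t - s (t + b) * transported_integral \<psi> (-b) \<partial>lborel)"
      using int_s[OF cF, of b] int_s1[of b] by (simp add: c_shift)
    also have "\<bar>\<dots>\<bar> \<le> (\<integral>t. s (t + b) * e \<partial>lborel)"
    proof (rule integral_abs_bound_integral)
      fix t
      show "\<bar>s (t + b) * transported_integral \<psi> t - s (t + b) * transported_integral \<psi> (-b)\<bar> \<le> s (t + b) * e"
      proof (cases "\<bar>t + b\<bar> < \<delta>")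
        case True
        then show ?thesis using b[OF True] s0(1)[of "t + b"]
          by (simp add: right_diff_distrib[symmetric] abs_mult mult_left_mono)
      qed (use s0 in simp)
    qed (use int_s[OF cF, of b] int_s1[of b] in auto)
    also have "\<dots> = e * c" by (simp add: c_shift)
    finally show ?thesis .
  qed
  have na: "\<bar>(\<integral>t. s (t + - a) * transported_integral \<psi> t \<partial>lborel) - c * transported_integral \<psi> (- (- a))\<bar> \<le> e * c"
    by (rule near) (use d(2) \<delta> in auto)
  have n0: "\<bar>(\<integral>t. s (t + 0) * transported_integral \<psi> t \<partial>lborel) - c * transported_integral \<psi> (- 0)\<bar> \<le> e * c"
    by (rule near) (use d(4) \<delta> in auto)
  have "(\<integral>t. s (t + - a) * transported_integral \<psi> t \<partial>lborel) = (\<integral>t. s (t + 0) * transported_integral \<psi> t \<partial>lborel)"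
    using zero int_s[OF cF, of "- a"] int_s[OF cF, of 0] by (simp add: left_diff_distrib)
  then have "\<bar>c * transported_integral \<psi> a - c * transported_integral \<psi> 0\<bar> \<le> 2 * (e * c)" using na n0 by simp
  then have "c * (3 * e) \<le> c * (2 * e)"
    using c by (simp add: right_diff_distrib[symmetric] abs_mult e_def mult_ac)
  then show False using c e by simp
qed

text \<open>Constancy of all transported integrals says that pushing \<open>\<mu> t\<close> back to
  time 0 along the flow gives \<open>\<mu> 0\<close>. Since the flow maps between times 0 and t are
  mutually inverse, pushing forward recovers \<open>\<mu> t\<close>.\<close>

theorem transport_representation: "\<mu> t = distr (\<mu> 0) borel (\<lambda>z. flow 0 z t)"
proof -
  have sp: "space (\<mu> t) = UNIV" for t using sets_eq_imp_space_eq[OF sets_\<mu>] by simp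
  have mX: "(\<lambda>z. flow 0 z t) \<in> borel_measurable borel" for t
    by (intro borel_measurable_continuous_onI continuous_on_compose2[OF continuous_flow_end, of _ "\<lambda>z. (t, z)", simplified])
      (auto intro!: continuous_intros)
  have mY: "(\<lambda>z. flow t z 0) \<in> borel_measurable borel" for t
    by (intro borel_measurable_continuous_onI continuous_on_compose2[OF continuous_flow_start, of _ "\<lambda>z. (t, z)", simplified])
      (auto intro!: continuous_intros)
  have m: "f \<in> \<mu> t \<rightarrow>\<^sub>M borel" if "f \<in> borel_measurable borel" for f :: "'a \<Rightarrow> 'c::topological_space" and t
    using that measurable_cong_sets[OF sets_\<mu> refl] by blast
  have Y: "distr (\<mu> t) borel (\<lambda>z. flow t z 0) = \<mu> 0"
  proof (rule measure_eqI_lipschitz)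
    show "finite_measure (distr (\<mu> t) borel (\<lambda>z. flow t z 0))" "finite_measure (\<mu> 0)"
      using prob_space.prob_space_distr[OF prob_\<mu> m[OF mY]] prob_\<mu> prob_space.finite_measure by blast+
    fix \<psi> :: "'a \<Rightarrow> real" and r
    assume lip: "\<And>x y. \<bar>\<psi> x - \<psi> y\<bar> \<le> norm (x - y)" and supp: "\<And>x. r < norm x \<Longrightarrow> \<psi> x = 0"
    have "(\<integral>x. \<psi> x \<partial>distr (\<mu> t) borel (\<lambda>z. flow t z 0)) = (\<integral>z. \<psi> (flow t z 0) \<partial>\<mu> t)"
      by (rule integral_distr[OF m[OF mY]]) (rule borel_measurable_continuous_onI[OF continuous_\<psi>[where \<psi> = \<psi> and r = r, OF lip supp]])
    also have "\<dots> = transported_integral \<psi> t" by (simp add: transported_integral_def[where \<psi> = \<psi> and r = r, OF lip supp] transported_def[where \<psi> = \<psi> and r = r, OF lip supp])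
    also have "\<dots> = transported_integral \<psi> 0" by (rule transported_integral_constant[where \<psi> = \<psi> and r = r, OF lip supp])
    also have "\<dots> = (\<integral>z. \<psi> z \<partial>\<mu> 0)" by (simp add: transported_integral_def[where \<psi> = \<psi> and r = r, OF lip supp] transported_def[where \<psi> = \<psi> and r = r, OF lip supp])
    finally show "(\<integral>x. \<psi> x \<partial>distr (\<mu> t) borel (\<lambda>z. flow t z 0)) = (\<integral>z. \<psi> z \<partial>\<mu> 0)" .
  qed (simp_all add: sets_\<mu>)
  have "distr (\<mu> 0) borel (\<lambda>z. flow 0 z t) = distr (\<mu> t) borel ((\<lambda>z. flow 0 z t) \<circ> (\<lambda>z. flow t z 0))"
    by (subst Y[symmetric]) (rule distr_distr[OF mX m[OF mY]])
  also have "\<dots> = distr (\<mu> t) (\<mu> t) (\<lambda>z. z)"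
    by (intro distr_cong) (simp_all add: sets_\<mu> flow_flow)
  finally show ?thesis by simp
qed

end

section \<open>Mean-field and particle flows\<close>

lemma kernel_nonneg:
  fixes K :: "'a::euclidean_space \<Rightarrow> 'a \<Rightarrow> 'a"
  assumes "interaction_kernel K L"
  shows "0 \<le> L"
proof -
  obtain b :: 'a where b: "b \<in> Basis" using nonempty_Basis by blast
  have "0 \<le> norm (K b 0 - K 0 0)" by simp
  also have "\<dots> \<le> L * norm (b - 0)" using assms unfolding interaction_kernel_def by blast
  finally show ?thesis using b by simp
qed

lemma kernel_diag:
  assumes "interaction_kernel K L" shows "K z z = 0"
proof -
  have "2 *\<^sub>R K z z = 0" using assms by (simp add: interaction_kernel_def scaleR_2)
  then show ?thesis by simp
qed

lemma kernel_lipschitz: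
  assumes "interaction_kernel K L"
  shows "norm (K x y - K x' y') \<le> L * norm (x - x') + L * norm (y - y')"
proof -
  have "norm (K x y - K x' y') \<le> norm (K x y - K x' y) + norm (K x' y - K x' y')"
    using norm_triangle_ineq[of "K x y - K x' y" "K x' y - K x' y'"] by simp
  also have "\<dots> \<le> L * norm (x - x') + L * norm (y - y')"
    using assms by (intro add_mono) (auto simp: interaction_kernel_def)
  finally show ?thesis .
qed

text \<open>Antisymmetry gives \<open>K x x = 0\<close>, so the Lipschitz bound in one variable,
  started on the diagonal, controls the kernel by the distance of its arguments.\<close>

lemma kernel_bound:
  assumes "interaction_kernel K L" shows "norm (K x y) \<le> L * norm (x - y)"
  using kernel_lipschitz[OF assms, of x y x x] kernel_diag[OF assms, of x] by (simp add: norm_minus_commute)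

lemma kernel_continuous:
  assumes "interaction_kernel K L" "continuous_on A f" "continuous_on A g"
  shows "continuous_on A (\<lambda>x. K (f x) (g x))"
proof -
  have "continuous_on UNIV (\<lambda>p. K (fst p) (snd p))"
    using assms(1) by (simp add: interaction_kernel_def case_prod_beta)
  from continuous_on_compose2[OF this continuous_on_Pair[OF assms(2,3)]] show ?thesis by simp
qed

lemma kernel_measurable:
  assumes "interaction_kernel K L" "f \<in> borel_measurable M" "g \<in> borel_measurable M"
  shows "(\<lambda>x. K (f x) (g x)) \<in> borel_measurable M"
proof -
  have "continuous_on UNIV (\<lambda>p. K (fst p) (snd p))"
    using assms(1) by (simp add: interaction_kernel_def case_prod_beta)
  from borel_measurable_continuous_onI[OF this] have "(\<lambda>x. K (fst (f x, g x)) (snd (f x, g x))) \<in> borel_measurable M"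
    by (rule measurable_compose_rev) (intro borel_measurable_Pair assms)
  then show ?thesis by simp
qed

lemma P1D:
  assumes "\<mu> \<in> P1"
  shows "sets \<mu> = sets borel" "prob_space \<mu>" "space \<mu> = UNIV" "integrable \<mu> norm"
proof -
  show s: "sets \<mu> = sets borel" and "prob_space \<mu>" using assms by (auto simp: P1_def)
  show "space \<mu> = UNIV" using sets_eq_imp_space_eq[OF s] by simp
  have "norm \<in> borel_measurable \<mu>" using measurable_cong_sets[OF s refl] borel_measurable_norm by blast
  then show "integrable \<mu> norm"
    using assms by (intro integrableI_bounded) (auto simp: P1_def top.not_eq_extremum)
qed

lemma P1_measurable: "\<mu> \<in> P1 \<Longrightarrow> f \<in> borel_measurable borel \<Longrightarrow> f \<in> borel_measurable \<mu>"
  using measurable_cong_sets[OF P1D(1) refl] by blast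

lemma P1_integrable_linear_growth:
  fixes f :: "'a::euclidean_space \<Rightarrow> 'b::{banach, second_countable_topology}"
  assumes \<mu>: "\<mu> \<in> P1" and f: "f \<in> borel_measurable borel" and b: "\<And>x. norm (f x) \<le> A + B * norm x"
  shows "integrable \<mu> f"
proof -
  interpret prob_space \<mu> by (rule P1D(2)[OF \<mu>])
  have "integrable \<mu> (\<lambda>x. A + B * norm x)" using P1D(4)[OF \<mu>] by simp
  then show ?thesis
    by (rule Bochner_Integration.integrable_bound) (use P1_measurable[OF \<mu> f] order_trans[OF b abs_ge_self] in auto)
qed

lemma kernel_integrable:
  assumes K: "interaction_kernel K L" and \<mu>: "\<mu> \<in> P1"
  shows "integrable \<mu> (K z)"
proof (rule P1_integrable_linear_growth[OF \<mu>])
  show "K z \<in> borel_measurable borel"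
    by (rule kernel_measurable[OF K]) auto
  fix x
  have "L * norm (z - x) \<le> L * (norm z + norm x)"
    using kernel_nonneg[OF K] by (intro mult_left_mono norm_triangle_ineq4)
  then show "norm (K z x) \<le> L * norm z + L * norm x"
    using kernel_bound[OF K, of z x] by (simp add: algebra_simps)
qed

section \<open>Characteristic flow of the Vlasov equation\<close>

text \<open>The velocity is an average over trajectories weighted by the initial measure \<mu>, so
  the law at time t no longer occurs. This self-consistent form is parallel to the particle system,
  whose velocity is an average over the particles. The exponent is L rather than
  \<open>2 * L\<close> because two trajectories move in the same field.\<close>

definition mean_field_flow ::
    "('a::euclidean_space \<Rightarrow> 'a \<Rightarrow> 'a) \<Rightarrow> real \<Rightarrow> 'a measure \<Rightarrow> (real \<Rightarrow> 'a \<Rightarrow> 'a) \<Rightarrow> bool" where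
  "mean_field_flow K L \<mu> X \<longleftrightarrow>
    continuous_on UNIV (\<lambda>p. X (fst p) (snd p)) \<and>
    (\<forall>z. X 0 z = z) \<and>
    (\<forall>z t. ((\<lambda>s. X s z) has_vector_derivative (\<integral>y. K (X t z) (X t y) \<partial>\<mu>)) (at t)) \<and>
    (\<forall>z. continuous_on UNIV (\<lambda>t. \<integral>y. K (X t z) (X t y) \<partial>\<mu>)) \<and>
    (\<forall>t z z'. norm (X t z - X t z') \<le> exp (L * \<bar>t\<bar>) * norm (z - z'))"

text \<open>Integrating \<open>K z\<close>, which is L-Lipschitz for every z, against two measures
  changes the result by at most L times their Monge-Kantorovich distance. This gives the continuity
  in time, uniform in z, and with it the representation by the flow; the image-measure formula then
  moves the integral to the initial measure.\<close>

lemma vlasov_mean_field_flow: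
  fixes K :: "'a::euclidean_space \<Rightarrow> 'a \<Rightarrow> 'a"
  assumes K: "interaction_kernel K L" and sol: "vlasov_solution K \<mu>in \<mu>"
  obtains X where "mean_field_flow K L \<mu>in X" "\<And>t. \<mu> t = distr \<mu>in borel (X t)"
proof -
  note L = kernel_nonneg[OF K]
  have \<mu>: "\<mu> t \<in> P1" for t using sol by (simp add: vlasov_solution_def)
  define v where "v t z = vlasov_field K (\<mu> t) z" for t z
  interpret weak_transport v L \<mu>
  proof (intro weak_transport.intro lipschitz_field.intro weak_transport_axioms.intro)
    show "0 \<le> L" by (rule L)
    show "norm (v t z - v t z') \<le> L * norm (z - z')" for t z z'
    proof -
      interpret prob_space "\<mu> t" by (rule P1D(2)[OF \<mu>])
      have "v t z - v t z' = (\<integral>y. K z y - K z' y \<partial>\<mu> t)"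
        by (simp add: v_def vlasov_field_def kernel_integrable[OF K \<mu>])
      also have "norm \<dots> \<le> (\<integral>y. norm (K z y - K z' y) \<partial>\<mu> t)" by (rule integral_norm_bound)
      also have "\<dots> \<le> (\<integral>y. L * norm (z - z') \<partial>\<mu> t)"
        using K by (intro integral_mono) (auto simp: kernel_integrable[OF K \<mu>] interaction_kernel_def)
      finally show ?thesis by (simp add: prob_space)
    qed
    show "sets (\<mu> t) = sets borel" "prob_space (\<mu> t)" for t using P1D[OF \<mu>] by auto
    show curve: "((\<lambda>t. dist_MK (\<mu> t) (\<mu> s)) \<longlongrightarrow> 0) (at s)" for s
      using sol by (simp add: vlasov_solution_def)
    show "(\<integral>t. (\<integral>z. frechet_derivative \<phi> (at (t, z)) (1, v t z) \<partial>\<mu> t) \<partial>lborel) = 0"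
      if "test_function \<phi>" for \<phi>
      using sol that by (simp add: vlasov_solution_def v_def)
    fix e :: real and s assume e: "0 < e"
    have "\<forall>\<^sub>F t in at s. dist_MK (\<mu> t) (\<mu> s) < ennreal (e / (L + 1))"
      by (rule order_tendstoD(2)[OF curve]) (use e L in simp)
    then have "\<forall>\<^sub>F t in nhds s. t \<noteq> s \<longrightarrow> dist_MK (\<mu> t) (\<mu> s) < ennreal (e / (L + 1))"
      by (simp add: eventually_at_filter)
    then show "\<forall>\<^sub>F t in nhds s. \<forall>z. norm (v t z - v s z) \<le> e"
    proof eventually_elim
      case (elim t)
      show ?case
      proof (intro allI)
        fix z
        show "norm (v t z - v s z) \<le> e"
        proof (cases "t = s")
          case False
          then obtain \<pi> where \<pi>: "\<pi> \<in> couplings (\<mu> t) (\<mu> s)"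
            "(\<integral>\<^sup>+p. ennreal (norm (fst p - snd p)) \<partial>\<pi>) < ennreal (e / (L + 1))"
            using dist_MK_lessE elim by blast
          have "norm (v t z - v s z) \<le> 0 + L * (e / (L + 1))"
            unfolding v_def vlasov_field_def
            by (rule coupling_integral_diff[OF \<pi>(1) less_imp_le[OF \<pi>(2)]])
              (use e L K in \<open>auto simp: kernel_integrable[OF K \<mu>] interaction_kernel_def\<close>)
          also have "\<dots> \<le> e" using L e by (simp add: field_simps)
          finally show ?thesis .
        qed (use e in simp)
      qed
    qed
  qed
  define X where "X t z = flow 0 z t" for t z
  have \<mu>0: "\<mu> 0 = \<mu>in" using sol by (simp add: vlasov_solution_def)
  have rep: "\<mu> t = distr \<mu>in borel (X t)" for t
    using transport_representation[of t] unfolding X_def \<mu>0 .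
  have cX: "continuous_on UNIV (\<lambda>p. X (fst p) (snd p))"
    unfolding X_def by (rule continuous_flow_end)
  have mX: "X t \<in> borel_measurable borel" for t
  proof -
    have "continuous_on UNIV (\<lambda>z. X (fst (t, z)) (snd (t, z)))"
      by (rule continuous_on_compose2[OF cX]) (auto intro!: continuous_intros)
    then show ?thesis by (simp add: borel_measurable_continuous_onI)
  qed
  have "\<mu>in \<in> P1" using \<mu>[of 0] \<mu>0 by simp
  have v: "v t z = (\<integral>y. K z (X t y) \<partial>\<mu>in)" for t z
    unfolding v_def vlasov_field_def rep
    by (rule integral_distr[OF P1_measurable[OF \<open>\<mu>in \<in> P1\<close> mX]], rule kernel_measurable[OF K]) auto
  have "mean_field_flow K L \<mu>in X"
    unfolding mean_field_flow_def
  proof (intro conjI allI)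
    show "continuous_on UNIV (\<lambda>p. X (fst p) (snd p))" by (rule cX)
    show "X 0 z = z" for z by (simp add: X_def)
    show "((\<lambda>s. X s z) has_vector_derivative (\<integral>y. K (X t z) (X t y) \<partial>\<mu>in)) (at t)" for z t
      unfolding v[symmetric] unfolding X_def by (rule solvesD[OF solves_flow])
    show "continuous_on UNIV (\<lambda>t. \<integral>y. K (X t z) (X t y) \<partial>\<mu>in)" for z
      unfolding v[symmetric] unfolding X_def by (intro continuous_along solves_continuous solves_flow)
    show "norm (X t z - X t z') \<le> exp (L * \<bar>t\<bar>) * norm (z - z')" for t z z'
      using flow_stable[of 0 z t z'] by (simp add: X_def)
  qed
  then show ?thesis using rep that by blast
qed

lemma mean_field_flowD:
  assumes "mean_field_flow K L \<mu> X"
  shows "continuous_on UNIV (\<lambda>p. X (fst p) (snd p))"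
    and "X 0 z = z"
    and "((\<lambda>s. X s z) has_vector_derivative (\<integral>y. K (X t z) (X t y) \<partial>\<mu>)) (at t)"
    and "continuous_on UNIV (\<lambda>t. \<integral>y. K (X t z) (X t y) \<partial>\<mu>)"
    and "norm (X t z - X t z') \<le> exp (L * \<bar>t\<bar>) * norm (z - z')"
    and "X t \<in> borel_measurable borel"
    and "continuous_on UNIV (\<lambda>t. X t z)"
proof -
  show c: "continuous_on UNIV (\<lambda>p. X (fst p) (snd p))"
    and "X 0 z = z"
    and "((\<lambda>s. X s z) has_vector_derivative (\<integral>y. K (X t z) (X t y) \<partial>\<mu>)) (at t)"
    and "continuous_on UNIV (\<lambda>t. \<integral>y. K (X t z) (X t y) \<partial>\<mu>)"
    and "norm (X t z - X t z') \<le> exp (L * \<bar>t\<bar>) * norm (z - z')"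
    using assms unfolding mean_field_flow_def by blast+
  have "continuous_on UNIV (\<lambda>z. X (fst (t, z)) (snd (t, z)))"
    by (rule continuous_on_compose2[OF c]) (auto intro!: continuous_intros)
  then show "X t \<in> borel_measurable borel" by (simp add: borel_measurable_continuous_onI)
  have "continuous_on UNIV (\<lambda>t. X (fst (t, z)) (snd (t, z)))"
    by (rule continuous_on_compose2[OF c]) (auto intro!: continuous_intros)
  then show "continuous_on UNIV (\<lambda>t. X t z)" by simp
qed


section \<open>Empirical measures as laws of a random index\<close>

text \<open>Seen as the law of z at a uniformly chosen index, the empirical measure inherits its
  integrals, null sets and tensor powers from finite counting.\<close>

lemma empirical_measure_eq_distr:
  assumes N: "1 \<le> N"
  shows "empirical_measure N z = distr (measure_pmf (pmf_of_set {..<N})) borel z"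
proof -
  let ?D = "distr (measure_pmf (pmf_of_set {..<N})) borel z"
  have ne: "{..<N} \<noteq> {}" using N by (simp add: lessThan_empty_iff)
  have eq: "(\<Sum>k<N. emeasure (return borel (z k)) A) / of_nat N = emeasure ?D A" if A: "A \<in> sets borel" for A
  proof -
    have "(\<Sum>k<N. emeasure (return borel (z k)) A) = (\<Sum>k<N. if k \<in> z -` A then 1 else 0)"
      using A by (intro sum.cong) (auto simp: indicator_def)
    also have "\<dots> = of_nat (card ({..<N} \<inter> z -` A))"
      by (simp add: sum.If_cases Int_def)
    finally show ?thesis
      using A ne N by (simp add: emeasure_distr emeasure_pmf_of_set ennreal_of_nat_eq_real_of_nat divide_ennreal)
  qed
  have "empirical_measure N z = measure_of UNIV (sets borel) (emeasure ?D)"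
    unfolding empirical_measure_def
    by (rule measure_of_eq)
      (use eq sets.sigma_sets_eq[of "borel :: 'a measure"] in \<open>simp_all del: emeasure_return\<close>)
  also have "\<dots> = ?D" using measure_of_of_measure[of ?D] by simp
  finally show ?thesis .
qed

lemma empirical_measure_integral:
  fixes f :: "'a::euclidean_space \<Rightarrow> 'b::{banach, second_countable_topology}"
  assumes "1 \<le> N" "f \<in> borel_measurable borel"
  shows "integrable (empirical_measure N z) f"
    and "(\<integral>x. f x \<partial>empirical_measure N z) = (1 / real N) *\<^sub>R (\<Sum>k<N. f (z k))"
proof -
  have ne: "{..<N} \<noteq> {}" using assms(1) by (simp add: lessThan_empty_iff)
  show "integrable (empirical_measure N z) f"
    unfolding empirical_measure_eq_distr[OF assms(1)]
    using assms(2) ne by (subst integrable_distr_eq) (auto intro!: integrable_measure_pmf_finite simp: set_pmf_of_set[OF ne])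
  show "(\<integral>x. f x \<partial>empirical_measure N z) = (1 / real N) *\<^sub>R (\<Sum>k<N. f (z k))"
  proof -
    have "(\<integral>x. f x \<partial>empirical_measure N z) = (\<integral>k. f (z k) \<partial>measure_pmf (pmf_of_set {..<N}))"
      unfolding empirical_measure_eq_distr[OF assms(1)] by (rule integral_distr) (use assms(2) in auto)
    also have "\<dots> = (\<Sum>k<N. pmf (pmf_of_set {..<N}) k *\<^sub>R f (z k))"
      by (rule integral_measure_pmf) (simp_all add: set_pmf_of_set[OF ne])
    finally show ?thesis by (simp add: pmf_of_set[OF ne] scaleR_sum_right)
  qed
qed

lemma empirical_measure_prob: "1 \<le> N \<Longrightarrow> prob_space (empirical_measure N z)"
  unfolding empirical_measure_eq_distr
  by (intro prob_space.prob_space_distr) (auto simp: measure_pmf.prob_space_axioms)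

lemma empirical_measure_AE:
  assumes "1 \<le> N"
  shows "AE x in empirical_measure N z. x \<in> z ` {..<N}"
proof -
  have "closed (z ` {..<N})" by (simp add: finite_imp_closed)
  then show ?thesis unfolding empirical_measure_eq_distr[OF assms]
    by (subst AE_distr_iff) (use assms in \<open>auto simp: AE_measure_pmf_iff set_pmf_of_set lessThan_empty_iff\<close>)
qed

section \<open>Stability and equivariance of the particle system\<close>

text \<open>Here \<rho> is the defect with which w satisfies the particle equation. The interaction
  of k with l contributes L q_k + L q_l; averaging over l and summing over k gives 2L times the
  total, independently of N. The sum of the norms is the natural quantity, as it makes both
  contributions equal.\<close>

lemma particle_stability:
  fixes u w \<rho> :: "nat \<Rightarrow> real \<Rightarrow> 'a::euclidean_space" and \<sigma> :: real
  assumes K: "interaction_kernel K L" and N: "1 \<le> N"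
    and du: "\<And>k t. k < N \<Longrightarrow> (u k has_vector_derivative (1 / real N) *\<^sub>R (\<Sum>l<N. K (u k t) (u l t))) (at t)"
    and dw: "\<And>k t. k < N \<Longrightarrow> (w k has_vector_derivative (1 / real N) *\<^sub>R (\<Sum>l<N. K (w k t) (w l t)) + \<rho> k t) (at t)"
    and c\<rho>: "\<And>k. k < N \<Longrightarrow> continuous_on UNIV (\<rho> k)"
    and \<sigma>: "\<bar>\<sigma>\<bar> = 1" and r: "0 \<le> r"
    and b: "\<And>x. 0 \<le> x \<Longrightarrow> x \<le> r \<Longrightarrow> (\<Sum>k<N. norm (\<rho> k (\<sigma> * x))) \<le> b x"
    and dB: "\<And>x. 0 \<le> x \<Longrightarrow> (B has_real_derivative 2 * L * B x + b x) (at x)"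
    and B0: "(\<Sum>k<N. norm (u k 0 - w k 0)) \<le> B 0"
  shows "(\<Sum>k<N. norm (u k (\<sigma> * r) - w k (\<sigma> * r))) \<le> B r"
proof -
  note L = kernel_nonneg[OF K]
  have cu: "continuous_on UNIV (u k)" if "k < N" for k
    using du[OF that] by (rule has_vector_derivative_imp_continuous_on)
  have cw: "continuous_on UNIV (w k)" if "k < N" for k
    using dw[OF that] by (rule has_vector_derivative_imp_continuous_on)
  define g where "g k t = (1 / real N) *\<^sub>R (\<Sum>l<N. K (u k t) (u l t)) -
      ((1 / real N) *\<^sub>R (\<Sum>l<N. K (w k t) (w l t)) + \<rho> k t)" for k t
  have "(\<Sum>k<N. norm (u k (0 + \<sigma> * r) - w k (0 + \<sigma> * r))) \<le> B r"
  proof (rule gronwall_sum_directed[where G = "\<lambda>k t. u k t - w k t" and g = g and c = "2 * L" and b = b, OF _ _ \<sigma> r])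
    fix k assume "k \<in> {..<N}"
    then have k: "k < N" by simp
    show "((\<lambda>t. u k t - w k t) has_vector_derivative g k t) (at t)" for t
      unfolding g_def by (intro has_vector_derivative_diff du dw k)
    show "continuous_on UNIV (g k)"
      unfolding g_def by (intro continuous_intros kernel_continuous[OF K] cu cw c\<rho> k) auto
  next
    fix x assume x: "0 \<le> x" "x \<le> r"
    let ?t = "0 + \<sigma> * x"
    define q where "q k = norm (u k ?t - w k ?t)" for k
    have "norm (g k ?t) \<le> (1 / real N) * (\<Sum>l<N. L * q k + L * q l) + norm (\<rho> k ?t)" for k
    proof -
      have eq: "g k ?t = (1 / real N) *\<^sub>R (\<Sum>l<N. K (u k ?t) (u l ?t) - K (w k ?t) (w l ?t)) - \<rho> k ?t"
        unfolding g_def sum_subtractf scaleR_diff_right by (rule diff_diff_eq[symmetric])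
      have "norm (g k ?t) \<le> norm ((1 / real N) *\<^sub>R (\<Sum>l<N. K (u k ?t) (u l ?t) - K (w k ?t) (w l ?t))) + norm (\<rho> k ?t)"
        unfolding eq by (rule norm_triangle_ineq4)
      also have "\<dots> \<le> (1 / real N) * (\<Sum>l<N. L * q k + L * q l) + norm (\<rho> k ?t)"
      proof -
        have "norm (\<Sum>l<N. K (u k ?t) (u l ?t) - K (w k ?t) (w l ?t)) \<le> (\<Sum>l<N. L * q k + L * q l)"
          unfolding q_def by (rule sum_norm_le) (rule kernel_lipschitz[OF K])
        then show ?thesis by (simp add: divide_right_mono)
      qed
      finally show ?thesis .
    qed
    then have "(\<Sum>k<N. norm (g k ?t)) \<le> (\<Sum>k<N. (1 / real N) * (\<Sum>l<N. L * q k + L * q l) + norm (\<rho> k ?t))"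
      by (rule sum_mono)
    also have "\<dots> = 2 * L * (\<Sum>k<N. q k) + (\<Sum>k<N. norm (\<rho> k ?t))"
    proof -
      have "(1 / real N) * (\<Sum>l<N. L * q k + L * q l) = L * q k + L * (\<Sum>l<N. q l) / real N" for k
        using N by (simp add: sum.distrib flip: sum_distrib_left) (simp add: field_simps)
      then have "(\<Sum>k<N. (1 / real N) * (\<Sum>l<N. L * q k + L * q l)) = (\<Sum>k<N. L * q k + L * (\<Sum>l<N. q l) / real N)"
        by presburger
      also have "\<dots> = 2 * L * (\<Sum>k<N. q k)"
        using N by (simp add: sum.distrib flip: sum_distrib_left)
      finally show ?thesis by (simp only: sum.distrib)
    qed
    finally show "(\<Sum>k<N. norm (g k ?t)) \<le> 2 * L * (\<Sum>k<N. norm (u k ?t - w k ?t)) + b x"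
      using b[OF x] by (simp add: q_def)
  qed (use L dB B0 in auto)
  then show ?thesis by simp
qed

locale particles =
  fixes K :: "'a::euclidean_space \<Rightarrow> 'a \<Rightarrow> 'a" and L :: real and N :: nat
    and T :: "real \<Rightarrow> (nat \<Rightarrow> 'a) \<Rightarrow> (nat \<Rightarrow> 'a)"
  assumes K: "interaction_kernel K L" and N: "1 \<le> N" and flow: "particle_flow K N T"
begin

lemma T_config: "z \<in> config N \<Longrightarrow> T t z \<in> config N"
  and T_start: "z \<in> config N \<Longrightarrow> T 0 z = z"
  and T_deriv: "z \<in> config N \<Longrightarrow> k < N \<Longrightarrow>
    ((\<lambda>s. T s z k) has_vector_derivative (1 / real N) *\<^sub>R (\<Sum>l<N. K (T t z k) (T t z l))) (at t)"
  using flow unfolding particle_flow_def by blast+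

text \<open>The comparison is with any family of curves solving the system, not only with another
  value of the flow. It thus contains uniqueness, which identifies relabelled trajectories, as well
  as Lipschitz dependence on the data.\<close>

lemma T_stable:
  assumes z: "z \<in> config N"
    and dw: "\<And>k t. k < N \<Longrightarrow> (w k has_vector_derivative (1 / real N) *\<^sub>R (\<Sum>l<N. K (w k t) (w l t))) (at t)"
  shows "(\<Sum>k<N. norm (T t z k - w k t)) \<le> exp (2 * L * \<bar>t\<bar>) * (\<Sum>k<N. norm (z k - w k 0))"
proof -
  define \<sigma> :: real where "\<sigma> = (if 0 \<le> t then 1 else -1)"
  have \<sigma>: "\<bar>\<sigma>\<bar> = 1" "\<sigma> * \<bar>t\<bar> = t" by (auto simp: \<sigma>_def)
  have "(\<Sum>k<N. norm (T (\<sigma> * \<bar>t\<bar>) z k - w k (\<sigma> * \<bar>t\<bar>))) \<le> exp (2 * L * \<bar>t\<bar>) * (\<Sum>k<N. norm (z k - w k 0))"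
  proof (rule particle_stability[OF K N T_deriv[OF z], where \<rho> = "\<lambda>_ _. 0" and b = "\<lambda>_. 0"
          and B = "\<lambda>x. exp (2 * L * x) * (\<Sum>k<N. norm (z k - w k 0))"])
    show "(w k has_vector_derivative (1 / real N) *\<^sub>R (\<Sum>l<N. K (w k t) (w l t)) + 0) (at t)" if "k < N" for k t
      using dw[OF that] by simp
    show "((\<lambda>x. exp (2 * L * x) * (\<Sum>k<N. norm (z k - w k 0))) has_real_derivative
        2 * L * (exp (2 * L * x) * (\<Sum>k<N. norm (z k - w k 0))) + 0) (at x)" for x
      by (auto intro!: derivative_eq_intros)
  qed (simp_all add: \<sigma>(1) T_start[OF z])
  then show ?thesis by (simp add: \<sigma>)
qed

lemma T_lipschitz:
  assumes "z \<in> config N" "w \<in> config N"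
  shows "(\<Sum>k<N. norm (T t z k - T t w k)) \<le> exp (2 * L * \<bar>t\<bar>) * (\<Sum>k<N. norm (z k - w k))"
  using T_stable[OF assms(1), of "\<lambda>k t. T t w k" t] T_deriv[OF assms(2)] T_start[OF assms(2)] by simp

text \<open>Relabelled trajectories solve the same system, because the sum over l does not see the
  labels, and they have the relabelled initial data. Outside \<open>{..<N}\<close> both sides are
  \<open>undefined\<close>.\<close>

lemma T_permute:
  assumes z: "z \<in> config N" and \<sigma>: "\<sigma> permutes {..<N}"
  shows "T t (\<lambda>i\<in>{..<N}. z (\<sigma> i)) = (\<lambda>i\<in>{..<N}. T t z (\<sigma> i))"
proof -
  let ?z = "\<lambda>i\<in>{..<N}. z (\<sigma> i)"
  have \<sigma>N: "\<sigma> k < N" if "k < N" for k using permutes_in_image[OF \<sigma>, of k] that by simp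
  have zc: "?z \<in> config N" by auto
  have "(\<Sum>k<N. norm (T t ?z k - T t z (\<sigma> k))) \<le> exp (2 * L * \<bar>t\<bar>) * (\<Sum>k<N. norm (?z k - T 0 z (\<sigma> k)))"
  proof (rule T_stable[OF zc])
    fix k t assume "k < N"
    have "(\<Sum>l<N. K (T t z (\<sigma> k)) (T t z (\<sigma> l))) = (\<Sum>l<N. K (T t z (\<sigma> k)) (T t z l))"
      using sum.permute[OF \<sigma>, of "\<lambda>l. K (T t z (\<sigma> k)) (T t z l)"] by (simp add: o_def)
    then show "((\<lambda>t. T t z (\<sigma> k)) has_vector_derivative (1 / real N) *\<^sub>R (\<Sum>l<N. K (T t z (\<sigma> k)) (T t z (\<sigma> l)))) (at t)"
      using T_deriv[OF z \<sigma>N[OF \<open>k < N\<close>], of t] by simp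
  qed
  also have "\<dots> = 0" by (simp add: T_start[OF z])
  finally have "(\<Sum>k<N. norm (T t ?z k - T t z (\<sigma> k))) = 0"
    by (intro antisym sum_nonneg) auto
  then have "T t ?z k = T t z (\<sigma> k)" if "k < N" for k
    using that by (simp add: sum_nonneg_eq_0_iff)
  moreover have "T t ?z k = undefined" if "\<not> k < N" for k
    using T_config[OF zc, of t] that by (auto simp: PiE_def extensional_def)
  ultimately show ?thesis by (auto simp: fun_eq_iff)
qed

text \<open>The transposition of k and l fixes z, hence by equivariance it fixes the trajectory. So
  a trajectory is determined by the initial position, even when positions repeat.\<close>

lemma T_coincide:
  assumes z: "z \<in> config N" and kl: "k < N" "l < N" "z k = z l"
  shows "T t z k = T t z l"
proof -
  define \<sigma> where "\<sigma> = Transposition.transpose k l"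
  have \<sigma>: "\<sigma> permutes {..<N}" unfolding \<sigma>_def using kl(1,2) by (intro permutes_swap_id) simp_all
  have "(\<lambda>i\<in>{..<N}. z (\<sigma> i)) = z"
  proof
    fix i
    have "z (\<sigma> i) = z i" unfolding \<sigma>_def Transposition.transpose_def using kl(3) by presburger
    then show "(\<lambda>i\<in>{..<N}. z (\<sigma> i)) i = z i" using PiE_arb[OF z, of i] by (cases "i < N") auto
  qed
  moreover have "T t (\<lambda>i\<in>{..<N}. z (\<sigma> i)) k = T t z (\<sigma> k)"
    using kl(1) by (simp add: T_permute[OF z \<sigma>])
  moreover have "\<sigma> k = l" by (simp add: \<sigma>_def)
  ultimately show ?thesis by simp
qed

end

section \<open>Stability in the Monge--Kantorovich distance\<close>

lemma continuous_bounded_interval: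
  fixes f :: "real \<Rightarrow> 'a::real_normed_vector"
  assumes "continuous_on UNIV f"
  obtains b where "0 \<le> b" "\<And>s. \<bar>s\<bar> \<le> R \<Longrightarrow> norm (f s) \<le> b"
proof -
  have "compact (f ` {-R..R})"
    by (intro compact_continuous_image continuous_on_subset[OF assms]) auto
  then obtain b where b: "\<And>x. x \<in> f ` {-R..R} \<Longrightarrow> norm x \<le> b"
    by (metis bounded_iff compact_imp_bounded)
  show ?thesis
  proof (rule that[of "max b 0"])
    show "norm (f s) \<le> max b 0" if "\<bar>s\<bar> \<le> R" for s
      using b[of "f s"] that by (auto simp: abs_le_iff le_max_iff_disj)
  qed simp
qed

lemma coupling_measurable_fst: "\<pi> \<in> couplings \<mu> \<nu> \<Longrightarrow> f \<in> borel_measurable borel \<Longrightarrow> (\<lambda>p. f (fst p)) \<in> borel_measurable \<pi>"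
  and coupling_measurable_snd: "\<pi> \<in> couplings \<mu> \<nu> \<Longrightarrow> f \<in> borel_measurable borel \<Longrightarrow> (\<lambda>p. f (snd p)) \<in> borel_measurable \<pi>"
  for f :: "'a::euclidean_space \<Rightarrow> 'b::topological_space"
proof -
  assume \<pi>: "\<pi> \<in> couplings \<mu> \<nu>" and f: "f \<in> borel_measurable borel"
  have [measurable]: "fst \<in> \<pi> \<rightarrow>\<^sub>M borel" "snd \<in> \<pi> \<rightarrow>\<^sub>M borel"
    by (simp_all add: couplingD[OF \<pi>] measurable_cong_sets[OF couplingD(1)[OF \<pi>] refl]
        borel_measurable_continuous_onI continuous_on_fst continuous_on_snd)
  show "(\<lambda>p. f (fst p)) \<in> borel_measurable \<pi>" "(\<lambda>p. f (snd p)) \<in> borel_measurable \<pi>"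
    using f by measurable
qed

context particles begin

text \<open>
  Gronwall is applied pointwise on the support of the coupling, with the mean distance at time s replaced by its
  supremum \<open>A\<close> weighted by \<open>exp (- (2 * L * \<bar>s\<bar>))\<close>; integrating then forces \<open>A \<le> D 0\<close>. This needs neither
  measurability nor continuity of the mean distance in time.
\<close>

lemma dobrushin_coupling:
  assumes \<nu>: "\<nu> \<in> P1" and X: "mean_field_flow K L \<nu> X" and Z: "Z \<in> config N"
    and \<pi>: "\<pi> \<in> couplings (empirical_measure N Z) \<nu>"
    and cost: "(\<integral>\<^sup>+p. ennreal (norm (fst p - snd p)) \<partial>\<pi>) \<le> ennreal d" and d: "0 \<le> d"
  shows "\<exists>\<pi>'\<in>couplings (empirical_measure N (T t Z)) (distr \<nu> borel (X t)).
    (\<integral>\<^sup>+p. ennreal (norm (fst p - snd p)) \<partial>\<pi>') \<le> ennreal (exp (2 * L * \<bar>t\<bar>) * d)"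
proof -
  note L = kernel_nonneg[OF K]
  note X = mean_field_flowD[OF X]
  interpret \<pi>: prob_space \<pi> by (rule couplingD(2)[OF \<pi>])
  \<comment> \<open>An index of a particle sitting at x, which turns the flow on labels into a map
    \<open>Y s\<close> on positions. Off the particles the index is 0, legitimate since N \<ge> 1,
    so \<open>Y s\<close> is constant outside a finite set and hence measurable.\<close>
  define j where "j x = (if x \<in> Z ` {..<N} then SOME k. k < N \<and> Z k = x else 0)" for x
  have jS: "j x < N \<and> Z (j x) = x" if x: "x \<in> Z ` {..<N}" for x
  proof -
    have "\<exists>k. k < N \<and> Z k = x" using x by auto
    from someI_ex[OF this] show ?thesis using x by (simp add: j_def)
  qed
  have jN: "j x < N" for x using jS[of x] N by (cases "x \<in> Z ` {..<N}") (auto simp: j_def)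
  define Y where "Y s x = T s Z (j x)" for s x
  have YZ: "Y s (Z k) = T s Z k" if "k < N" for s k
    unfolding Y_def using jS[of "Z k"] that by (intro T_coincide[OF Z]) auto
  have mY: "Y s \<in> borel_measurable borel" for s
  proof (rule measurable_discrete_difference[where X = "Z ` {..<N}"])
    show "(\<lambda>_. T s Z 0) \<in> borel_measurable borel" by simp
    show "countable (Z ` {..<N})" by (simp add: countable_finite)
    show "T s Z 0 = Y s x" if "x \<in> space borel" "x \<notin> Z ` {..<N}" for x
      using that by (simp add: Y_def j_def)
  qed auto
  have cT: "continuous_on UNIV (\<lambda>s. T s Z k)" if "k < N" for k
    using T_deriv[OF Z that] by (rule has_vector_derivative_imp_continuous_on)
  define q where "q s p = norm (Y s (fst p) - X s (snd p))" for s p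
  define D where "D s = (\<integral>p. q s p \<partial>\<pi>)" for s
  have mq: "q s \<in> borel_measurable \<pi>" for s
    using measurable_compose[OF borel_measurable_diff[OF coupling_measurable_fst[OF \<pi> mY]
        coupling_measurable_snd[OF \<pi> X(6)]] borel_measurable_norm] unfolding q_def .
  define R where "R = \<bar>t\<bar>"
  have int_snd: "integrable \<pi> (\<lambda>p. norm (snd p))" by (rule coupling_integral(3)[OF \<pi> P1D(4)[OF \<nu>]])
  \<comment> \<open>The finitely many particles are bounded on the time interval and X grows at most
    linearly in its starting point. As \<nu> has a first moment, all mean distances are bounded by
    one number and the supremum below is finite.\<close>
  obtain M where M: "0 \<le> M" "\<And>s p. \<bar>s\<bar> \<le> R \<Longrightarrow> q s p \<le> M + exp (L * R) * norm (snd p)"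
  proof -
    have "\<exists>b\<ge>0. \<forall>s. \<bar>s\<bar> \<le> R \<longrightarrow> norm (T s Z k) \<le> b" if "k < N" for k
      using continuous_bounded_interval[OF cT[OF that], of R] by metis
    then obtain b where b: "\<And>k. k < N \<Longrightarrow> 0 \<le> b k" "\<And>k s. k < N \<Longrightarrow> \<bar>s\<bar> \<le> R \<Longrightarrow> norm (T s Z k) \<le> b k" by metis
    obtain b' where b': "0 \<le> b'" "\<And>s. \<bar>s\<bar> \<le> R \<Longrightarrow> norm (X s 0) \<le> b'"
      using continuous_bounded_interval[OF X(7)[of 0], of R] by metis
    show ?thesis
    proof (rule that[of "(\<Sum>k<N. b k) + b'"])
      show "0 \<le> (\<Sum>k<N. b k) + b'" using b b' by (auto intro!: add_nonneg_nonneg sum_nonneg)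
      fix s and p :: "'a \<times> 'a" assume s: "\<bar>s\<bar> \<le> R"
      have "norm (Y s (fst p)) \<le> b (j (fst p))" unfolding Y_def by (intro b jN s)
      also have "\<dots> \<le> (\<Sum>k<N. b k)" using jN b(1) by (intro member_le_sum) auto
      finally have 1: "norm (Y s (fst p)) \<le> (\<Sum>k<N. b k)" .
      have "norm (X s (snd p) - X s 0) \<le> exp (L * \<bar>s\<bar>) * norm (snd p)" using X(5)[of s "snd p" 0] by simp
      also have "\<dots> \<le> exp (L * R) * norm (snd p)" using s L by (intro mult_right_mono) (auto intro: mult_left_mono)
      finally have "norm (X s (snd p)) \<le> exp (L * R) * norm (snd p) + b'"
        using b'(2)[OF s] norm_triangle_ineq2[of "X s (snd p)" "X s 0"] by linarith
      then show "q s p \<le> (\<Sum>k<N. b k) + b' + exp (L * R) * norm (snd p)"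
        using 1 norm_triangle_ineq4[of "Y s (fst p)" "X s (snd p)"] unfolding q_def by linarith
    qed
  qed
  have q0: "0 \<le> q s p" for s p by (simp add: q_def)
  have intq: "integrable \<pi> (q s)" if s: "\<bar>s\<bar> \<le> R" for s
  proof (rule Bochner_Integration.integrable_bound[OF _ mq])
    show "integrable \<pi> (\<lambda>p. M + exp (L * R) * norm (snd p))" using int_snd by simp
    show "AE p in \<pi>. norm (q s p) \<le> norm (M + exp (L * R) * norm (snd p))"
      using M(2)[OF s] q0[of s] M(1) by (auto intro!: AE_I2)
  qed
  define M' where "M' = M + exp (L * R) * (\<integral>p. norm (snd p) \<partial>\<pi>)"
  have DM: "D s \<le> M'" if s: "\<bar>s\<bar> \<le> R" for s
  proof -
    have "D s \<le> (\<integral>p. M + exp (L * R) * norm (snd p) \<partial>\<pi>)"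
      unfolding D_def using M(2)[OF s] intq[OF s] int_snd by (intro integral_mono) auto
    also have "\<dots> = M'" using int_snd by (simp add: M'_def \<pi>.prob_space)
    finally show ?thesis .
  qed
  have D0: "0 \<le> D s" for s unfolding D_def by (intro integral_nonneg_AE) (simp add: q0)
  define A where "A = (SUP s\<in>{-R..R}. exp (- (2 * L * \<bar>s\<bar>)) * D s)"
  have R0: "0 \<le> R" by (simp add: R_def)
  have bdd: "bdd_above ((\<lambda>s. exp (- (2 * L * \<bar>s\<bar>)) * D s) ` {-R..R})"
  proof (rule bdd_aboveI2)
    fix s assume "s \<in> {-R..R}"
    then have "D s \<le> M'" by (intro DM) auto
    moreover have "exp (- (2 * L * \<bar>s\<bar>)) * D s \<le> 1 * D s"
      using L D0 by (intro mult_right_mono) auto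
    ultimately show "exp (- (2 * L * \<bar>s\<bar>)) * D s \<le> M'" by simp
  qed
  have DA: "D s \<le> A * exp (2 * L * \<bar>s\<bar>)" if s: "\<bar>s\<bar> \<le> R" for s
  proof -
    have "exp (- (2 * L * \<bar>s\<bar>)) * D s \<le> A"
      unfolding A_def by (rule cSUP_upper[OF _ bdd]) (use s in \<open>auto simp: abs_le_iff\<close>)
    then have "exp (2 * L * \<bar>s\<bar>) * (exp (- (2 * L * \<bar>s\<bar>)) * D s) \<le> exp (2 * L * \<bar>s\<bar>) * A"
      by (intro mult_left_mono) auto
    moreover have "exp (2 * L * \<bar>s\<bar>) * (exp (- (2 * L * \<bar>s\<bar>)) * D s) = D s"
      by (simp add: mult.assoc[symmetric] mult_exp_exp)
    ultimately show ?thesis by (simp only: mult.commute[of A])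
  qed
  have A0: "D 0 \<le> A" using DA[of 0] R0 by simp
  \<comment> \<open>The comparison function
    \<open>exp (L * r) * q 0 p + A * (exp (2 * L * r) - exp (L * r))\<close> solves B' = L B + L A
    exp(2 L r). One L comes from the pair p itself, the other from the mean distance, bounded
    through A.\<close>
  have q_est: "q s p \<le> exp (L * \<bar>s\<bar>) * q 0 p + A * (exp (2 * L * \<bar>s\<bar>) - exp (L * \<bar>s\<bar>))" if s: "\<bar>s\<bar> \<le> R" for s p
  proof -
    obtain x y where p: "p = (x, y)" by fastforce
    define g where "g r = (1 / real N) *\<^sub>R (\<Sum>l<N. K (T r Z (j x)) (T r Z l)) - (\<integral>y'. K (X r y) (X r y') \<partial>\<nu>)" for r
    have "(\<Sum>k\<in>{()}. norm (T s Z (j x) - X s y)) \<le> exp (L * \<bar>s - 0\<bar>) * q 0 p + A * (exp (2 * L * \<bar>s - 0\<bar>) - exp (L * \<bar>s - 0\<bar>))"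
    proof (rule gronwall_sum[where G = "\<lambda>_ r. T r Z (j x) - X r y" and g = "\<lambda>_. g" and c = L and R = R
          and b = "\<lambda>r. L * A * exp (2 * L * r)" and B = "\<lambda>r. exp (L * r) * q 0 p + A * (exp (2 * L * r) - exp (L * r))"])
      show "((\<lambda>r. T r Z (j x) - X r y) has_vector_derivative g r) (at r)" for r
        unfolding g_def by (intro has_vector_derivative_diff T_deriv[OF Z jN] X)
      show "continuous_on UNIV g"
        unfolding g_def by (intro continuous_intros kernel_continuous[OF K] cT jN X) auto
      show "((\<lambda>r. exp (L * r) * q 0 p + A * (exp (2 * L * r) - exp (L * r))) has_real_derivative
         L * (exp (L * r) * q 0 p + A * (exp (2 * L * r) - exp (L * r))) + L * A * exp (2 * L * r)) (at r)" for r
        by (auto intro!: derivative_eq_intros simp: algebra_simps)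
      show "(\<Sum>k\<in>{()}. norm (T 0 Z (j x) - X 0 y)) \<le> exp (L * 0) * q 0 p + A * (exp (2 * L * 0) - exp (L * 0))"
        by (simp add: q_def p Y_def)
      fix r assume r: "\<bar>r - 0\<bar> \<le> R"
      have mK: "(\<lambda>x'. K (Y r x) (Y r x')) \<in> borel_measurable borel"
        by (intro kernel_measurable[OF K] mY) auto
      have mK': "(\<lambda>y'. K (X r y) (X r y')) \<in> borel_measurable borel"
        by (intro kernel_measurable[OF K] X) auto
      have iK: "integrable (empirical_measure N Z) (\<lambda>x'. K (Y r x) (Y r x'))"
        by (rule empirical_measure_integral(1)[OF N mK])
      have iK': "integrable \<nu> (\<lambda>y'. K (X r y) (X r y'))"
      proof (rule P1_integrable_linear_growth[OF \<nu> mK'])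
        fix y'
        have "norm (K (X r y) (X r y')) \<le> L * norm (X r y - X r y')" by (rule kernel_bound[OF K])
        also have "\<dots> \<le> L * (exp (L * \<bar>r\<bar>) * norm (y - y'))" by (intro mult_left_mono X L)
        also have "\<dots> \<le> L * (exp (L * \<bar>r\<bar>) * (norm y + norm y'))"
          by (intro mult_left_mono norm_triangle_ineq4 L) auto
        finally show "norm (K (X r y) (X r y')) \<le> L * exp (L * \<bar>r\<bar>) * norm y + L * exp (L * \<bar>r\<bar>) * norm y'"
          by (simp add: algebra_simps)
      qed
      have "(\<Sum>l<N. K (Y r x) (Y r (Z l))) = (\<Sum>l<N. K (T r Z (j x)) (T r Z l))"
        by (intro sum.cong refl) (simp add: YZ, simp add: Y_def)
      \<comment> \<open>Both velocities become integrals against the initial marginals of \<pi>, and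
        so one integral against \<pi>, where the kernel is compared argument by argument.\<close>
      then have "g r = (\<integral>x'. K (Y r x) (Y r x') \<partial>empirical_measure N Z) - (\<integral>y'. K (X r y) (X r y') \<partial>\<nu>)"
        by (simp add: g_def empirical_measure_integral(2)[OF N mK])
      also have "\<dots> = (\<integral>p'. K (Y r x) (Y r (fst p')) - K (X r y) (X r (snd p')) \<partial>\<pi>)"
        by (simp add: coupling_integral(2)[OF \<pi> iK] coupling_integral(4)[OF \<pi> iK']
            coupling_integral(1)[OF \<pi> iK] coupling_integral(3)[OF \<pi> iK'])
      finally have "norm (g r) \<le> (\<integral>p'. norm (K (Y r x) (Y r (fst p')) - K (X r y) (X r (snd p'))) \<partial>\<pi>)"
        by simp
      also have "\<dots> \<le> (\<integral>p'. L * q r p + L * q r p' \<partial>\<pi>)"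
      proof (rule integral_mono)
        show "integrable \<pi> (\<lambda>p'. norm (K (Y r x) (Y r (fst p')) - K (X r y) (X r (snd p'))))"
          using coupling_integral(1)[OF \<pi> iK] coupling_integral(3)[OF \<pi> iK'] by simp
        show "integrable \<pi> (\<lambda>p'. L * q r p + L * q r p')" using intq[of r] r by simp
        show "norm (K (Y r x) (Y r (fst p')) - K (X r y) (X r (snd p'))) \<le> L * q r p + L * q r p'" for p'
          using kernel_lipschitz[OF K] by (simp add: q_def p)
      qed
      also have "\<dots> = L * q r p + L * D r" using intq[of r] r by (simp add: D_def \<pi>.prob_space)
      also have "\<dots> \<le> L * q r p + L * (A * exp (2 * L * \<bar>r\<bar>))"
        using DA[of r] r L by (intro add_left_mono mult_left_mono) auto
      finally show "(\<Sum>k\<in>{()}. norm (g r)) \<le> L * (\<Sum>k\<in>{()}. norm (T r Z (j x) - X r y)) + L * A * exp (2 * L * \<bar>r - 0\<bar>)"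
        by (simp add: q_def p Y_def mult.assoc)
    qed (use L s in auto)
    then show ?thesis by (simp add: q_def p Y_def)
  qed
  have Dest: "D s \<le> exp (L * \<bar>s\<bar>) * D 0 + A * (exp (2 * L * \<bar>s\<bar>) - exp (L * \<bar>s\<bar>))" if s: "\<bar>s\<bar> \<le> R" for s
  proof -
    have i0: "integrable \<pi> (q 0)" using intq[of 0] R0 by simp
    have "D s \<le> (\<integral>p. exp (L * \<bar>s\<bar>) * q 0 p + A * (exp (2 * L * \<bar>s\<bar>) - exp (L * \<bar>s\<bar>)) \<partial>\<pi>)"
      unfolding D_def using q_est[OF s] intq[OF s] i0 by (intro integral_mono) auto
    also have "\<dots> = exp (L * \<bar>s\<bar>) * D 0 + A * (exp (2 * L * \<bar>s\<bar>) - exp (L * \<bar>s\<bar>))"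
      using i0 by (simp add: D_def \<pi>.prob_space)
    finally show ?thesis .
  qed
  \<comment> \<open>If A exceeded D 0, the weighted mean distances would stay below A by a fixed
    amount on the whole interval, contrary to A being their supremum.\<close>
  have "A \<le> A - (A - D 0) * exp (- (L * R))"
    unfolding A_def
  proof (rule cSUP_least)
    show "{-R..R} \<noteq> {}" using R0 by simp
    fix s assume "s \<in> {-R..R}"
    then have s: "\<bar>s\<bar> \<le> R" by auto
    have "exp (- (2 * L * \<bar>s\<bar>)) * D s \<le> exp (- (2 * L * \<bar>s\<bar>)) * (exp (L * \<bar>s\<bar>) * D 0 + A * (exp (2 * L * \<bar>s\<bar>) - exp (L * \<bar>s\<bar>)))"
      using Dest[OF s] by (intro mult_left_mono) auto
    also have "\<dots> = (exp (- (2 * L * \<bar>s\<bar>)) * exp (L * \<bar>s\<bar>)) * D 0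
        + A * (exp (- (2 * L * \<bar>s\<bar>)) * exp (2 * L * \<bar>s\<bar>) - exp (- (2 * L * \<bar>s\<bar>)) * exp (L * \<bar>s\<bar>))"
      by (simp only: algebra_simps)
    also have "\<dots> = A - (A - D 0) * exp (- (L * \<bar>s\<bar>))"
      by (simp add: mult_exp_exp left_diff_distrib right_diff_distrib)
    also have "\<dots> \<le> A - (A - D 0) * exp (- (L * R))"
      using A0 s L by (intro diff_left_mono mult_left_mono) (auto intro: mult_left_mono)
    finally show "exp (- (2 * L * \<bar>s\<bar>)) * D s \<le>
       (SUP s\<in>{-R..R}. exp (- (2 * L * \<bar>s\<bar>)) * D s) - ((SUP s\<in>{-R..R}. exp (- (2 * L * \<bar>s\<bar>)) * D s) - D 0) * exp (- (L * R))"
      by (simp only: A_def)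
  qed
  then have AD: "A \<le> D 0" by (simp add: mult_le_0_iff)
  \<comment> \<open>On particle positions \<open>Y 0\<close> is the identity, while elsewhere it
    takes an arbitrary value. The first marginal charges only particle positions, so D 0 is the cost
    of \<pi>.\<close>
  have "AE p in \<pi>. fst p \<in> Z ` {..<N}"
  proof -
    have cl: "{x \<in> space borel. x \<in> Z ` {..<N}} \<in> sets borel" by (simp add: finite_imp_closed)
    have "fst \<in> \<pi> \<rightarrow>\<^sub>M borel" using coupling_measurable_fst[OF \<pi>, of "\<lambda>x. x"] by simp
    from AE_distr_iff[OF this cl] show ?thesis
      using empirical_measure_AE[OF N, of Z, folded couplingD(3)[OF \<pi>]] by blast
  qed
  then have "AE p in \<pi>. q 0 p = norm (fst p - snd p)"
  proof eventually_elim
    case (elim p)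
    then show ?case using jS[of "fst p"] by (simp add: q_def Y_def T_start[OF Z] X)
  qed
  then have "D 0 = (\<integral>p. norm (fst p - snd p) \<partial>\<pi>)"
    unfolding D_def by (intro integral_cong_AE mq borel_measurable_integrable[OF coupling_cost(1)[OF \<pi> cost d]])
  then have "D 0 \<le> d" using coupling_cost(2)[OF \<pi> cost d] by simp
  then have Dt: "D t \<le> exp (2 * L * \<bar>t\<bar>) * d"
    using DA[of t] AD by (smt (verit) R_def exp_ge_zero mult.commute mult_left_mono)
  define \<pi>' where "\<pi>' = distr \<pi> borel (\<lambda>p. (Y t (fst p), X t (snd p)))"
  have mYf: "(\<lambda>p. Y t (fst p)) \<in> borel_measurable \<pi>" by (rule coupling_measurable_fst[OF \<pi> mY])
  have mXs: "(\<lambda>p. X t (snd p)) \<in> borel_measurable \<pi>" by (rule coupling_measurable_snd[OF \<pi> X(6)])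
  have mp: "(\<lambda>p. (Y t (fst p), X t (snd p))) \<in> borel_measurable \<pi>" by (intro borel_measurable_Pair mYf mXs)
  have mf: "(fst :: 'a \<times> 'a \<Rightarrow> 'a) \<in> borel_measurable borel" "(snd :: 'a \<times> 'a \<Rightarrow> 'a) \<in> borel_measurable borel"
    by (auto intro!: borel_measurable_continuous_onI continuous_intros)
  have "\<pi>' \<in> couplings (empirical_measure N (T t Z)) (distr \<nu> borel (X t))"
    unfolding couplings_def mem_Collect_eq
  proof (intro conjI)
    show "sets \<pi>' = sets borel" by (simp add: \<pi>'_def)
    show "prob_space \<pi>'" unfolding \<pi>'_def by (rule \<pi>.prob_space_distr[OF mp])
    have "distr \<pi>' borel fst = distr \<pi> borel (\<lambda>p. Y t (fst p))"
      unfolding \<pi>'_def by (subst distr_distr[OF mf(1) mp]) (simp add: o_def)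
    also have "\<dots> = distr (distr \<pi> borel fst) borel (Y t)"
      using coupling_measurable_fst[OF \<pi>, of "\<lambda>x. x"] by (subst distr_distr[OF mY]) (simp_all add: o_def)
    also have "\<dots> = distr (measure_pmf (pmf_of_set {..<N})) borel (Y t \<circ> Z)"
      unfolding couplingD(3)[OF \<pi>] empirical_measure_eq_distr[OF N] by (rule distr_distr[OF mY]) simp
    also have "\<dots> = distr (measure_pmf (pmf_of_set {..<N})) borel (T t Z)"
      using N by (intro distr_cong_AE) (auto simp: AE_measure_pmf_iff set_pmf_of_set lessThan_empty_iff YZ)
    finally show "distr \<pi>' borel fst = empirical_measure N (T t Z)"
      by (simp add: empirical_measure_eq_distr[OF N])
    have "distr \<pi>' borel snd = distr \<pi> borel (\<lambda>p. X t (snd p))"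
      unfolding \<pi>'_def by (subst distr_distr[OF mf(2) mp]) (simp add: o_def)
    also have "\<dots> = distr (distr \<pi> borel snd) borel (X t)"
      using coupling_measurable_snd[OF \<pi>, of "\<lambda>x. x"] by (subst distr_distr[OF X(6)]) (simp_all add: o_def)
    finally show "distr \<pi>' borel snd = distr \<nu> borel (X t)" by (simp add: couplingD(4)[OF \<pi>])
  qed
  moreover have "(\<integral>\<^sup>+p. ennreal (norm (fst p - snd p)) \<partial>\<pi>') = (\<integral>\<^sup>+p. ennreal (q t p) \<partial>\<pi>)"
    unfolding \<pi>'_def q_def by (subst nn_integral_distr[OF mp])
      (auto intro!: measurable_compose[OF _ measurable_ennreal] borel_measurable_continuous_onI continuous_intros)
  moreover have "\<dots> = ennreal (D t)"
    unfolding D_def using intq[of t] by (intro nn_integral_eq_integral) (auto simp: q0 R_def)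
  ultimately show ?thesis using Dt by (auto intro!: bexI[of _ \<pi>'] ennreal_leI)
qed

end

section \<open>Regularity of observables on configurations\<close>

text \<open>Composed with the restriction to the first m coordinates, \<phi> becomes a function on
  all sequences that is continuous for the product topology, whose Borel sets form the product
  sigma-algebra. It is then pulled back along the inclusion of configurations, whose remaining
  coordinates are the constant \<open>undefined\<close>.\<close>

lemma config_lipschitz_measurable:
  fixes \<phi> :: "(nat \<Rightarrow> 'a::euclidean_space) \<Rightarrow> 'b::metric_space"
  assumes lip: "\<And>x y. x \<in> config m \<Longrightarrow> y \<in> config m \<Longrightarrow> dist (\<phi> x) (\<phi> y) \<le> C * (\<Sum>i<m. norm (x i - y i))"
  shows "\<phi> \<in> borel_measurable (config_borel m)"
proof -
  define \<psi> where "\<psi> w = \<phi> (restrict w {..<m})" for w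
  have "isCont \<psi> x" for x
  proof -
    have co: "((\<lambda>y. y i) \<longlongrightarrow> x i) (at x)" for i
    proof -
      have "continuous_on UNIV (\<lambda>y :: nat \<Rightarrow> 'a. y i)" by (rule continuous_on_product_coordinates)
      then have "isCont (\<lambda>y :: nat \<Rightarrow> 'a. y i) x"
        using continuous_on_eq_continuous_at[OF open_UNIV] by blast
      then show ?thesis by (simp add: isCont_def)
    qed
    have "((\<lambda>y. C * (\<Sum>i<m. norm (y i - x i))) \<longlongrightarrow> C * (\<Sum>i<m. norm (x i - x i))) (at x)"
      by (intro tendsto_intros co)
    then have "((\<lambda>y. C * (\<Sum>i<m. norm (y i - x i))) \<longlongrightarrow> 0) (at x)" by simp
    then have lim: "((\<lambda>y. C * (\<Sum>i<m. norm (y i - x i))) \<longlongrightarrow> 0) (at x)" .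
    have bound: "norm (dist (\<psi> y) (\<psi> x)) \<le> C * (\<Sum>i<m. norm (y i - x i))" for y
    proof -
      have "(\<Sum>i<m. norm (restrict y {..<m} i - restrict x {..<m} i)) = (\<Sum>i<m. norm (y i - x i))"
        by (intro sum.cong) auto
      then show ?thesis using lip[of "restrict y {..<m}" "restrict x {..<m}"] unfolding \<psi>_def by auto
    qed
    have "((\<lambda>y. dist (\<psi> y) (\<psi> x)) \<longlongrightarrow> 0) (at x)"
      by (rule Lim_null_comparison[OF always_eventually lim]) (use bound in blast)
    then show "isCont \<psi> x" unfolding isCont_def by (subst tendsto_dist_iff)
  qed
  then have "continuous_on UNIV \<psi>" by (intro continuous_at_imp_continuous_on) blast
  then have "\<psi> \<in> borel_measurable borel" by (rule borel_measurable_continuous_onI)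
  then have \<psi>: "\<psi> \<in> borel_measurable (PiM UNIV (\<lambda>_. borel))"
    by (subst measurable_cong_sets[OF sets_PiM_equal_borel refl])
  have id: "(\<lambda>\<omega> i. \<omega> i) \<in> config_borel m \<rightarrow>\<^sub>M PiM (UNIV :: nat set) (\<lambda>_. borel :: 'a measure)"
  proof (rule measurable_PiM_single')
    fix i :: nat
    show "(\<lambda>\<omega>. \<omega> i) \<in> config_borel m \<rightarrow>\<^sub>M (borel :: 'a measure)"
    proof (cases "i < m")
      case False
      then have "\<omega> i = undefined" if "\<omega> \<in> space (config_borel m)" for \<omega> :: "nat \<Rightarrow> 'a"
        using that by (auto simp: space_PiM PiE_def extensional_def)
      then show ?thesis by (rule measurable_cong[THEN iffD2]) simp_all
    qed simp
  qed auto
  have 1: "(\<lambda>\<omega>. \<psi> (\<lambda>i. \<omega> i)) \<in> borel_measurable (config_borel m)"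
    by (rule measurable_compose[OF id \<psi>])
  have 2: "\<psi> (\<lambda>i. \<omega> i) = \<phi> \<omega>" if "\<omega> \<in> space (config_borel m)" for \<omega>
    using that by (simp add: \<psi>_def space_PiM PiE_restrict)
  show ?thesis by (rule measurable_cong[THEN iffD1, OF 2 1])
qed

text \<open>The essential supremum refers to Lebesgue measure, whereas particle marginals may be
  singular, so a bound at every point is required. A value above the essential supremum would, by
  the Lipschitz property, persist on a product of balls of positive measure.\<close>

lemma Linf_norm_upper:
  fixes \<phi> :: "(nat \<Rightarrow> 'a::euclidean_space) \<Rightarrow> real"
  assumes lip: "\<And>x y. x \<in> config m \<Longrightarrow> y \<in> config m \<Longrightarrow> \<bar>\<phi> x - \<phi> y\<bar> \<le> C * (\<Sum>i<m. norm (x i - y i))"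
    and C: "0 \<le> C" and z: "z \<in> config m"
  shows "ennreal \<bar>\<phi> z\<bar> \<le> Linf_norm m \<phi>"
proof (rule ccontr)
  assume "\<not> ennreal \<bar>\<phi> z\<bar> \<le> Linf_norm m \<phi>"
  then have lt: "Linf_norm m \<phi> < ennreal \<bar>\<phi> z\<bar>" by simp
  then obtain s where s: "0 \<le> s" "Linf_norm m \<phi> = ennreal s"
    by (cases "Linf_norm m \<phi>") auto
  have sz: "s < \<bar>\<phi> z\<bar>" using lt s by (simp add: ennreal_less_iff)
  interpret product_sigma_finite "\<lambda>_::nat. lborel :: 'a measure" ..
  \<comment> \<open>Moving every coordinate by less than \<delta> changes \<phi> by at most C m
    \<delta>, which is below the gap |\<phi> z| - s; the summand 1 covers C m = 0.\<close>
  define \<delta> where "\<delta> = (\<bar>\<phi> z\<bar> - s) / (C * real m + 1)"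
  have den: "0 < C * real m + 1" using C by (simp add: add_nonneg_pos)
  have \<delta>: "0 < \<delta>" using sz den by (simp add: \<delta>_def)
  let ?B = "\<Pi>\<^sub>E i\<in>{..<m}. ball (z i) \<delta>"
  have big: "s < \<bar>\<phi> w\<bar>" if w: "w \<in> ?B" for w
  proof -
    have wc: "w \<in> config m" using w by auto
    have "(\<Sum>i<m. norm (z i - w i)) \<le> (\<Sum>i<m. \<delta>)"
      using w by (intro sum_mono) (auto simp: PiE_iff dist_norm less_imp_le)
    then have "C * (\<Sum>i<m. norm (z i - w i)) \<le> C * (real m * \<delta>)" using C by (intro mult_left_mono) auto
    also have "\<dots> < \<bar>\<phi> z\<bar> - s"
    proof -
      have "C * (real m * \<delta>) < (C * real m + 1) * \<delta>" using \<delta> by (simp add: algebra_simps)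
      also have "\<dots> = \<bar>\<phi> z\<bar> - s" using den by (simp add: \<delta>_def)
      finally show ?thesis .
    qed
    finally show ?thesis using lip[OF z wc] by linarith
  qed
  have B: "?B \<in> sets (tensor_power m lborel)" by (intro sets_PiM_I_finite) auto
  have "AE w in tensor_power m lborel. ennreal \<bar>\<phi> w\<bar> \<le> ennreal s"
    using esssup_AE[of "\<lambda>z. ennreal \<bar>\<phi> z\<bar>" "tensor_power m lborel"] s(2) by (simp add: Linf_norm_def)
  then have "AE w in tensor_power m lborel. w \<notin> ?B"
  proof eventually_elim
    case (elim w)
    then show ?case using big[of w] s(1) by (auto simp: ennreal_le_iff)
  qed
  then have "emeasure (tensor_power m lborel) ?B = 0"
    using AE_iff_measurable[OF B, of "\<lambda>w. w \<notin> ?B"] sets.sets_into_space[OF B] by (auto simp: Int_absorb1 Int_def)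
  moreover have "emeasure (tensor_power m lborel) ?B = (\<Prod>i<m. emeasure lborel (ball (z i) \<delta>))"
    by (rule emeasure_PiM) auto
  ultimately obtain i where "emeasure lborel (ball (z i) \<delta>) = 0" by (auto simp: prod_zero_iff)
  then show False using content_ball_pos[OF \<delta>, of "z i"] by (simp add: measure_def)
qed

text \<open>The Euclidean norm of a configuration is at most the sum of the norms of its components.
  That sum is additive over particles, as are coupling costs, and it produces the factor m in the
  estimates.\<close>

lemma Lip_const_finite:
  fixes \<phi> :: "(nat \<Rightarrow> 'a::euclidean_space) \<Rightarrow> real"
  assumes "Lip_const m \<phi> < \<infinity>" and x: "x \<in> config m" and y: "y \<in> config m"
  shows "\<bar>\<phi> x - \<phi> y\<bar> \<le> enn2real (Lip_const m \<phi>) * (\<Sum>i<m. norm (x i - y i))"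
proof (cases "x = y")
  case False
  let ?n = "config_norm m (\<lambda>i. x i - y i)" and ?C = "enn2real (Lip_const m \<phi>)"
  obtain i where i: "i < m" "x i \<noteq> y i"
    using False x y by (metis (no_types, lifting) PiE_ext lessThan_iff)
  have "0 < norm (x i - y i)" using i by simp
  also have "\<dots> \<le> ?n" unfolding config_norm_def by (rule member_le_L2_set) (use i in auto)
  finally have n: "0 < ?n" .
  have "ennreal (\<bar>\<phi> x - \<phi> y\<bar> / ?n) \<le> Lip_const m \<phi>"
    unfolding Lip_const_def by (rule SUP_upper2[of "(x, y)"]) (use x y False in auto)
  also have "\<dots> = ennreal ?C" using assms(1) by (simp add: less_top)
  finally have "\<bar>\<phi> x - \<phi> y\<bar> / ?n \<le> ?C" by (simp add: ennreal_le_iff)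
  then have "\<bar>\<phi> x - \<phi> y\<bar> \<le> ?C * ?n" using n by (simp add: pos_divide_le_eq)
  also have "?n \<le> (\<Sum>i<m. norm (x i - y i))"
    unfolding config_norm_def by (rule L2_set_le_sum) auto
  then have "?C * ?n \<le> ?C * (\<Sum>i<m. norm (x i - y i))" by (intro mult_left_mono) auto
  finally show ?thesis .
qed simp

section \<open>Tensor powers of measures and of couplings\<close>

lemma tensor_power_distr:
  fixes f :: "'b \<Rightarrow> 'a::euclidean_space"
  assumes "prob_space M" "f \<in> borel_measurable M"
  shows "tensor_power m (distr M borel f) = distr (tensor_power m M) (config_borel m) (\<lambda>z. \<lambda>i\<in>{..<m}. f (z i))"
proof -
  let ?D = "distr M borel f"
  have "distr (tensor_power m M) (tensor_power m ?D) (compose {..<m} f) = tensor_power m (distr M ?D f)"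
    using assms by (intro distr_PiM_finite_prob_space') (auto intro: prob_space.prob_space_distr)
  moreover have "distr M ?D f = ?D" by (rule distr_cong) auto
  moreover have "distr (tensor_power m M) (tensor_power m ?D) (compose {..<m} f) =
      distr (tensor_power m M) (config_borel m) (compose {..<m} f)"
    by (intro distr_cong sets_PiM_cong) auto
  ultimately have "distr (tensor_power m M) (config_borel m) (compose {..<m} f) = tensor_power m ?D"
    by simp
  then show ?thesis by (simp add: compose_def[abs_def])
qed

lemma tensor_power_component_integral:
  fixes f :: "'a \<Rightarrow> real"
  assumes "prob_space M" "i < m" "integrable M f"
  shows "integrable (tensor_power m M) (\<lambda>z. f (z i))" "(\<integral>z. f (z i) \<partial>tensor_power m M) = (\<integral>x. f x \<partial>M)"
proof -
  have d: "distr (tensor_power m M) M (\<lambda>z. z i) = M"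
    by (rule distr_PiM_component) (use assms in auto)
  have m: "(\<lambda>z. z i) \<in> tensor_power m M \<rightarrow>\<^sub>M M" using assms(2) by simp
  show "integrable (tensor_power m M) (\<lambda>z. f (z i))"
    using integrable_distr[OF m, of f] assms(3) by (simp add: d)
  show "(\<integral>z. f (z i) \<partial>tensor_power m M) = (\<integral>x. f x \<partial>M)"
    using integral_distr[OF m, of f] assms(3) by (simp add: d)
qed

lemma integral_abs_le:
  fixes f g :: "'a \<Rightarrow> real"
  assumes "integrable M f" "integrable M g" "\<And>x. x \<in> space M \<Longrightarrow> \<bar>f x\<bar> \<le> g x"
  shows "\<bar>\<integral>x. f x \<partial>M\<bar> \<le> (\<integral>x. g x \<partial>M)"
proof -
  have "\<bar>\<integral>x. f x \<partial>M\<bar> \<le> (\<integral>x. \<bar>f x\<bar> \<partial>M)"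
    using integral_norm_bound[of M f] by simp
  also have "\<dots> \<le> (\<integral>x. g x \<partial>M)" using assms by (intro integral_mono) auto
  finally show ?thesis .
qed

text \<open>The m-fold power of \<pi> couples the m-fold powers of its marginals. Each component is
  again distributed like \<pi>, so the total cost is m times that of \<pi>.\<close>

lemma tensor_coupling_bound:
  fixes \<mu> \<nu> :: "'a::euclidean_space measure" and \<phi> :: "(nat \<Rightarrow> 'a) \<Rightarrow> real"
  assumes \<pi>: "\<pi> \<in> couplings \<mu> \<nu>" and cost: "(\<integral>\<^sup>+p. ennreal (norm (fst p - snd p)) \<partial>\<pi>) \<le> ennreal d" and d: "0 \<le> d"
    and m\<phi>: "\<phi> \<in> borel_measurable (config_borel m)"
    and lip: "\<And>x y. x \<in> config m \<Longrightarrow> y \<in> config m \<Longrightarrow> \<bar>\<phi> x - \<phi> y\<bar> \<le> C * (\<Sum>i<m. norm (x i - y i))"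
    and bd: "\<And>z. z \<in> config m \<Longrightarrow> \<bar>\<phi> z\<bar> \<le> M" and C: "0 \<le> C"
  shows "\<bar>(\<integral>z. \<phi> z \<partial>tensor_power m \<mu>) - (\<integral>z. \<phi> z \<partial>tensor_power m \<nu>)\<bar> \<le> C * (real m * d)"
proof -
  interpret \<pi>: prob_space \<pi> by (rule couplingD(2)[OF \<pi>])
  interpret T: prob_space "tensor_power m \<pi>" by (rule prob_space_PiM) (rule couplingD(2)[OF \<pi>])
  have mfst: "fst \<in> \<pi> \<rightarrow>\<^sub>M borel" and msnd: "snd \<in> \<pi> \<rightarrow>\<^sub>M borel"
    using coupling_measurable_fst[OF \<pi>, of "\<lambda>x. x"] coupling_measurable_snd[OF \<pi>, of "\<lambda>x. x"] by simp_all
  let ?f = "\<lambda>z. \<lambda>i\<in>{..<m}. fst (z i :: 'a \<times> 'a)" and ?s = "\<lambda>z. \<lambda>i\<in>{..<m}. snd (z i :: 'a \<times> 'a)"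
  have mf: "?f \<in> tensor_power m \<pi> \<rightarrow>\<^sub>M config_borel m"
    by (intro measurable_restrict measurable_compose[OF _ mfst]) auto
  have ms: "?s \<in> tensor_power m \<pi> \<rightarrow>\<^sub>M config_borel m"
    by (intro measurable_restrict measurable_compose[OF _ msnd]) auto
  have int: "integrable (tensor_power m \<pi>) (\<lambda>z. \<phi> (g z))" if g: "g \<in> tensor_power m \<pi> \<rightarrow>\<^sub>M config_borel m" for g
  proof (rule T.integrable_const_bound[where B = M])
    show "AE z in tensor_power m \<pi>. norm (\<phi> (g z)) \<le> M"
      using bd measurable_space[OF g] by (auto simp: space_PiM intro!: AE_I2)
  qed (rule measurable_compose[OF g m\<phi>])
  have tf: "(\<integral>z. \<phi> z \<partial>tensor_power m \<mu>) = (\<integral>z. \<phi> (?f z) \<partial>tensor_power m \<pi>)"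
    using tensor_power_distr[OF couplingD(2)[OF \<pi>] mfst, of m] integral_distr[OF mf m\<phi>]
    by (simp add: couplingD(3)[OF \<pi>])
  have ts: "(\<integral>z. \<phi> z \<partial>tensor_power m \<nu>) = (\<integral>z. \<phi> (?s z) \<partial>tensor_power m \<pi>)"
    using tensor_power_distr[OF couplingD(2)[OF \<pi>] msnd, of m] integral_distr[OF ms m\<phi>]
    by (simp add: couplingD(4)[OF \<pi>])
  note cc = coupling_cost[OF \<pi> cost d]
  note ci = tensor_power_component_integral[OF couplingD(2)[OF \<pi>] _ cc(1)]
  have "\<bar>(\<integral>z. \<phi> z \<partial>tensor_power m \<mu>) - (\<integral>z. \<phi> z \<partial>tensor_power m \<nu>)\<bar> = \<bar>\<integral>z. \<phi> (?f z) - \<phi> (?s z) \<partial>tensor_power m \<pi>\<bar>"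
    by (simp add: tf ts int[OF mf] int[OF ms])
  also have "\<dots> \<le> (\<integral>z. C * (\<Sum>i<m. norm (fst (z i) - snd (z i))) \<partial>tensor_power m \<pi>)"
  proof (rule integral_abs_le)
    show "integrable (tensor_power m \<pi>) (\<lambda>z. \<phi> (?f z) - \<phi> (?s z))" using int[OF mf] int[OF ms] by simp
    show "integrable (tensor_power m \<pi>) (\<lambda>z. C * (\<Sum>i<m. norm (fst (z i) - snd (z i))))"
      by (intro integrable_mult_right Bochner_Integration.integrable_sum ci) simp
    fix z
    show "\<bar>\<phi> (?f z) - \<phi> (?s z)\<bar> \<le> C * (\<Sum>i<m. norm (fst (z i) - snd (z i)))"
      using lip[of "?f z" "?s z"] by simp
  qed
  also have "\<dots> = C * (\<Sum>i<m. (\<integral>p. norm (fst p - snd p) \<partial>\<pi>))"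
    by (simp add: ci)
  also have "\<dots> \<le> C * (\<Sum>i<m. d)" using cc(2) C by (intro mult_left_mono sum_mono) auto
  finally show ?thesis by simp
qed

lemma (in particles) T_measurable: "T t \<in> config_borel N \<rightarrow>\<^sub>M config_borel N"
proof -
  have "(\<lambda>z i. T t z i) \<in> config_borel N \<rightarrow>\<^sub>M config_borel N"
  proof (rule measurable_PiM_single')
    fix i assume "i \<in> {..<N}"
    show "(\<lambda>z. T t z i) \<in> borel_measurable (config_borel N)"
    proof (rule config_lipschitz_measurable)
      fix x y :: "nat \<Rightarrow> 'a" assume xy: "x \<in> config N" "y \<in> config N"
      have "norm (T t x i - T t y i) \<le> (\<Sum>k<N. norm (T t x k - T t y k))"
        using \<open>i \<in> {..<N}\<close> by (intro member_le_sum) auto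
      also have "\<dots> \<le> exp (2 * L * \<bar>t\<bar>) * (\<Sum>k<N. norm (x k - y k))" by (rule T_lipschitz[OF xy])
      finally show "dist (T t x i) (T t y i) \<le> exp (2 * L * \<bar>t\<bar>) * (\<Sum>k<N. norm (x k - y k))"
        by (simp add: dist_norm)
    qed
  qed (use T_config in \<open>auto simp: space_PiM\<close>)
  then show ?thesis by simp
qed

section \<open>Tensor powers of the empirical measure\<close>

abbreviation select :: "nat \<Rightarrow> (nat \<Rightarrow> 'a) \<Rightarrow> (nat \<Rightarrow> nat) \<Rightarrow> (nat \<Rightarrow> 'a)" where
  "select m z s \<equiv> \<lambda>i\<in>{..<m}. z (s i)"

abbreviation indices :: "nat \<Rightarrow> nat \<Rightarrow> (nat \<Rightarrow> nat) set" where
  "indices m N \<equiv> {..<m} \<rightarrow>\<^sub>E {..<N}"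

lemma indices_finite: "finite (indices m N)"
  by (intro finite_PiE) auto

lemma indices_nonempty: "1 \<le> N \<Longrightarrow> indices m N \<noteq> {}"
  by (auto simp: PiE_eq_empty_iff lessThan_empty_iff)

lemma card_indices: "card (indices m N) = N ^ m"
  by (simp add: card_PiE)

lemma select_measurable [measurable]: "select m z \<in> measure_pmf p \<rightarrow>\<^sub>M config_borel m"
  by (intro measurable_restrict) simp

text \<open>Both sides agree on rectangles: the index maps sending each i into a prescribed set form
  a product, so their proportion among all \<open>N ^ m\<close> maps is the product of the
  proportions.\<close>

lemma tensor_power_empirical:
  fixes z :: "nat \<Rightarrow> 'a::euclidean_space"
  assumes N: "1 \<le> N"
  shows "tensor_power m (empirical_measure N z) =
    distr (measure_pmf (pmf_of_set (indices m N))) (config_borel m) (select m z)"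
proof (rule sym)
  interpret product_prob_space "\<lambda>_::nat. empirical_measure N z"
    by (rule product_prob_spaceI) (rule empirical_measure_prob[OF N])
  have sets_e: "sets (empirical_measure N z) = sets borel" by (simp add: empirical_measure_eq_distr[OF N])
  have ne: "{..<N} \<noteq> {}" using N by (simp add: lessThan_empty_iff)
  have e: "emeasure (empirical_measure N z) A = ennreal (real (card {k\<in>{..<N}. z k \<in> A}) / real N)"
    if "A \<in> sets borel" for A
    unfolding empirical_measure_eq_distr[OF N] using that ne
    by (simp add: emeasure_distr emeasure_pmf_of_set vimage_def Int_def)
  show "distr (measure_pmf (pmf_of_set (indices m N))) (config_borel m) (select m z) = tensor_power m (empirical_measure N z)"
  proof (rule PiM_eqI)
    show "sets (distr (measure_pmf (pmf_of_set (indices m N))) (config_borel m) (select m z)) =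
        sets (tensor_power m (empirical_measure N z))"
      using sets_PiM_cong[of "{..<m}" "{..<m}" "\<lambda>_. borel" "\<lambda>_. empirical_measure N z"] by (simp add: sets_e)
    fix A :: "nat \<Rightarrow> 'a set" assume "\<And>i. i \<in> {..<m} \<Longrightarrow> A i \<in> sets (empirical_measure N z)"
    then have A: "A i \<in> sets borel" if "i < m" for i using that by (simp add: sets_e)
    have "indices m N \<inter> select m z -` (Pi\<^sub>E {..<m} A) = (\<Pi>\<^sub>E i\<in>{..<m}. {k\<in>{..<N}. z k \<in> A i})"
    proof (intro set_eqI)
      fix s
      have "select m z s \<in> Pi\<^sub>E {..<m} A \<longleftrightarrow> (\<forall>i<m. z (s i) \<in> A i)"
        unfolding PiE_iff by (simp add: Ball_def)
      then show "s \<in> indices m N \<inter> select m z -` (Pi\<^sub>E {..<m} A) \<longleftrightarrow> s \<in> (\<Pi>\<^sub>E i\<in>{..<m}. {k\<in>{..<N}. z k \<in> A i})"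
        unfolding Int_iff vimage_eq PiE_iff by auto
    qed
    moreover have "Pi\<^sub>E {..<m} A \<in> sets (config_borel m)" using A by (intro sets_PiM_I_finite) auto
    from emeasure_distr[OF select_measurable this]
    have "emeasure (distr (measure_pmf (pmf_of_set (indices m N))) (config_borel m) (select m z)) (Pi\<^sub>E {..<m} A)
      = ennreal (real (card (indices m N \<inter> select m z -` (Pi\<^sub>E {..<m} A))) / real (N ^ m))"
      by (simp only: space_measure_pmf Int_UNIV_right emeasure_pmf_of_set[OF indices_nonempty[OF N] indices_finite] card_indices)
    ultimately have "emeasure (distr (measure_pmf (pmf_of_set (indices m N))) (config_borel m) (select m z)) (Pi\<^sub>E {..<m} A)
      = ennreal (real (card (\<Pi>\<^sub>E i\<in>{..<m}. {k\<in>{..<N}. z k \<in> A i})) / real (N ^ m))"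
      by (simp only:)
    also have "\<dots> = ennreal (\<Prod>i<m. real (card {k\<in>{..<N}. z k \<in> A i}) / real N)"
      by (simp add: card_PiE prod_dividef)
    also have "\<dots> = (\<Prod>i<m. ennreal (real (card {k\<in>{..<N}. z k \<in> A i}) / real N))"
      by (rule prod_ennreal[symmetric]) simp
    also have "\<dots> = (\<Prod>i<m. emeasure (empirical_measure N z) (A i))"
      using A by (intro prod.cong) (auto simp: e)
    finally show "emeasure (distr (measure_pmf (pmf_of_set (indices m N))) (config_borel m) (select m z)) (Pi\<^sub>E {..<m} A) =
      (\<Prod>i\<in>{..<m}. emeasure (empirical_measure N z) (A i))" .
  qed simp
qed

lemma tensor_power_empirical_integral:
  fixes \<phi> :: "(nat \<Rightarrow> 'a::euclidean_space) \<Rightarrow> real"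
  assumes N: "1 \<le> N" and \<phi>: "\<phi> \<in> borel_measurable (config_borel m)"
  shows "(\<integral>x. \<phi> x \<partial>tensor_power m (empirical_measure N z)) = (\<Sum>s\<in>indices m N. \<phi> (select m z s)) / real N ^ m"
proof -
  have "(\<integral>x. \<phi> x \<partial>tensor_power m (empirical_measure N z)) = (\<integral>s. \<phi> (select m z s) \<partial>measure_pmf (pmf_of_set (indices m N)))"
    unfolding tensor_power_empirical[OF N] by (rule integral_distr[OF select_measurable \<phi>])
  also have "\<dots> = (\<Sum>s\<in>indices m N. \<phi> (select m z s)) / real N ^ m"
    using indices_nonempty[OF N] indices_finite by (simp add: integral_pmf_of_set card_indices)
  finally show ?thesis .
qed

lemma tensor_power_empirical_emeasure:
  fixes z :: "nat \<Rightarrow> 'a::euclidean_space"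
  assumes N: "1 \<le> N" and A: "A \<in> sets (config_borel m)"
  shows "emeasure (tensor_power m (empirical_measure N z)) A =
    (\<Sum>s\<in>indices m N. ennreal (1 / real N ^ m) * indicator A (select m z s))"
proof -
  have "(\<Sum>s\<in>indices m N. indicator A (select m z s)) = (of_nat (card (indices m N \<inter> select m z -` A)) :: ennreal)"
  proof -
    have "(\<Sum>s\<in>S. indicator B (f s)) = (of_nat (card (S \<inter> f -` B)) :: ennreal)"
      if "finite S" for S :: "'b set" and f :: "'b \<Rightarrow> 'c" and B
    proof -
      have "(\<Sum>s\<in>S. indicator B (f s)) = (\<Sum>s\<in>S. if s \<in> f -` B then 1 else 0 :: ennreal)"
        by (intro sum.cong) (auto simp: indicator_def)
      then show ?thesis using that by (simp add: sum.If_cases Int_def)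
    qed
    from this[OF indices_finite] show ?thesis .
  qed
  then have "(\<Sum>s\<in>indices m N. ennreal (1 / real N ^ m) * indicator A (select m z s)) =
      ennreal (1 / real N ^ m) * of_nat (card (indices m N \<inter> select m z -` A))"
    by (simp add: sum_distrib_left[symmetric])
  also have "\<dots> = ennreal (real (card (indices m N \<inter> select m z -` A)) / real (N ^ m))"
    by (simp add: ennreal_of_nat_eq_real_of_nat ennreal_mult[symmetric])
  also have "\<dots> = emeasure (tensor_power m (empirical_measure N z)) A"
    unfolding tensor_power_empirical[OF N] emeasure_distr[OF select_measurable A]
    by (simp only: space_measure_pmf Int_UNIV_right emeasure_pmf_of_set[OF indices_nonempty[OF N] indices_finite] card_indices)
  finally show ?thesis by simp
qed

section \<open>Counting injective index maps\<close>

text \<open>The complements of the domain and of the image within \<open>{..<N}\<close> have equal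
  size, so any bijection between them completes s. Symmetry under permutations can then be applied
  to a choice of m distinct indices.\<close>

lemma injective_index_extends:
  assumes s: "s \<in> indices m N" "inj_on s {..<m}" and m: "m \<le> N"
  obtains \<sigma> where "\<sigma> permutes {..<N}" "\<And>i. i < m \<Longrightarrow> \<sigma> i = s i"
proof -
  have sub: "s ` {..<m} \<subseteq> {..<N}" using s by auto
  have "card ({..<N} - s ` {..<m}) = card {m..<N}"
    using sub s(2) by (simp add: card_Diff_subset card_image)
  then obtain g where g: "bij_betw g {m..<N} ({..<N} - s ` {..<m})"
    using finite_same_card_bij[of "{m..<N}" "{..<N} - s ` {..<m}"] by auto
  define \<sigma> where "\<sigma> i = (if i < m then s i else if i < N then g i else i)" for i
  have "bij_betw \<sigma> ({..<m} \<union> {m..<N}) (s ` {..<m} \<union> ({..<N} - s ` {..<m}))"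
  proof (rule bij_betw_combine)
    have "bij_betw s {..<m} (s ` {..<m})" using s(2) by (simp add: bij_betw_def)
    then show "bij_betw \<sigma> {..<m} (s ` {..<m})"
      by (rule bij_betw_cong[THEN iffD1, rotated]) (simp add: \<sigma>_def)
    show "bij_betw \<sigma> {m..<N} ({..<N} - s ` {..<m})"
      using g by (rule bij_betw_cong[THEN iffD1, rotated]) (simp add: \<sigma>_def)
  qed auto
  moreover have "{..<m} \<union> {m..<N} = {..<N}" "s ` {..<m} \<union> ({..<N} - s ` {..<m}) = {..<N}"
    using m sub by auto
  ultimately have "\<sigma> permutes {..<N}"
    using m by (intro bij_imp_permutes) (auto simp: \<sigma>_def)
  then show ?thesis by (rule that) (simp add: \<sigma>_def)
qed

abbreviation (input) inj_indices :: "nat \<Rightarrow> nat \<Rightarrow> (nat \<Rightarrow> nat) set" where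
  "inj_indices m N \<equiv> {s\<in>indices m N. inj_on s {..<m}}"

lemma card_inj_indices:
  assumes "m \<le> N"
  shows "real (card (inj_indices m N)) = fact N / fact (N - m)"
proof -
  let ?X = "{xs. length xs = m \<and> distinct xs \<and> set xs \<subseteq> {..<N}}"
  have "bij_betw (\<lambda>s. map s [0..<m]) (inj_indices m N) ?X"
  proof (rule bij_betw_byWitness[where f' = "\<lambda>xs. \<lambda>i\<in>{..<m}. xs ! i"])
    show "\<forall>s\<in>inj_indices m N. (\<lambda>i\<in>{..<m}. map s [0..<m] ! i) = s"
    proof (intro ballI ext)
      fix s i assume "s \<in> inj_indices m N"
      then have "s \<in> indices m N" by simp
      then show "(\<lambda>i\<in>{..<m}. map s [0..<m] ! i) i = s i"
        using PiE_arb[of s "{..<m}" "\<lambda>_. {..<N}" i] by (cases "i < m") auto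
    qed
    show "\<forall>xs\<in>?X. map (\<lambda>i\<in>{..<m}. xs ! i) [0..<m] = xs"
      by (intro ballI nth_equalityI) auto
    show "(\<lambda>s. map s [0..<m]) ` inj_indices m N \<subseteq> ?X"
    proof (rule image_subsetI)
      fix s assume s: "s \<in> inj_indices m N"
      then have "inj_on s (set [0..<m])" "s ` {..<m} \<subseteq> {..<N}" by (auto simp: atLeast0LessThan)
      then show "map s [0..<m] \<in> ?X" by (simp add: distinct_map atLeast0LessThan)
    qed
    show "(\<lambda>xs. \<lambda>i\<in>{..<m}. xs ! i) ` ?X \<subseteq> inj_indices m N"
    proof (rule image_subsetI)
      fix xs assume xs: "xs \<in> ?X"
      have "xs ! i < N" if "i < m" for i
      proof -
        have "xs ! i \<in> set xs" using xs that by simp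
        then show ?thesis using xs by auto
      qed
      then have "(\<lambda>i\<in>{..<m}. xs ! i) \<in> indices m N" by auto
      moreover have "inj_on (\<lambda>i\<in>{..<m}. xs ! i) {..<m}"
        using xs by (intro inj_onI) (simp add: nth_eq_iff_index_eq)
      ultimately show "(\<lambda>i\<in>{..<m}. xs ! i) \<in> inj_indices m N" by simp
    qed
  qed
  then have "card (inj_indices m N) = card ?X" by (rule bij_betw_same_card)
  also have "\<dots> = \<Prod>{N - m + 1..N}"
    using card_lists_distinct_length_eq[of "{..<N}" m] assms by simp
  also have "\<dots> = fact N div fact (N - m)"
    using fact_div_fact[of "N - m" N] by simp
  finally show ?thesis
    by (simp add: real_of_nat_div fact_dvd)
qed

lemma card_noninjective_indices:
  assumes "m \<le> N" "1 \<le> N"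
  shows "real (card (indices m N - inj_indices m N)) / real N ^ m = 1 - fact N / (fact (N - m) * real N ^ m)"
proof -
  have "card (indices m N - inj_indices m N) = card (indices m N) - card (inj_indices m N)"
    by (rule card_Diff_subset) (auto intro: finite_subset[OF _ indices_finite])
  moreover have "card (inj_indices m N) \<le> card (indices m N)" by (intro card_mono indices_finite) auto
  ultimately have "real (card (indices m N - inj_indices m N)) = real N ^ m - real (card (inj_indices m N))"
    by (simp only: of_nat_diff card_indices of_nat_power)
  then show ?thesis using assms(2) by (simp add: diff_divide_distrib card_inj_indices[OF assms(1)])
qed

text \<open>The birthday problem: the proportion of injective maps is multiplied by 1 - m/N when an
  index is added. Being at most 1, it drops by at most m/N, and the drops sum to
  m(m-1)/(2N).\<close>

lemma birthday_bound:
  assumes "m \<le> N" "1 \<le> N"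
  shows "fact N / (fact (N - m) * real N ^ m) \<le> 1"
    and "1 - fact N / (fact (N - m) * real N ^ m) \<le> real m * (real m - 1) / (2 * real N)"
proof -
  have le1: "fact N / (fact (N - m) * real N ^ m) \<le> 1" if "m \<le> N" for m
  proof -
    have "card (inj_indices m N) \<le> card (indices m N)"
      by (intro card_mono indices_finite) auto
    then have "real (card (inj_indices m N)) \<le> real N ^ m"
      by (metis card_indices of_nat_le_iff of_nat_power)
    then have "fact N / fact (N - m) \<le> real N ^ m" by (simp only: card_inj_indices[OF that])
    moreover have "0 < real N ^ m" using assms(2) by simp
    ultimately have "fact N / fact (N - m) / real N ^ m \<le> 1" by (simp only: divide_le_eq_1_pos)
    then show ?thesis by simp
  qed
  show "fact N / (fact (N - m) * real N ^ m) \<le> 1" by (rule le1[OF assms(1)])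
  show "1 - fact N / (fact (N - m) * real N ^ m) \<le> real m * (real m - 1) / (2 * real N)"
    using assms(1)
  proof (induction m)
    case (Suc m)
    let ?c = "\<lambda>m. fact N / (fact (N - m) * real N ^ m) :: real"
    have f: "(fact (N - m) :: real) = real (N - m) * fact (N - Suc m)"
    proof -
      have "N - m = Suc (N - Suc m)" using Suc.prems by simp
      then show ?thesis by (metis fact_Suc)
    qed
    have alg: "F / (e * (n * p)) = F / ((d * e) * p) * (d / n)" if "d \<noteq> 0" for F e n p d :: real
      using that by (simp add: field_simps)
    have "?c (Suc m) = ?c m * (real (N - m) / real N)"
      unfolding f power_Suc by (rule alg) (use Suc.prems in simp)
    also have "real (N - m) / real N = 1 - real m / real N"
      using Suc.prems by (simp add: of_nat_diff diff_divide_distrib)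
    finally have "?c (Suc m) = ?c m - ?c m * (real m / real N)"
      by (simp only: right_diff_distrib mult_1_right)
    then have "1 - ?c (Suc m) = (1 - ?c m) + ?c m * (real m / real N)" by simp
    also have "\<dots> \<le> real m * (real m - 1) / (2 * real N) + 1 * (real m / real N)"
      using Suc le1[of m] by (intro add_mono mult_right_mono) auto
    also have "\<dots> = real (Suc m) * (real (Suc m) - 1) / (2 * real N)"
      using assms(2) by (simp add: field_simps)
    finally show ?case .
  qed simp
qed

lemma weighted_sum_measure:
  fixes M :: "'b measure"
  assumes S: "finite S" and \<nu>: "\<And>s. s \<in> S \<Longrightarrow> sets (\<nu> s) = sets M"
  obtains R where "sets R = sets M" "\<And>A. A \<in> sets M \<Longrightarrow> emeasure R A = (\<Sum>s\<in>S. c * emeasure (\<nu> s) A)"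
proof -
  define R where "R = measure_of (space M) (sets M) (\<lambda>A. \<Sum>s\<in>S. c * emeasure (\<nu> s) A)"
  have sets: "sets R = sets M" by (simp add: R_def)
  have "emeasure R A = (\<Sum>s\<in>S. c * emeasure (\<nu> s) A)" if A: "A \<in> sets M" for A
  proof (rule emeasure_measure_of[OF R_def])
    show "sets M \<subseteq> Pow (space M)" by (rule sets.space_closed)
    show "A \<in> sets R" using A sets by simp
    show "positive (sets R) (\<lambda>A. \<Sum>s\<in>S. c * emeasure (\<nu> s) A)" by (simp add: positive_def)
    show "countably_additive (sets R) (\<lambda>A. \<Sum>s\<in>S. c * emeasure (\<nu> s) A)"
    proof (rule countably_additiveI)
      fix F :: "nat \<Rightarrow> 'b set" assume F: "range F \<subseteq> sets R" "disjoint_family F"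
      have "(\<Sum>n. \<Sum>s\<in>S. c * emeasure (\<nu> s) (F n)) = (\<Sum>s\<in>S. \<Sum>n. c * emeasure (\<nu> s) (F n))"
        by (rule suminf_sum) simp
      also have "\<dots> = (\<Sum>s\<in>S. c * emeasure (\<nu> s) (\<Union>(range F)))"
        using F \<nu> by (intro sum.cong refl) (simp add: suminf_emeasure sets)
      finally show "(\<Sum>n. \<Sum>s\<in>S. c * emeasure (\<nu> s) (F n)) = (\<Sum>s\<in>S. c * emeasure (\<nu> s) (\<Union>(range F)))" .
    qed
  qed
  with sets show ?thesis by (rule that)
qed

section \<open>Symmetric initial laws and the mean empirical power\<close>

locale symmetric_particles = particles K L N T
  for K :: "'a::euclidean_space \<Rightarrow> 'a \<Rightarrow> 'a" and L :: real and N :: nat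
    and T :: "real \<Rightarrow> (nat \<Rightarrow> 'a) \<Rightarrow> (nat \<Rightarrow> 'a)" +
  fixes P :: "(nat \<Rightarrow> 'a) measure"
  assumes sets_P: "sets P = sets (config_borel N)" and prob_P: "prob_space P"
    and sym: "symmetric_measure N P"
begin

sublocale P: prob_space P by (rule prob_P)

lemma space_P: "space P = config N"
  using sets_eq_imp_space_eq[OF sets_P] by (simp add: space_PiM)

lemma P_measurable: "f \<in> config_borel N \<rightarrow>\<^sub>M M \<Longrightarrow> f \<in> P \<rightarrow>\<^sub>M M"
  using measurable_cong_sets[OF sets_P refl] by blast

lemma select_flow_measurable:
  assumes "s \<in> indices m N"
  shows "(\<lambda>Z. select m (T t Z) s) \<in> P \<rightarrow>\<^sub>M config_borel m"
proof -
  have sel: "(\<lambda>z. select m z s) \<in> config_borel N \<rightarrow>\<^sub>M config_borel m"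
    by (intro measurable_restrict measurable_component_singleton) (rule PiE_mem[OF assms])
  show ?thesis by (rule measurable_compose[OF P_measurable[OF T_measurable] sel])
qed

lemma permute_measurable:
  assumes "\<sigma> permutes {..<N}"
  shows "(\<lambda>z. select N z \<sigma>) \<in> config_borel N \<rightarrow>\<^sub>M config_borel N"
  by (intro measurable_restrict measurable_component_singleton) (simp only: permutes_in_image[OF assms])

text \<open>Extending s to a permutation, equivariance of the flow moves the selection to the
  initial data, and symmetry of \<open>P\<close> removes it there. Symmetry thus propagates in
  time.\<close>

lemma select_flow_distr:
  assumes s: "s \<in> indices m N" "inj_on s {..<m}" and m: "m \<le> N"
  shows "distr P (config_borel m) (\<lambda>Z. select m (T t Z) s) = marginal m (distr P (config_borel N) (T t))"
proof -
  obtain \<sigma> where \<sigma>: "\<sigma> permutes {..<N}" "\<And>i. i < m \<Longrightarrow> \<sigma> i = s i"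
    using injective_index_extends[OF s m] by blast
  have mr: "(\<lambda>z. restrict z {..<m}) \<in> config_borel N \<rightarrow>\<^sub>M config_borel m"
    by (rule measurable_restrict) (use m in auto)
  have mrT: "(\<lambda>Z. restrict (T t Z) {..<m}) \<in> config_borel N \<rightarrow>\<^sub>M config_borel m"
    using measurable_compose[OF T_measurable mr] .
  have "distr P (config_borel m) (\<lambda>Z. select m (T t Z) s) = distr P (config_borel m) ((\<lambda>Z. restrict (T t Z) {..<m}) \<circ> (\<lambda>z. select N z \<sigma>))"
  proof (rule distr_cong)
    fix Z assume "Z \<in> space P"
    then have Z: "Z \<in> config N" by (simp add: space_P)
    show "select m (T t Z) s = ((\<lambda>Z. restrict (T t Z) {..<m}) \<circ> (\<lambda>z. select N z \<sigma>)) Z"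
      using T_permute[OF Z \<sigma>(1), of t] \<sigma>(2) m by (auto simp: fun_eq_iff)
  qed auto
  also have "\<dots> = distr (distr P (config_borel N) (\<lambda>z. select N z \<sigma>)) (config_borel m) (\<lambda>Z. restrict (T t Z) {..<m})"
    by (rule distr_distr[symmetric, OF mrT P_measurable[OF permute_measurable[OF \<sigma>(1)]]])
  also have "distr P (config_borel N) (\<lambda>z. select N z \<sigma>) = P"
    using sym \<sigma>(1) by (simp add: symmetric_measure_def)
  also have "distr P (config_borel m) (\<lambda>Z. restrict (T t Z) {..<m}) = marginal m (distr P (config_borel N) (T t))"
    unfolding marginal_def by (subst distr_distr[OF mr P_measurable[OF T_measurable]]) (simp add: o_def)
  finally show ?thesis .
qed

lemma mean_empirical_decomposition:
  assumes m: "m \<in> {1..N}"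
  shows "\<exists>R. sets R = sets (config_borel m) \<and> finite_measure R \<and>
    (\<forall>A\<in>sets (config_borel m).
      emeasure (P \<bind> (\<lambda>Z. tensor_power m (empirical_measure N (T t Z)))) A =
        ennreal (fact N / (fact (N - m) * real N ^ m)) *
          emeasure (marginal m (distr P (config_borel N) (T t))) A + emeasure R A) \<and>
    measure R (space R) = 1 - fact N / (fact (N - m) * real N ^ m) \<and>
    1 - fact N / (fact (N - m) * real N ^ m) \<le> real m * (real m - 1) / (2 * real N)"
proof -
  have mN: "m \<le> N" using m by simp
  let ?\<nu> = "\<lambda>s. distr P (config_borel m) (\<lambda>Z. select m (T t Z) s)"
  let ?I = "inj_indices m N" and ?J = "indices m N - inj_indices m N"
  let ?w = "ennreal (1 / real N ^ m)" and ?c = "fact N / (fact (N - m) * real N ^ m) :: real"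
  \<comment> \<open>The remainder is built from the laws of the selections with a repeated index,
    each of weight \<open>1 / real N ^ m\<close>. No measures are subtracted, so positivity is
    automatic.\<close>
  obtain R where R: "sets R = sets (config_borel m)"
    "\<And>A. A \<in> sets (config_borel m) \<Longrightarrow> emeasure R A = (\<Sum>s\<in>?J. ?w * emeasure (?\<nu> s) A)"
    by (rule weighted_sum_measure[of ?J ?\<nu> "config_borel m" ?w]) (use indices_finite in auto)
  have cI: "real (card ?I) / real N ^ m = ?c"
    by (simp add: card_inj_indices[OF mN])
  note cJ = card_noninjective_indices[OF mN N]
  have spR: "space R = space (config_borel m)" by (rule sets_eq_imp_space_eq[OF R(1)])
  have "emeasure R (space R) = (\<Sum>s\<in>?J. ?w * 1)"
    unfolding spR
  proof (subst R(2), simp, rule sum.cong[OF refl])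
    fix s assume "s \<in> ?J"
    then have "prob_space (?\<nu> s)" by (intro P.prob_space_distr select_flow_measurable) auto
    from prob_space.emeasure_space_1[OF this] show "?w * emeasure (?\<nu> s) (space (config_borel m)) = ?w * 1" by simp
  qed
  also have "\<dots> = ennreal (1 - ?c)"
    by (simp add: cJ[symmetric] ennreal_of_nat_eq_real_of_nat ennreal_mult[symmetric])
  finally have massR: "emeasure R (space R) = ennreal (1 - ?c)" .
  have "emeasure (P \<bind> (\<lambda>Z. tensor_power m (empirical_measure N (T t Z)))) A =
        ennreal ?c * emeasure (marginal m (distr P (config_borel N) (T t))) A + emeasure R A"
    if A: "A \<in> sets (config_borel m)" for A
  proof -
    have ms: "(\<lambda>Z. indicator A (select m (T t Z) s) :: ennreal) \<in> borel_measurable P"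
      if A: "A \<in> sets (config_borel m)" and "s \<in> indices m N" for s A
      by (rule measurable_compose[OF select_flow_measurable[OF that(2)]]) (use A in auto)
    \<comment> \<open>The formula for \<open>bind\<close> asks for measurability in Z. On each set
      the value is a finite weighted sum of indicators of selected configurations, which gives
      it.\<close>
    have "(\<lambda>Z. tensor_power m (empirical_measure N (T t Z))) \<in> P \<rightarrow>\<^sub>M subprob_algebra (config_borel m)"
    proof (rule measurable_subprob_algebra)
      show "subprob_space (tensor_power m (empirical_measure N (T t Z)))" for Z
        by (intro prob_space_imp_subprob_space prob_space_PiM empirical_measure_prob N)
      show "sets (tensor_power m (empirical_measure N (T t Z))) = sets (config_borel m)" for Z
        by (simp add: tensor_power_empirical[OF N])
      show "(\<lambda>Z. emeasure (tensor_power m (empirical_measure N (T t Z))) B) \<in> borel_measurable P"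
        if "B \<in> sets (config_borel m)" for B
        unfolding tensor_power_empirical_emeasure[OF N that]
        by (intro borel_measurable_sum borel_measurable_times_ennreal ms that) auto
    qed
    from emeasure_bind[OF P.not_empty this A]
    have "emeasure (P \<bind> (\<lambda>Z. tensor_power m (empirical_measure N (T t Z)))) A =
      (\<integral>\<^sup>+Z. (\<Sum>s\<in>indices m N. ?w * indicator A (select m (T t Z) s)) \<partial>P)"
      by (simp only: tensor_power_empirical_emeasure[OF N A])
    also have "\<dots> = (\<Sum>s\<in>indices m N. (\<integral>\<^sup>+Z. ?w * indicator A (select m (T t Z) s) \<partial>P))"
      by (rule nn_integral_sum) (intro borel_measurable_times_ennreal borel_measurable_const ms[OF A])
    also have "\<dots> = (\<Sum>s\<in>indices m N. ?w * (\<integral>\<^sup>+Z. indicator A (select m (T t Z) s) \<partial>P))"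
      by (intro sum.cong refl nn_integral_cmult ms[OF A])
    also have "\<dots> = (\<Sum>s\<in>indices m N. ?w * emeasure (?\<nu> s) A)"
    proof (intro sum.cong refl arg_cong[where f = "\<lambda>x. ?w * x"])
      fix s assume s: "s \<in> indices m N"
      have "emeasure (?\<nu> s) A = (\<integral>\<^sup>+x. indicator A x \<partial>?\<nu> s)" using A by simp
      also have "\<dots> = (\<integral>\<^sup>+Z. indicator A (select m (T t Z) s) \<partial>P)"
        by (rule nn_integral_distr[OF select_flow_measurable[OF s]]) (use A in simp)
      finally show "(\<integral>\<^sup>+Z. indicator A (select m (T t Z) s) \<partial>P) = emeasure (?\<nu> s) A" by simp
    qed
    also have "\<dots> = (\<Sum>s\<in>?J. ?w * emeasure (?\<nu> s) A) + (\<Sum>s\<in>?I. ?w * emeasure (?\<nu> s) A)"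
      by (rule sum.subset_diff) (auto simp: indices_finite)
    also have "(\<Sum>s\<in>?J. ?w * emeasure (?\<nu> s) A) = emeasure R A" by (simp only: R(2)[OF A])
    also have "(\<Sum>s\<in>?I. ?w * emeasure (?\<nu> s) A) = (\<Sum>s\<in>?I. ?w * emeasure (marginal m (distr P (config_borel N) (T t))) A)"
      by (intro sum.cong refl) (simp add: select_flow_distr mN)
    also have "\<dots> = ennreal ?c * emeasure (marginal m (distr P (config_borel N) (T t))) A"
      by (simp add: cI[symmetric] ennreal_of_nat_eq_real_of_nat ennreal_mult[symmetric] mult.assoc[symmetric])
    finally show ?thesis by (simp add: add.commute)
  qed
  moreover have "finite_measure R" by (rule finite_measureI) (simp add: massR)
  moreover have "measure R (space R) = 1 - ?c"
    using birthday_bound(1)[OF mN N] by (simp add: measure_def massR)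
  moreover have "1 - ?c \<le> real m * (real m - 1) / (2 * real N)" by (rule birthday_bound(2)[OF mN N])
  ultimately show ?thesis using R(1) by blast
qed

end

section \<open>Chaos estimate for symmetric initial laws\<close>

text \<open>Avoids optimal couplings: the infimum is approached up to \<eta>, and \<eta> tends to
  0.\<close>

lemma le_of_le_mult_add:
  fixes a c \<delta> :: real
  assumes "\<And>\<eta>. 0 < \<eta> \<Longrightarrow> a \<le> c * (\<delta> + \<eta>)"
  shows "a \<le> c * \<delta>"
proof -
  have "((\<lambda>\<eta>. c * (\<delta> + \<eta>)) \<longlongrightarrow> c * (\<delta> + 0)) (at_right 0)" by (intro tendsto_intros)
  moreover have "\<forall>\<^sub>F \<eta> in at_right 0. a \<le> c * (\<delta> + \<eta>)"
    using eventually_at_right_less[of "0::real"] by eventually_elim (rule assms)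
  ultimately have "a \<le> c * (\<delta> + 0)" by (rule tendsto_lowerbound) simp
  then show ?thesis by simp
qed

context symmetric_particles begin

text \<open>
  The bound is divided by the constant because the distance is not known to be measurable in \<open>Z\<close>,
  so that constants cannot be moved out of its lower integral.
\<close>

lemma flow_tensor_stability:
  fixes t :: real
  assumes \<nu>: "\<nu> \<in> P1" and X: "mean_field_flow K L \<nu> X" and Z: "Z \<in> config N"
    and m\<phi>: "\<phi> \<in> borel_measurable (config_borel m)"
    and lip: "\<And>x y. x \<in> config m \<Longrightarrow> y \<in> config m \<Longrightarrow> \<bar>\<phi> x - \<phi> y\<bar> \<le> C * (\<Sum>i<m. norm (x i - y i))"
    and bd: "\<And>z. z \<in> config m \<Longrightarrow> \<bar>\<phi> z\<bar> \<le> S" and C: "0 \<le> C"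
  defines "c \<equiv> C * (real m * exp (2 * L * \<bar>t\<bar>))"
  defines "D \<equiv> \<bar>(\<integral>z. \<phi> z \<partial>tensor_power m (empirical_measure N (T t Z))) - (\<integral>z. \<phi> z \<partial>tensor_power m (distr \<nu> borel (X t)))\<bar>"
  shows "c = 0 \<Longrightarrow> D = 0" and "0 < c \<Longrightarrow> ennreal (D / c) \<le> dist_MK (empirical_measure N Z) \<nu>"
proof -
  interpret \<nu>: prob_space \<nu> by (rule P1D(2)[OF \<nu>])
  have pX: "prob_space (distr \<nu> borel (X t))"
    by (intro \<nu>.prob_space_distr P1_measurable[OF \<nu>] mean_field_flowD(6)[OF X])
  \<comment> \<open>Either C = 0 or m = 0, so \<phi> is constant on configurations and both
    integrals equal its value. An exact zero is required, since 0 times an infinite distance is 0 in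
    the final bound.\<close>
  show "D = 0" if "c = 0"
  proof -
    have c0: "C * (\<Sum>i<m. norm (x i - y i)) = 0" for x y :: "nat \<Rightarrow> 'a"
      using that by (cases "C = 0") (auto simp: c_def)
    define z0 :: "nat \<Rightarrow> 'a" where "z0 = (\<lambda>i\<in>{..<m}. 0)"
    have const: "\<phi> x = \<phi> z0" if "x \<in> config m" for x
    proof -
      have "z0 \<in> config m" by (simp add: z0_def)
      from lip[OF that this] have "\<bar>\<phi> x - \<phi> z0\<bar> \<le> 0" by (simp only: c0)
      then show ?thesis by simp
    qed
    have "(\<integral>z. \<phi> z \<partial>tensor_power m \<rho>) = \<phi> z0" if \<rho>: "prob_space \<rho>" "space \<rho> = UNIV" for \<rho> :: "'a measure"
    proof -
      interpret R: prob_space "tensor_power m \<rho>" by (rule prob_space_PiM) (rule \<rho>)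
      have "(\<integral>z. \<phi> z \<partial>tensor_power m \<rho>) = (\<integral>z. \<phi> z0 \<partial>tensor_power m \<rho>)"
        by (rule Bochner_Integration.integral_cong[OF refl]) (rule const, simp add: space_PiM \<rho>(2))
      then show ?thesis by (simp add: R.prob_space)
    qed
    from this[OF empirical_measure_prob[OF N]] this[OF pX] show ?thesis
      by (simp add: D_def empirical_measure_eq_distr[OF N])
  qed
  show "ennreal (D / c) \<le> dist_MK (empirical_measure N Z) \<nu>" if c: "0 < c"
  proof (cases "dist_MK (empirical_measure N Z) \<nu>")
    case (real \<delta>)
    have "D \<le> c * (\<delta> + \<eta>)" if \<eta>: "0 < \<eta>" for \<eta>
    proof -
      have "dist_MK (empirical_measure N Z) \<nu> < ennreal (\<delta> + \<eta>)" using real \<eta> by (simp add: ennreal_less_iff)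
      then obtain \<pi> where \<pi>: "\<pi> \<in> couplings (empirical_measure N Z) \<nu>"
        "(\<integral>\<^sup>+p. ennreal (norm (fst p - snd p)) \<partial>\<pi>) < ennreal (\<delta> + \<eta>)" by (rule dist_MK_lessE)
      obtain \<pi>' where \<pi>': "\<pi>' \<in> couplings (empirical_measure N (T t Z)) (distr \<nu> borel (X t))"
        "(\<integral>\<^sup>+p. ennreal (norm (fst p - snd p)) \<partial>\<pi>') \<le> ennreal (exp (2 * L * \<bar>t\<bar>) * (\<delta> + \<eta>))"
        using dobrushin_coupling[OF \<nu> X Z \<pi>(1) less_imp_le[OF \<pi>(2)], of t] real \<eta> by auto
      have "D \<le> C * (real m * (exp (2 * L * \<bar>t\<bar>) * (\<delta> + \<eta>)))"
        unfolding D_def by (rule tensor_coupling_bound[OF \<pi>' _ m\<phi> lip bd C]) (use real \<eta> in auto)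
      then show ?thesis by (simp add: c_def mult_ac)
    qed
    then have "D \<le> c * \<delta>" by (rule le_of_le_mult_add)
    then show ?thesis using real c by (simp add: ennreal_leI pos_divide_le_eq mult.commute)
  qed simp
qed

text \<open>The mean of the empirical power is inserted between the two terms. Against the marginal,
  injective maps cancel and each other map costs at most 2S, so half of m(m-1)/N times 2S gives the
  first term. Against the limit, the deterministic stability estimate is integrated over the initial
  law.\<close>

theorem marginal_chaos_bound:
  assumes \<nu>: "\<nu> \<in> P1" and X: "mean_field_flow K L \<nu> X" and m: "m \<in> {1..N}"
    and Linf: "Linf_norm m \<phi> < \<infinity>" and Lip: "Lip_const m \<phi> < \<infinity>"
  shows "ennreal \<bar>(\<integral>z. \<phi> z \<partial>marginal m (distr P (config_borel N) (T t)))
             - (\<integral>z. \<phi> z \<partial>tensor_power m (distr \<nu> borel (X t)))\<bar>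
    \<le> Linf_norm m \<phi> * ennreal (real m * (real m - 1) / real N)
      + ennreal (real m * exp (2 * L * \<bar>t\<bar>)) * Lip_const m \<phi> *
          (\<integral>\<^sup>+Z. dist_MK (empirical_measure N Z) \<nu> \<partial>P)"
proof -
  have mN: "m \<le> N" and m1: "1 \<le> m" using m by auto
  define C where "C = enn2real (Lip_const m \<phi>)"
  define S where "S = enn2real (Linf_norm m \<phi>)"
  have C: "0 \<le> C" "Lip_const m \<phi> = ennreal C" and S: "0 \<le> S" "Linf_norm m \<phi> = ennreal S"
    using Lip Linf by (auto simp: C_def S_def less_top)
  have lip: "\<bar>\<phi> x - \<phi> y\<bar> \<le> C * (\<Sum>i<m. norm (x i - y i))" if "x \<in> config m" "y \<in> config m" for x y
    unfolding C_def by (rule Lip_const_finite[OF Lip that])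
  have m\<phi>: "\<phi> \<in> borel_measurable (config_borel m)"
    by (rule config_lipschitz_measurable[where C = C]) (simp add: dist_real_def lip)
  have bd: "\<bar>\<phi> z\<bar> \<le> S" if "z \<in> config m" for z
    using Linf_norm_upper[of m \<phi> C z] lip C(1) that S by (simp add: ennreal_le_iff)
  define E where "E s = (\<integral>Z. \<phi> (select m (T t Z) s) \<partial>P)" for s
  define A where "A = (\<integral>z. \<phi> z \<partial>marginal m (distr P (config_borel N) (T t)))"
  define B where "B = (\<integral>z. \<phi> z \<partial>tensor_power m (distr \<nu> borel (X t)))"
  define I where "I Z = (\<integral>z. \<phi> z \<partial>tensor_power m (empirical_measure N (T t Z)))" for Z
  have int: "integrable P (\<lambda>Z. \<phi> (select m (T t Z) s))" if s: "s \<in> indices m N" for s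
  proof (rule P.integrable_const_bound[where B = S])
    show "AE Z in P. norm (\<phi> (select m (T t Z) s)) \<le> S" using bd by (intro AE_I2) simp
  qed (rule measurable_compose[OF select_flow_measurable[OF s] m\<phi>])
  have EA: "E s = A" if s: "s \<in> inj_indices m N" for s
  proof -
    have "E s = (\<integral>z. \<phi> z \<partial>distr P (config_borel m) (\<lambda>Z. select m (T t Z) s))"
      unfolding E_def using s by (intro integral_distr[symmetric] select_flow_measurable m\<phi>) simp
    then show ?thesis using s by (simp add: A_def select_flow_distr mN)
  qed
  have Eb: "\<bar>E s\<bar> \<le> S" if s: "s \<in> indices m N" for s
  proof -
    have "\<bar>E s\<bar> \<le> (\<integral>Z. S \<partial>P)" unfolding E_def
      using int[OF s] bd by (intro integral_abs_le) auto
    then show ?thesis by (simp add: P.prob_space)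
  qed
  obtain \<sigma>0 where \<sigma>0: "\<sigma>0 \<in> inj_indices m N"
  proof
    show "(\<lambda>i\<in>{..<m}. i) \<in> inj_indices m N" using mN by (auto simp: inj_on_def)
  qed
  have Ab: "\<bar>A\<bar> \<le> S" using EA[OF \<sigma>0] Eb \<sigma>0 by auto
  let ?c = "fact N / (fact (N - m) * real N ^ m) :: real"
  have I: "I Z = (\<Sum>s\<in>indices m N. \<phi> (select m (T t Z) s)) / real N ^ m" for Z
    unfolding I_def by (rule tensor_power_empirical_integral[OF N m\<phi>])
  have intI: "integrable P I" unfolding I by (intro integrable_divide Bochner_Integration.integrable_sum int)
  have EI: "(\<integral>Z. I Z \<partial>P) = (\<Sum>s\<in>indices m N. E s) / real N ^ m"
    unfolding I by (simp add: int E_def)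
  let ?J = "indices m N - inj_indices m N"
  have Nm: "0 < real N ^ m" using N by simp
  note cardJ = card_noninjective_indices[OF mN N]
  have "A - (\<integral>Z. I Z \<partial>P) = (\<Sum>s\<in>indices m N. A - E s) / real N ^ m"
    using Nm by (simp add: EI sum_subtractf card_indices diff_divide_distrib)
  also have "(\<Sum>s\<in>indices m N. A - E s) = (\<Sum>s\<in>?J. A - E s)"
    by (rule sum.mono_neutral_right[OF indices_finite]) (auto simp: EA)
  finally have "\<bar>A - (\<integral>Z. I Z \<partial>P)\<bar> = \<bar>\<Sum>s\<in>?J. A - E s\<bar> / real N ^ m"
    using Nm by (simp add: abs_divide)
  also have "\<dots> \<le> (\<Sum>s\<in>?J. 2 * S) / real N ^ m"
  proof (intro divide_right_mono order_trans[OF sum_abs] sum_mono)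
    fix s assume "s \<in> ?J"
    then show "\<bar>A - E s\<bar> \<le> 2 * S" using Ab Eb[of s] by auto
  qed (use Nm in simp)
  also have "\<dots> = (real (card ?J) / real N ^ m) * (2 * S)" by simp
  also have "\<dots> = (1 - ?c) * (2 * S)" by (simp only: cardJ)
  also have "\<dots> \<le> real m * (real m - 1) / (2 * real N) * (2 * S)"
    using S by (intro mult_right_mono birthday_bound(2) mN N) auto
  also have "\<dots> = S * (real m * (real m - 1) / real N)" using N by simp
  finally have first: "\<bar>A - (\<integral>Z. I Z \<partial>P)\<bar> \<le> S * (real m * (real m - 1) / real N)" .
  define c where "c = C * (real m * exp (2 * L * \<bar>t\<bar>))"
  have c0: "0 \<le> c" using C by (simp add: c_def)
  note stab = flow_tensor_stability[OF \<nu> X _ m\<phi> lip bd C(1), of _ t, folded c_def]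
  have "\<bar>(\<integral>Z. I Z \<partial>P) - B\<bar> = \<bar>\<integral>Z. I Z - B \<partial>P\<bar>" using intI by (simp add: P.prob_space)
  also have "\<dots> \<le> (\<integral>Z. \<bar>I Z - B\<bar> \<partial>P)" using intI by (intro integral_abs_le) auto
  finally have "ennreal \<bar>(\<integral>Z. I Z \<partial>P) - B\<bar> \<le> ennreal (\<integral>Z. \<bar>I Z - B\<bar> \<partial>P)" by (rule ennreal_leI)
  also have "\<dots> = (\<integral>\<^sup>+Z. ennreal \<bar>I Z - B\<bar> \<partial>P)"
    using intI by (intro nn_integral_eq_integral[symmetric]) auto
  also have "\<dots> \<le> ennreal c * (\<integral>\<^sup>+Z. dist_MK (empirical_measure N Z) \<nu> \<partial>P)"
  proof (cases "c = 0")
    case True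
    have IB: "\<bar>I Z - B\<bar> = 0" if "Z \<in> space P" for Z
      unfolding I_def B_def using that by (intro stab(1) True) (simp only: space_P)
    have "(\<integral>\<^sup>+Z. ennreal \<bar>I Z - B\<bar> \<partial>P) = (\<integral>\<^sup>+Z. 0 \<partial>P)"
      by (rule nn_integral_cong) (simp only: IB ennreal_0)
    then show ?thesis by simp
  next
    case False
    then have c: "0 < c" using c0 by simp
    have "(\<integral>\<^sup>+Z. ennreal \<bar>I Z - B\<bar> \<partial>P) = (\<integral>\<^sup>+Z. ennreal c * ennreal (\<bar>I Z - B\<bar> / c) \<partial>P)"
    proof (rule nn_integral_cong)
      show "ennreal \<bar>I Z - B\<bar> = ennreal c * ennreal (\<bar>I Z - B\<bar> / c)" for Z
        using c by (subst ennreal_mult[symmetric]) auto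
    qed
    also have "\<dots> = ennreal c * (\<integral>\<^sup>+Z. ennreal (\<bar>I Z - B\<bar> / c) \<partial>P)"
      using intI by (intro nn_integral_cmult) auto
    also have "\<dots> \<le> ennreal c * (\<integral>\<^sup>+Z. dist_MK (empirical_measure N Z) \<nu> \<partial>P)"
    proof (intro mult_left_mono nn_integral_mono)
      fix Z assume "Z \<in> space P"
      then show "ennreal (\<bar>I Z - B\<bar> / c) \<le> dist_MK (empirical_measure N Z) \<nu>"
        unfolding I_def B_def by (intro stab(2) c) (simp only: space_P)
    qed simp
    finally show ?thesis .
  qed
  finally have second: "ennreal \<bar>(\<integral>Z. I Z \<partial>P) - B\<bar> \<le> ennreal c * (\<integral>\<^sup>+Z. dist_MK (empirical_measure N Z) \<nu> \<partial>P)" .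
  have "ennreal \<bar>A - B\<bar> \<le> ennreal (\<bar>A - (\<integral>Z. I Z \<partial>P)\<bar> + \<bar>(\<integral>Z. I Z \<partial>P) - B\<bar>)"
    by (intro ennreal_leI) linarith
  also have "\<dots> = ennreal \<bar>A - (\<integral>Z. I Z \<partial>P)\<bar> + ennreal \<bar>(\<integral>Z. I Z \<partial>P) - B\<bar>" by simp
  also have "\<dots> \<le> ennreal (S * (real m * (real m - 1) / real N)) + ennreal c * (\<integral>\<^sup>+Z. dist_MK (empirical_measure N Z) \<nu> \<partial>P)"
    by (intro add_mono ennreal_leI first second)
  also have "ennreal (S * (real m * (real m - 1) / real N)) = Linf_norm m \<phi> * ennreal (real m * (real m - 1) / real N)"
    using S m1 by (simp add: ennreal_mult[symmetric])
  also have "ennreal c = ennreal (real m * exp (2 * L * \<bar>t\<bar>)) * Lip_const m \<phi>"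
    using C by (simp add: c_def ennreal_mult[symmetric] mult.commute)
  finally show ?thesis by (simp only: A_def B_def)
qed

end

lemma (in prob_space) expectation_le_sqrt:
  fixes f :: "'a \<Rightarrow> real"
  assumes f: "f \<in> borel_measurable M" and f2: "integrable M (\<lambda>x. (f x)\<^sup>2)"
  shows "integrable M f" "expectation f \<le> sqrt (expectation (\<lambda>x. (f x)\<^sup>2))"
proof -
  show i: "integrable M f"
  proof (rule Bochner_Integration.integrable_bound[OF _ f])
    show "integrable M (\<lambda>x. 1 + (f x)\<^sup>2)" using f2 by simp
    have "\<bar>y\<bar> \<le> 1 + y\<^sup>2" for y :: real
      using zero_le_power2[of "\<bar>y\<bar> - 1"] by (simp add: power2_diff)
    then show "AE x in M. norm (f x) \<le> norm (1 + (f x)\<^sup>2)" by (intro AE_I2) (simp add: abs_of_nonneg)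
  qed
  have "0 \<le> variance f" by (rule variance_positive)
  also have "\<dots> = expectation (\<lambda>x. (f x)\<^sup>2) - (expectation f)\<^sup>2" by (rule variance_eq[OF i f2])
  finally show "expectation f \<le> sqrt (expectation (\<lambda>x. (f x)\<^sup>2))" by (intro real_le_rsqrt) simp
qed

section \<open>Independent initial data\<close>

text \<open>Fubini with coordinate l integrated first: a function centred in one independent
  coordinate has mean zero.\<close>

lemma tensor_power_integral_conditional_zero:
  fixes \<mu> :: "'a measure" and f :: "(nat \<Rightarrow> 'a) \<Rightarrow> real"
  assumes \<mu>: "prob_space \<mu>" and l: "l < N" and f: "integrable (tensor_power N \<mu>) f"
    and zero: "\<And>x. (\<integral>y. f (x(l := y)) \<partial>\<mu>) = 0"
  shows "(\<integral>z. f z \<partial>tensor_power N \<mu>) = 0"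
proof -
  interpret product_prob_space "\<lambda>_::nat. \<mu>" by (rule product_prob_spaceI) (rule \<mu>)
  have I: "{..<N} = insert l ({..<N} - {l})" using l by auto
  have "(\<integral>z. f z \<partial>tensor_power N \<mu>) = (\<integral>z. f z \<partial>PiM (insert l ({..<N} - {l})) (\<lambda>_. \<mu>))"
    using I by simp
  also have "\<dots> = (\<integral>x. (\<integral>y. f (x(l := y)) \<partial>\<mu>) \<partial>PiM ({..<N} - {l}) (\<lambda>_. \<mu>))"
    by (rule product_integral_insert) (use f I in auto)
  finally show ?thesis by (simp add: zero)
qed

text \<open>
  The summands \<open>F (Z k) (Z l)\<close>, centred given \<open>Z k\<close>, are orthogonal. The diagonal term \<open>l = k\<close> has nonzero mean but
  is orthogonal to the others, and is bounded like them; 18 comes from \<open>(u + v + w)\<^sup>2 \<le> 3 * (u\<^sup>2 + v\<^sup>2 + w\<^sup>2)\<close>.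
\<close>

lemma mean_square_deviation:
  fixes F :: "'a::euclidean_space \<Rightarrow> 'a \<Rightarrow> 'a"
  assumes \<mu>: "\<mu> \<in> P1" and mF: "(\<lambda>p. F (fst p) (snd p)) \<in> borel_measurable borel"
    and F: "\<And>x y. norm (F x y) \<le> B * norm (x - y)" and B: "0 \<le> B"
    and i2: "integrable \<mu> (\<lambda>x. (norm x)\<^sup>2)" and M2: "(\<integral>x. (norm x)\<^sup>2 \<partial>\<mu>) \<le> M2" and k: "k < N"
  defines "r \<equiv> \<lambda>Z. norm ((\<integral>y. F (Z k) y \<partial>\<mu>) - (1 / real N) *\<^sub>R (\<Sum>l<N. F (Z k) (Z l)))"
  shows "integrable (tensor_power N \<mu>) r" "(\<integral>Z. r Z \<partial>tensor_power N \<mu>) \<le> B * sqrt (18 * M2 / real N)"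
proof -
  note p\<mu> = P1D(2)[OF \<mu>]
  interpret \<mu>: prob_space \<mu> by (rule p\<mu>)
  interpret T: prob_space "tensor_power N \<mu>" by (rule prob_space_PiM) (rule p\<mu>)
  define V where "V x = (\<integral>y. F x y \<partial>\<mu>)" for x
  define m1 where "m1 = (\<integral>x. norm x \<partial>\<mu>)"
  note int1 = P1D(4)[OF \<mu>]
  have m1: "0 \<le> m1" "m1\<^sup>2 \<le> M2"
  proof -
    show "0 \<le> m1" unfolding m1_def by (intro integral_nonneg_AE) simp
    have "m1 \<le> sqrt (\<integral>x. (norm x)\<^sup>2 \<partial>\<mu>)" unfolding m1_def
      by (rule \<mu>.expectation_le_sqrt(2)[OF borel_measurable_integrable[OF int1] i2])
    then have "m1\<^sup>2 \<le> (sqrt (\<integral>x. (norm x)\<^sup>2 \<partial>\<mu>))\<^sup>2" using \<open>0 \<le> m1\<close> by (rule power_mono)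
    also have "\<dots> = (\<integral>x. (norm x)\<^sup>2 \<partial>\<mu>)" by (intro real_sqrt_pow2 integral_nonneg_AE) simp
    finally show "m1\<^sup>2 \<le> M2" using M2 by simp
  qed
  have Flin: "norm (F x y) \<le> B * norm x + B * norm y" for x y
    using order_trans[OF F mult_left_mono[OF norm_triangle_ineq4 B], of x y] by (simp add: algebra_simps)
  have mFx: "F x \<in> borel_measurable borel" for x
  proof -
    have "(\<lambda>y. F (fst (x, y)) (snd (x, y))) \<in> borel_measurable borel"
      by (rule measurable_compose[OF _ mF]) (intro borel_measurable_Pair, auto)
    then show ?thesis by simp
  qed
  have intF: "integrable \<mu> (F x)" for x by (rule P1_integrable_linear_growth[OF \<mu> mFx Flin])
  have Vlin: "norm (V x) \<le> B * norm x + B * m1" for x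
  proof -
    have "norm (V x) \<le> (\<integral>y. norm (F x y) \<partial>\<mu>)" unfolding V_def by (rule integral_norm_bound)
    also have "\<dots> \<le> (\<integral>y. B * norm x + B * norm y \<partial>\<mu>)"
      using intF int1 Flin by (intro integral_mono) auto
    also have "\<dots> = B * norm x + B * m1" using int1 by (simp add: m1_def \<mu>.prob_space)
    finally show ?thesis .
  qed
  have mV: "V \<in> borel_measurable borel"
  proof -
    have "(\<lambda>p. F (fst p) (snd p)) \<in> borel_measurable (borel \<Otimes>\<^sub>M \<mu>)"
      using mF by (subst measurable_cong_sets[OF _ refl, of _ "borel :: ('a \<times> 'a) measure"])
        (simp_all add: borel_prod[symmetric] sets_pair_measure_cong[OF refl P1D(1)[OF \<mu>]])
    then have "(\<lambda>(x, y). F x y) \<in> borel_measurable (borel \<Otimes>\<^sub>M \<mu>)" by (simp add: case_prod_beta)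
    then show ?thesis unfolding V_def by (rule \<mu>.borel_measurable_lebesgue_integral)
  qed
  have comp: "(\<lambda>Z. Z i) \<in> borel_measurable (tensor_power N \<mu>)" if "i < N" for i
    using measurable_component_singleton[of i "{..<N}" "\<lambda>_. \<mu>"] that measurable_cong_sets[OF refl P1D(1)[OF \<mu>]] by blast
  define a where "a l Z = F (Z k) (Z l) - V (Z k)" for l Z
  have ma: "a l \<in> borel_measurable (tensor_power N \<mu>)" if "l < N" for l
  proof -
    have "(\<lambda>Z. F (fst (Z k, Z l)) (snd (Z k, Z l))) \<in> borel_measurable (tensor_power N \<mu>)"
      by (rule measurable_compose[OF _ mF]) (intro borel_measurable_Pair comp k that)
    then show ?thesis unfolding a_def
      by (intro borel_measurable_diff measurable_compose[OF comp[OF k] mV]) simp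
  qed
  \<comment> \<open>The kernel gives B(|Z_k| + |Z_l|) and its mean B(|Z_k| + m1). After squaring,
    the weights 4, 1, 1 sum to 6; with the factor 3 and m1^2 \<le> M2 this makes 18.\<close>
  have a2: "(norm (a l Z))\<^sup>2 \<le> 3 * B\<^sup>2 * (4 * (norm (Z k))\<^sup>2 + (norm (Z l))\<^sup>2 + m1\<^sup>2)" for l Z
  proof -
    have "norm (a l Z) \<le> norm (F (Z k) (Z l)) + norm (V (Z k))" unfolding a_def by (rule norm_triangle_ineq4)
    also have "\<dots> \<le> B * (2 * norm (Z k) + norm (Z l) + m1)"
      using Flin[of "Z k" "Z l"] Vlin[of "Z k"] by (simp add: algebra_simps)
    finally have "(norm (a l Z))\<^sup>2 \<le> (B * (2 * norm (Z k) + norm (Z l) + m1))\<^sup>2" by (rule power_mono) simp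
    also have "\<dots> = B\<^sup>2 * (2 * norm (Z k) + norm (Z l) + m1)\<^sup>2" by (simp add: power_mult_distrib)
    also have "\<dots> \<le> B\<^sup>2 * (3 * ((2 * norm (Z k))\<^sup>2 + (norm (Z l))\<^sup>2 + m1\<^sup>2))"
    proof (rule mult_left_mono)
      have sq: "(u + v + w)\<^sup>2 \<le> 3 * (u\<^sup>2 + v\<^sup>2 + w\<^sup>2)" for u v w :: real
      proof -
        have "3 * (u\<^sup>2 + v\<^sup>2 + w\<^sup>2) - (u + v + w)\<^sup>2 = (u - v)\<^sup>2 + (v - w)\<^sup>2 + (u - w)\<^sup>2"
          by (simp add: power2_eq_square algebra_simps)
        moreover have "0 \<le> (u - v)\<^sup>2 + (v - w)\<^sup>2 + (u - w)\<^sup>2" by simp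
        ultimately show ?thesis by linarith
      qed
      show "(2 * norm (Z k) + norm (Z l) + m1)\<^sup>2 \<le> 3 * ((2 * norm (Z k))\<^sup>2 + (norm (Z l))\<^sup>2 + m1\<^sup>2)" by (rule sq)
    qed simp
    finally show ?thesis by (simp add: power_mult_distrib algebra_simps)
  qed
  note ci = tensor_power_component_integral[OF p\<mu> _ i2]
  have ib: "integrable (tensor_power N \<mu>) (\<lambda>Z. 3 * B\<^sup>2 * (4 * (norm (Z k))\<^sup>2 + (norm (Z l))\<^sup>2 + m1\<^sup>2))" if "l < N" for l
    by (intro integrable_mult_right Bochner_Integration.integrable_add ci(1) k that T.integrable_const)
  have ia2: "integrable (tensor_power N \<mu>) (\<lambda>Z. (norm (a l Z))\<^sup>2)" if l: "l < N" for l
    by (rule Bochner_Integration.integrable_bound[OF ib[OF l]])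
      (use ma[OF l] a2 in \<open>auto intro!: AE_I2 order_trans[OF a2 abs_ge_self]\<close>)
  have Ea2: "(\<integral>Z. (norm (a l Z))\<^sup>2 \<partial>tensor_power N \<mu>) \<le> 18 * B\<^sup>2 * M2" if l: "l < N" for l
  proof -
    have "(\<integral>Z. (norm (a l Z))\<^sup>2 \<partial>tensor_power N \<mu>) \<le> (\<integral>Z. 3 * B\<^sup>2 * (4 * (norm (Z k))\<^sup>2 + (norm (Z l))\<^sup>2 + m1\<^sup>2) \<partial>tensor_power N \<mu>)"
      by (intro integral_mono ia2 ib l a2)
    also have "\<dots> = 3 * B\<^sup>2 * (4 * (\<integral>x. (norm x)\<^sup>2 \<partial>\<mu>) + (\<integral>x. (norm x)\<^sup>2 \<partial>\<mu>) + m1\<^sup>2)"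
      by (simp add: ci k l T.prob_space)
    also have "\<dots> \<le> 3 * B\<^sup>2 * (4 * M2 + M2 + M2)" using M2 m1 by (intro mult_left_mono) auto
    finally show ?thesis by simp
  qed
  have ia: "integrable (tensor_power N \<mu>) (\<lambda>Z. a l Z \<bullet> a l' Z)" if l: "l < N" "l' < N" for l l'
  proof (rule Bochner_Integration.integrable_bound[OF Bochner_Integration.integrable_add[OF ia2[OF l(1)] ia2[OF l(2)]]])
    show "(\<lambda>Z. a l Z \<bullet> a l' Z) \<in> borel_measurable (tensor_power N \<mu>)" by (intro borel_measurable_inner ma l)
    have "\<bar>x \<bullet> y\<bar> \<le> (norm x)\<^sup>2 + (norm y)\<^sup>2" for x y :: 'a
    proof -
      have "\<bar>x \<bullet> y\<bar> \<le> norm x * norm y" by (rule Cauchy_Schwarz_ineq2)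
      moreover have "2 * (norm x * norm y) \<le> (norm x)\<^sup>2 + (norm y)\<^sup>2" using sum_squares_bound[of "norm x" "norm y"] by (simp add: mult.assoc)
      moreover have "0 \<le> norm x * norm y" by simp
      ultimately show ?thesis by linarith
    qed
    then show "AE Z in tensor_power N \<mu>. norm (a l Z \<bullet> a l' Z) \<le> norm ((norm (a l Z))\<^sup>2 + (norm (a l' Z))\<^sup>2)"
      by (intro AE_I2) (simp add: abs_of_nonneg)
  qed
  \<comment> \<open>Changing coordinate l leaves both Z_k and the summand l' unaffected, because l
    differs from k and from l'. Integration over it therefore centres the summand l.\<close>
  have orth1: "(\<integral>Z. a l Z \<bullet> a l' Z \<partial>tensor_power N \<mu>) = 0" if l: "l < N" "l' < N" "l \<noteq> l'" "l \<noteq> k" for l l'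
  proof (rule tensor_power_integral_conditional_zero[OF p\<mu> l(1) ia[OF l(1,2)]])
    fix x :: "nat \<Rightarrow> 'a"
    have "(\<integral>y. a l (x(l := y)) \<bullet> a l' (x(l := y)) \<partial>\<mu>) = (\<integral>y. (F (x k) y - V (x k)) \<bullet> a l' x \<partial>\<mu>)"
      using l by (simp add: a_def)
    also have "\<dots> = (\<integral>y. F (x k) y - V (x k) \<partial>\<mu>) \<bullet> a l' x"
      by (rule integral_inner_left) (simp add: intF)
    also have "(\<integral>y. F (x k) y - V (x k) \<partial>\<mu>) = 0" using intF by (simp add: \<mu>.prob_space V_def)
    finally show "(\<integral>y. a l (x(l := y)) \<bullet> a l' (x(l := y)) \<partial>\<mu>) = 0" by (simp only: inner_zero_left)
  qed
  \<comment> \<open>Of two distinct indices at least one differs from k, and that one is integrated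
    out.\<close>
  have orth: "(\<integral>Z. a l Z \<bullet> a l' Z \<partial>tensor_power N \<mu>) = 0" if l: "l < N" "l' < N" "l \<noteq> l'" for l l'
    using orth1[of l l'] orth1[of l' l] l by (cases "l = k") (auto simp: inner_commute)
  have N: "0 < real N" using k by simp
  have r: "(r Z)\<^sup>2 = (1 / (real N)\<^sup>2) * (\<Sum>l<N. \<Sum>l'<N. a l Z \<bullet> a l' Z)" for Z
  proof -
    have "(\<integral>y. F (Z k) y \<partial>\<mu>) - (1 / real N) *\<^sub>R (\<Sum>l<N. F (Z k) (Z l)) = - ((1 / real N) *\<^sub>R (\<Sum>l<N. a l Z))"
      using N by (simp add: a_def sum_subtractf scaleR_diff_right V_def sum_constant_scaleR)
    then have "r Z = (1 / real N) * norm (\<Sum>l<N. a l Z)" by (simp add: r_def)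
    then have "(r Z)\<^sup>2 = (1 / (real N)\<^sup>2) * (norm (\<Sum>l<N. a l Z))\<^sup>2" by (simp add: power_divide)
    then show ?thesis by (subst sum.swap) (simp add: power2_norm_eq_inner inner_sum_left inner_sum_right)
  qed
  have ir2: "integrable (tensor_power N \<mu>) (\<lambda>Z. (r Z)\<^sup>2)"
    unfolding r by (intro integrable_mult_right Bochner_Integration.integrable_sum ia) auto
  have mr: "r \<in> borel_measurable (tensor_power N \<mu>)"
  proof -
    have "(\<lambda>Z. norm ((1 / real N) *\<^sub>R (\<Sum>l<N. a l Z))) \<in> borel_measurable (tensor_power N \<mu>)"
      by (intro measurable_compose[OF _ borel_measurable_norm] borel_measurable_scaleR borel_measurable_const borel_measurable_sum ma) simp
    moreover have "r = (\<lambda>Z. norm ((1 / real N) *\<^sub>R (\<Sum>l<N. a l Z)))"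
      using N by (auto simp: r_def a_def fun_eq_iff sum_subtractf scaleR_diff_right V_def sum_constant_scaleR norm_minus_commute)
    ultimately show ?thesis by simp
  qed
  have "(\<integral>Z. (\<Sum>l<N. \<Sum>l'<N. a l Z \<bullet> a l' Z) \<partial>tensor_power N \<mu>) =
      (\<Sum>l<N. (\<integral>Z. (\<Sum>l'<N. a l Z \<bullet> a l' Z) \<partial>tensor_power N \<mu>))"
    by (intro Bochner_Integration.integral_sum Bochner_Integration.integrable_sum ia) auto
  also have "\<dots> = (\<Sum>l<N. \<Sum>l'<N. (\<integral>Z. a l Z \<bullet> a l' Z \<partial>tensor_power N \<mu>))"
    by (intro sum.cong refl Bochner_Integration.integral_sum ia) auto
  finally have "(\<integral>Z. (r Z)\<^sup>2 \<partial>tensor_power N \<mu>) = (1 / (real N)\<^sup>2) * (\<Sum>l<N. \<Sum>l'<N. (\<integral>Z. a l Z \<bullet> a l' Z \<partial>tensor_power N \<mu>))"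
    unfolding r by simp
  also have "(\<Sum>l<N. \<Sum>l'<N. (\<integral>Z. a l Z \<bullet> a l' Z \<partial>tensor_power N \<mu>)) = (\<Sum>l<N. (\<integral>Z. a l Z \<bullet> a l Z \<partial>tensor_power N \<mu>))"
  proof (rule sum.cong[OF refl])
    fix l assume "l \<in> {..<N}"
    then have "(\<Sum>l'<N. (\<integral>Z. a l Z \<bullet> a l' Z \<partial>tensor_power N \<mu>)) = (\<Sum>l'\<in>{l}. (\<integral>Z. a l Z \<bullet> a l' Z \<partial>tensor_power N \<mu>))"
      by (intro sum.mono_neutral_right) (auto simp: orth)
    then show "(\<Sum>l'<N. (\<integral>Z. a l Z \<bullet> a l' Z \<partial>tensor_power N \<mu>)) = (\<integral>Z. a l Z \<bullet> a l Z \<partial>tensor_power N \<mu>)" by simp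
  qed
  also have "\<dots> \<le> (\<Sum>l<N. 18 * B\<^sup>2 * M2)"
    using Ea2 by (intro sum_mono) (simp add: power2_norm_eq_inner)
  then have "(1 / (real N)\<^sup>2) * (\<Sum>l<N. (\<integral>Z. a l Z \<bullet> a l Z \<partial>tensor_power N \<mu>)) \<le> (1 / (real N)\<^sup>2) * (\<Sum>l<N. 18 * B\<^sup>2 * M2)"
    by (rule mult_left_mono) simp
  also have "\<dots> = B\<^sup>2 * (18 * M2 / real N)" using N by (simp add: power2_eq_square)
  finally have "sqrt (\<integral>Z. (r Z)\<^sup>2 \<partial>tensor_power N \<mu>) \<le> sqrt (B\<^sup>2 * (18 * M2 / real N))" by (rule real_sqrt_le_mono)
  also have "\<dots> = B * sqrt (18 * M2 / real N)" using B by (simp only: real_sqrt_mult real_sqrt_abs abs_of_nonneg)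
  finally show "(\<integral>Z. r Z \<partial>tensor_power N \<mu>) \<le> B * sqrt (18 * M2 / real N)"
    using T.expectation_le_sqrt(2)[OF mr ir2] by linarith
  show "integrable (tensor_power N \<mu>) r" by (rule T.expectation_le_sqrt(1)[OF mr ir2])
qed

section \<open>Coupling with independent mean-field trajectories\<close>

context symmetric_particles begin

text \<open>The mean-square law of large numbers for (x, y) mapped to
  \<open>K (X s x) (X s y)\<close>. Vanishing on the diagonal and the Lipschitz bound of the flow
  control it by \<open>L * exp (L * \<bar>s\<bar>)\<close> times |x - y|, a constant that is small
  with L.\<close>

lemma mean_field_deviation:
  assumes \<nu>: "\<nu> \<in> P1" and X: "mean_field_flow K L \<nu> X"
    and i2: "integrable \<nu> (\<lambda>x. (norm x)\<^sup>2)" and M2: "(\<integral>x. (norm x)\<^sup>2 \<partial>\<nu>) \<le> M2" and k: "k < N"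
  defines "r \<equiv> \<lambda>s Z. norm ((\<integral>y. K (X s (Z k)) (X s y) \<partial>\<nu>) - (1 / real N) *\<^sub>R (\<Sum>l<N. K (X s (Z k)) (X s (Z l))))"
  shows "integrable (tensor_power N \<nu>) (r s)"
    and "(\<integral>Z. r s Z \<partial>tensor_power N \<nu>) \<le> L * exp (L * \<bar>s\<bar>) * sqrt (18 * M2 / real N)"
proof -
  have mF: "(\<lambda>p. K (X s (fst p)) (X s (snd p))) \<in> borel_measurable borel"
    by (intro kernel_measurable[OF K] measurable_compose[OF _ mean_field_flowD(6)[OF X]])
      (auto intro!: borel_measurable_continuous_onI continuous_intros)
  have F: "norm (K (X s x) (X s y)) \<le> L * exp (L * \<bar>s\<bar>) * norm (x - y)" for x y
    using order_trans[OF kernel_bound[OF K] mult_left_mono[OF mean_field_flowD(5)[OF X] kernel_nonneg[OF K]]]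
    by (simp add: mult.assoc)
  have B: "0 \<le> L * exp (L * \<bar>s\<bar>)" using kernel_nonneg[OF K] by simp
  note dev = mean_square_deviation[OF \<nu> mF F B i2 M2 k]
  show "integrable (tensor_power N \<nu>) (r s)"
    unfolding r_def by (rule dev(1))
  show "(\<integral>Z. r s Z \<partial>tensor_power N \<nu>) \<le> L * exp (L * \<bar>s\<bar>) * sqrt (18 * M2 / real N)"
    unfolding r_def by (rule dev(2))
qed

text \<open>
  The deviation of the kernel average at time s grows like \<open>exp (L * \<bar>s\<bar>)\<close> only, and Gronwall contributes
  \<open>exp (2 * L * (\<bar>t\<bar> - \<bar>s\<bar>))\<close>, so the time integral costs no more than \<open>exp (2 * L * \<bar>t\<bar>)\<close>.
\<close>

lemma total_coupling_cost:
  assumes \<nu>: "\<nu> \<in> P1" and X: "mean_field_flow K L \<nu> X" and P: "P = tensor_power N \<nu>"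
    and i2: "integrable \<nu> (\<lambda>x. (norm x)\<^sup>2)" and M2: "(\<integral>x. (norm x)\<^sup>2 \<partial>\<nu>) \<le> M2"
  shows "(\<integral>\<^sup>+Z. ennreal (\<Sum>k<N. norm (T t Z k - X t (Z k))) \<partial>P) \<le>
    ennreal (exp (2 * L * \<bar>t\<bar>) * (real N * sqrt (18 * M2 / real N)))"
proof -
  note L = kernel_nonneg[OF K]
  note XD = mean_field_flowD[OF X]
  interpret \<nu>: prob_space \<nu> by (rule P1D(2)[OF \<nu>])
  define \<sigma> :: real where "\<sigma> = (if 0 \<le> t then 1 else -1)"
  define R where "R = \<bar>t\<bar>"
  define c where "c = real N * sqrt (18 * M2 / real N)"
  have \<sigma>: "\<bar>\<sigma>\<bar> = 1" "\<sigma> * R = t" "0 \<le> R" by (auto simp: \<sigma>_def R_def)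
  have "0 \<le> (\<integral>x. (norm x)\<^sup>2 \<partial>\<nu>)" by (intro integral_nonneg_AE) simp
  from order_trans[OF this M2] have c0: "0 \<le> c" by (simp add: c_def)
  define \<rho> where "\<rho> Z k s = (\<integral>y. K (X s (Z k)) (X s y) \<partial>\<nu>) - (1 / real N) *\<^sub>R (\<Sum>l<N. K (X s (Z k)) (X s (Z l)))" for Z k s
  define b where "b x Z = (\<Sum>k<N. norm (\<rho> Z k (\<sigma> * x)))" for x Z
  \<comment> \<open>The defect weighted by the integrating factor: \<open>exp (2 * L * x)\<close>
    times an antiderivative of g solves the Gronwall comparison equation exactly.\<close>
  define g where "g x Z = exp (- (2 * L * x)) * b x Z" for x Z
  have b0: "0 \<le> b x Z" for x Z by (simp add: b_def sum_nonneg)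
  have c\<rho>: "continuous_on UNIV (\<rho> Z k)" for Z k
    unfolding \<rho>_def by (intro continuous_intros kernel_continuous[OF K] XD)
  have cg: "continuous_on UNIV (\<lambda>x. g x Z)" for Z
    unfolding g_def b_def by (intro continuous_intros continuous_on_compose2[OF c\<rho>]) auto
  have pointwise: "ennreal (\<Sum>k<N. norm (T t Z k - X t (Z k))) \<le>
      ennreal (exp (2 * L * R)) * (\<integral>\<^sup>+x. ennreal (g x Z) * indicator {0..R} x \<partial>lborel)" if Z: "Z \<in> config N" for Z
  proof -
    obtain Q where Qv: "\<And>x. (Q has_vector_derivative g x Z) (at x)"
      using antiderivative_exists[OF cg] by blast
    then have Q: "(Q has_real_derivative g x Z) (at x)" for x
      by (simp add: has_real_derivative_iff_has_vector_derivative)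
    have "(\<Sum>k<N. norm (T (\<sigma> * R) Z k - X (\<sigma> * R) (Z k))) \<le> exp (2 * L * R) * (Q R - Q 0)"
    proof (rule particle_stability[OF K N T_deriv[OF Z], where \<rho> = "\<rho> Z" and b = "\<lambda>x. b x Z" and w = "\<lambda>k s. X s (Z k)"
          and B = "\<lambda>x. exp (2 * L * x) * (Q x - Q 0)"])
      show "((\<lambda>s. X s (Z k)) has_vector_derivative (1 / real N) *\<^sub>R (\<Sum>l<N. K (X s (Z k)) (X s (Z l))) + \<rho> Z k s) (at s)" for k s
        using XD(3)[of "Z k" s] by (simp add: \<rho>_def)
      show "((\<lambda>x. exp (2 * L * x) * (Q x - Q 0)) has_real_derivative 2 * L * (exp (2 * L * x) * (Q x - Q 0)) + b x Z) (at x)" for x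
      proof -
        have e1: "exp (2 * L * x) * g x Z = b x Z" by (simp add: g_def mult.assoc[symmetric] mult_exp_exp)
        have "((\<lambda>x. exp (2 * L * x)) has_real_derivative exp (2 * L * x) * (2 * L)) (at x)"
          by (auto intro!: derivative_eq_intros)
        moreover have "((\<lambda>x. Q x - Q 0) has_real_derivative g x Z) (at x)"
          using DERIV_diff[OF Q DERIV_const[of "Q 0"]] by simp
        ultimately have "((\<lambda>x. exp (2 * L * x) * (Q x - Q 0)) has_real_derivative
            exp (2 * L * x) * (2 * L) * (Q x - Q 0) + g x Z * exp (2 * L * x)) (at x)" by (rule DERIV_mult)
        then show ?thesis using e1 by (simp add: mult_ac)
      qed
    qed (use \<sigma> c\<rho> in \<open>simp_all add: b_def T_start[OF Z] XD(2)\<close>)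
    moreover have "(\<integral>\<^sup>+x. ennreal (g x Z) * indicator {0..R} x \<partial>lborel) = ennreal (Q R - Q 0)"
    proof (rule nn_integral_FTC_Icc)
      show "(\<lambda>x. g x Z) \<in> borel_measurable borel" by (rule borel_measurable_continuous_onI[OF cg])
      show "(Q has_real_derivative g x Z) (at x)" for x by (rule Q)
      show "0 \<le> g x Z" for x using b0 by (simp add: g_def)
    qed (use \<sigma> in auto)
    ultimately show ?thesis using \<sigma>(2) by (simp add: ennreal_mult'[symmetric] ennreal_leI)
  qed
  \<comment> \<open>Joint measurability in time and initial data permits exchanging the time
    integral with the expectation. It rests on joint continuity of X and on measurability of a
    parameter integral over \<nu>.\<close>
  have mg: "(\<lambda>(x, Z). ennreal (g x Z) * indicator {0..R} x) \<in> borel_measurable (lborel \<Otimes>\<^sub>M P)"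
  proof -
    let ?M = "lborel \<Otimes>\<^sub>M P"
    have mXp: "(\<lambda>p. X (fst p) (snd p)) \<in> borel_measurable borel" by (rule borel_measurable_continuous_onI[OF XD(1)])
    have m1: "(\<lambda>p. \<sigma> * fst p) \<in> borel_measurable ?M" by simp
    have m2: "(\<lambda>p. snd p k) \<in> borel_measurable ?M" if "k < N" for k
      by (rule measurable_compose[OF measurable_snd P_measurable[OF measurable_component_singleton]]) (use that in simp)
    have mXk: "(\<lambda>p. X (\<sigma> * fst p) (snd p k)) \<in> borel_measurable ?M" if k: "k < N" for k
      using measurable_compose[OF borel_measurable_Pair[OF m1 m2[OF k]] mXp] by simp
    have mV: "(\<lambda>p. \<integral>y. K (X (\<sigma> * fst p) (snd p k)) (X (\<sigma> * fst p) y) \<partial>\<nu>) \<in> borel_measurable ?M" if k: "k < N" for k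
    proof (rule \<nu>.borel_measurable_lebesgue_integral)
      have s: "snd \<in> ?M \<Otimes>\<^sub>M \<nu> \<rightarrow>\<^sub>M (borel :: 'a measure)"
        using measurable_snd measurable_cong_sets[OF refl P1D(1)[OF \<nu>]] by blast
      have "(\<lambda>q. K (X (\<sigma> * fst (fst q)) (snd (fst q) k)) (X (\<sigma> * fst (fst q)) (snd q))) \<in> borel_measurable (?M \<Otimes>\<^sub>M \<nu>)"
        using measurable_compose[OF borel_measurable_Pair[OF measurable_compose[OF measurable_fst m1] s] mXp]
        by (intro kernel_measurable[OF K] measurable_compose[OF measurable_fst mXk[OF k]]) simp
      then show "(\<lambda>(p, y). K (X (\<sigma> * fst p) (snd p k)) (X (\<sigma> * fst p) y)) \<in> borel_measurable (?M \<Otimes>\<^sub>M \<nu>)"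
        by (simp add: case_prod_beta)
    qed
    have "(\<lambda>p. norm (\<rho> (snd p) k (\<sigma> * fst p))) \<in> borel_measurable ?M" if k: "k < N" for k
      unfolding \<rho>_def
      by (intro measurable_compose[OF _ borel_measurable_norm] borel_measurable_diff mV[OF k] borel_measurable_scaleR
          borel_measurable_const borel_measurable_sum kernel_measurable[OF K] mXk k) simp
    then have "(\<lambda>p. b (fst p) (snd p)) \<in> borel_measurable ?M"
      unfolding b_def by (intro borel_measurable_sum) simp
    then have "(\<lambda>p. ennreal (exp (- (2 * L * fst p)) * b (fst p) (snd p)) * indicator {0..R} (fst p)) \<in> borel_measurable ?M"
      by measurable
    then show ?thesis by (simp add: g_def case_prod_beta)
  qed
  interpret LP: pair_sigma_finite lborel P ..
  have inner: "(\<integral>\<^sup>+Z. ennreal (g x Z) * indicator {0..R} x \<partial>P) \<le> ennreal (c * (L * exp (- (L * x)))) * indicator {0..R} x" for x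
  proof (cases "x \<in> {0..R}")
    case True
    have ik: "integrable P (\<lambda>Z. norm (\<rho> Z k (\<sigma> * x)))"
      and ek: "(\<integral>Z. norm (\<rho> Z k (\<sigma> * x)) \<partial>P) \<le> L * exp (L * x) * sqrt (18 * M2 / real N)" if k: "k < N" for k
      using mean_field_deviation[OF \<nu> X i2 M2 k, of "\<sigma> * x"] True \<sigma>(1) unfolding P \<rho>_def by (auto simp: abs_mult)
    have "(\<integral>\<^sup>+Z. ennreal (g x Z) \<partial>P) = ennreal (\<integral>Z. g x Z \<partial>P)"
    proof (rule nn_integral_eq_integral)
      show "integrable P (g x)"
        unfolding g_def b_def by (intro integrable_mult_right Bochner_Integration.integrable_sum ik) simp
      show "AE Z in P. 0 \<le> g x Z" using b0 by (intro AE_I2) (simp add: g_def)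
    qed
    also have "(\<integral>Z. g x Z \<partial>P) = exp (- (2 * L * x)) * (\<Sum>k<N. (\<integral>Z. norm (\<rho> Z k (\<sigma> * x)) \<partial>P))"
      unfolding g_def b_def using ik by simp
    also have "ennreal \<dots> \<le> ennreal (exp (- (2 * L * x)) * (\<Sum>k<N. L * exp (L * x) * sqrt (18 * M2 / real N)))"
      by (intro ennreal_leI mult_left_mono sum_mono ek) auto
    also have "exp (- (2 * L * x)) * (\<Sum>k<N. L * exp (L * x) * sqrt (18 * M2 / real N)) =
        c * (L * (exp (- (2 * L * x)) * exp (L * x)))" by (simp add: c_def mult_ac)
    also have "exp (- (2 * L * x)) * exp (L * x) = exp (- (L * x))" by (simp add: mult_exp_exp)
    finally show ?thesis using True by simp
  qed simp
  have "(\<integral>\<^sup>+Z. ennreal (\<Sum>k<N. norm (T t Z k - X t (Z k))) \<partial>P) \<le>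
      (\<integral>\<^sup>+Z. ennreal (exp (2 * L * R)) * (\<integral>\<^sup>+x. ennreal (g x Z) * indicator {0..R} x \<partial>lborel) \<partial>P)"
    by (intro nn_integral_mono pointwise) (simp add: space_P)
  also have "\<dots> = ennreal (exp (2 * L * R)) * (\<integral>\<^sup>+Z. (\<integral>\<^sup>+x. ennreal (g x Z) * indicator {0..R} x \<partial>lborel) \<partial>P)"
  proof (rule nn_integral_cmult)
    have "(\<lambda>(Z, x). ennreal (g x Z) * indicator {0..R} x) \<in> borel_measurable (P \<Otimes>\<^sub>M lborel)"
      using measurable_pair_swap[OF mg] by (simp add: case_prod_beta)
    then show "(\<lambda>Z. \<integral>\<^sup>+x. ennreal (g x Z) * indicator {0..R} x \<partial>lborel) \<in> borel_measurable P"
      by (rule lborel.borel_measurable_nn_integral)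
  qed
  also have "(\<integral>\<^sup>+Z. (\<integral>\<^sup>+x. ennreal (g x Z) * indicator {0..R} x \<partial>lborel) \<partial>P) =
      (\<integral>\<^sup>+x. (\<integral>\<^sup>+Z. ennreal (g x Z) * indicator {0..R} x \<partial>P) \<partial>lborel)"
    by (rule LP.Fubini'[OF mg])
  also have "ennreal (exp (2 * L * R)) * \<dots> \<le> ennreal (exp (2 * L * R)) * ennreal c"
  proof (rule mult_left_mono)
    have "(\<integral>\<^sup>+x. (\<integral>\<^sup>+Z. ennreal (g x Z) * indicator {0..R} x \<partial>P) \<partial>lborel) \<le>
        (\<integral>\<^sup>+x. ennreal (c * (L * exp (- (L * x)))) * indicator {0..R} x \<partial>lborel)"
      by (intro nn_integral_mono inner)
    \<comment> \<open>The integral of L exp(-L x) over [0, R] is 1 - exp(-L R) \<le> 1, also for L =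
      0. The factor L kept in the deviation bound is what makes the constant independent of L and of
      time.\<close>
    also have "\<dots> = ennreal (- (c * exp (- (L * R))) - (- (c * exp (- (L * 0)))))"
    proof (rule nn_integral_FTC_Icc)
      show "(\<lambda>x. c * (L * exp (- (L * x)))) \<in> borel_measurable borel"
        by (intro borel_measurable_continuous_onI continuous_intros)
      show "((\<lambda>x. - (c * exp (- (L * x)))) has_real_derivative c * (L * exp (- (L * x)))) (at x)" for x
        by (auto intro!: derivative_eq_intros)
    qed (use c0 L \<sigma>(3) in auto)
    also have "\<dots> \<le> ennreal c" using c0 by (intro ennreal_leI) simp
    finally show "(\<integral>\<^sup>+x. (\<integral>\<^sup>+Z. ennreal (g x Z) * indicator {0..R} x \<partial>P) \<partial>lborel) \<le> ennreal c" .
  qed simp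
  also have "\<dots> = ennreal (exp (2 * L * \<bar>t\<bar>) * (real N * sqrt (18 * M2 / real N)))"
    using c0 by (simp add: ennreal_mult[symmetric] R_def c_def)
  finally show ?thesis .
qed

lemma displacement_measurable:
  assumes X: "mean_field_flow K L \<nu> X" and k: "k < N"
  shows "(\<lambda>Z. norm (T t Z k - X t (Z k))) \<in> borel_measurable (config_borel N)"
proof -
  have c: "(\<lambda>Z. Z k) \<in> borel_measurable (config_borel N)"
    by (rule measurable_component_singleton) (use k in simp)
  show ?thesis
    by (intro measurable_compose[OF _ borel_measurable_norm] borel_measurable_diff
        measurable_compose[OF T_measurable c] measurable_compose[OF c mean_field_flowD(6)[OF X]])
qed

text \<open>The displacement between a particle and its mean-field companion has the same
  expectation for all particles: transposing two labels preserves \<open>P\<close>, and the flow is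
  equivariant. Each is thus the total cost divided by N.\<close>

lemma particle_coupling_cost:
  assumes \<nu>: "\<nu> \<in> P1" and X: "mean_field_flow K L \<nu> X" and P: "P = tensor_power N \<nu>"
    and i2: "integrable \<nu> (\<lambda>x. (norm x)\<^sup>2)" and M2: "(\<integral>x. (norm x)\<^sup>2 \<partial>\<nu>) \<le> M2" and i: "i < N"
  shows "(\<integral>\<^sup>+Z. ennreal (norm (T t Z i - X t (Z i))) \<partial>P) \<le> ennreal (exp (2 * L * \<bar>t\<bar>) * sqrt (18 * M2 / real N))"
proof -
  define e where "e k = (\<integral>\<^sup>+Z. ennreal (norm (T t Z k - X t (Z k))) \<partial>P)" for k
  have md: "(\<lambda>Z. ennreal (norm (T t Z k - X t (Z k)))) \<in> borel_measurable (config_borel N)" if "k < N" for k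
    by (rule measurable_compose[OF displacement_measurable[OF X that] measurable_ennreal])
  have e: "e k = e i" if k: "k < N" for k
  proof -
    define \<sigma> where "\<sigma> = Transposition.transpose k i"
    have \<sigma>: "\<sigma> permutes {..<N}" unfolding \<sigma>_def using k i by (intro permutes_swap_id) simp_all
    have "e k = (\<integral>\<^sup>+Z. ennreal (norm (T t Z k - X t (Z k))) \<partial>distr P (config_borel N) (\<lambda>z. select N z \<sigma>))"
      using sym \<sigma> by (simp add: e_def symmetric_measure_def)
    also have "\<dots> = (\<integral>\<^sup>+Z. ennreal (norm (T t (select N Z \<sigma>) k - X t (select N Z \<sigma> k))) \<partial>P)"
      by (rule nn_integral_distr[OF P_measurable[OF permute_measurable[OF \<sigma>]]]) (use md[OF k] in simp)
    also have "\<dots> = e i"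
      unfolding e_def
    proof (rule nn_integral_cong)
      fix Z assume "Z \<in> space P"
      then show "ennreal (norm (T t (select N Z \<sigma>) k - X t (select N Z \<sigma> k))) = ennreal (norm (T t Z i - X t (Z i)))"
        using k by (simp add: space_P T_permute[OF _ \<sigma>]) (simp add: \<sigma>_def)
    qed
    finally show ?thesis .
  qed
  have "of_nat N * e i = (\<Sum>k<N. e k)" using e by simp
  also have "\<dots> = (\<integral>\<^sup>+Z. (\<Sum>k<N. ennreal (norm (T t Z k - X t (Z k)))) \<partial>P)"
    unfolding e_def by (rule nn_integral_sum[symmetric], rule P_measurable, rule md) simp
  also have "\<dots> = (\<integral>\<^sup>+Z. ennreal (\<Sum>k<N. norm (T t Z k - X t (Z k))) \<partial>P)" by simp
  also have "\<dots> \<le> ennreal (exp (2 * L * \<bar>t\<bar>) * (real N * sqrt (18 * M2 / real N)))"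
    by (rule total_coupling_cost[OF \<nu> X P i2 M2])
  finally have le: "ennreal (real N) * e i \<le> ennreal (exp (2 * L * \<bar>t\<bar>) * (real N * sqrt (18 * M2 / real N)))"
    by (simp add: ennreal_of_nat_eq_real_of_nat)
  have N0: "0 < real N" using N by simp
  have "ennreal (1 / real N) * (ennreal (real N) * e i) \<le>
      ennreal (1 / real N) * ennreal (exp (2 * L * \<bar>t\<bar>) * (real N * sqrt (18 * M2 / real N)))"
    by (rule mult_left_mono[OF le]) simp
  moreover have "ennreal (1 / real N) * (ennreal (real N) * e i) = e i"
    using N0 by (simp add: mult.assoc[symmetric] ennreal_mult[symmetric])
  moreover have "ennreal (1 / real N) * ennreal (exp (2 * L * \<bar>t\<bar>) * (real N * sqrt (18 * M2 / real N))) =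
      ennreal ((1 / real N) * (exp (2 * L * \<bar>t\<bar>) * (real N * sqrt (18 * M2 / real N))))"
    using N0 by (intro ennreal_mult'[symmetric]) simp
  ultimately show ?thesis using N0 by (simp add: e_def)
qed

text \<open>On the space of initial data, the first m particles have the marginal as their law, and
  the trajectories X from the same m points have the tensor power, as these points are independent.
  Comparing \<phi> on the two m-tuples costs m single displacements, with no combinatorial
  error.\<close>

lemma iid_marginal_bound:
  assumes \<nu>: "\<nu> \<in> P1" and X: "mean_field_flow K L \<nu> X" and P: "P = tensor_power N \<nu>"
    and i2: "integrable \<nu> (\<lambda>x. (norm x)\<^sup>2)" and M2: "(\<integral>x. (norm x)\<^sup>2 \<partial>\<nu>) \<le> M2" and mN: "m \<le> N"
    and m\<phi>: "\<phi> \<in> borel_measurable (config_borel m)"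
    and lip: "\<And>x y. x \<in> config m \<Longrightarrow> y \<in> config m \<Longrightarrow> \<bar>\<phi> x - \<phi> y\<bar> \<le> C * (\<Sum>i<m. norm (x i - y i))"
    and bd: "\<And>z. z \<in> config m \<Longrightarrow> \<bar>\<phi> z\<bar> \<le> S" and C: "0 \<le> C"
  shows "\<bar>(\<integral>z. \<phi> z \<partial>marginal m (distr P (config_borel N) (T t))) - (\<integral>z. \<phi> z \<partial>tensor_power m (distr \<nu> borel (X t)))\<bar>
    \<le> C * (real m * (exp (2 * L * \<bar>t\<bar>) * sqrt (18 * M2 / real N)))"
proof -
  let ?s = "exp (2 * L * \<bar>t\<bar>) * sqrt (18 * M2 / real N)"
  note p\<nu> = P1D(2)[OF \<nu>] and XD = mean_field_flowD[OF X]
  interpret \<nu>: product_prob_space "\<lambda>_::nat. \<nu>" "{..<N}" by (rule product_prob_spaceI) (rule p\<nu>)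
  have "0 \<le> (\<integral>x. (norm x)\<^sup>2 \<partial>\<nu>)" by (intro integral_nonneg_AE) simp
  from order_trans[OF this M2] have s0: "0 \<le> ?s" by simp
  let ?f = "\<lambda>Z. restrict (T t Z) {..<m}" and ?g = "\<lambda>Z. \<lambda>i\<in>{..<m}. X t (Z i)"
  have mr: "(\<lambda>z. restrict z {..<m}) \<in> config_borel N \<rightarrow>\<^sub>M config_borel m"
    by (rule measurable_restrict) (use mN in auto)
  have mf: "?f \<in> P \<rightarrow>\<^sub>M config_borel m"
    by (rule P_measurable[OF measurable_compose[OF T_measurable mr]])
  have mg: "?g \<in> P \<rightarrow>\<^sub>M config_borel m"
  proof (rule P_measurable, rule measurable_restrict)
    fix i assume "i \<in> {..<m}"
    then have "(\<lambda>Z. Z i) \<in> config_borel N \<rightarrow>\<^sub>M (borel :: 'a measure)"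
      using mN by (intro measurable_component_singleton) simp
    then show "(\<lambda>Z. X t (Z i)) \<in> config_borel N \<rightarrow>\<^sub>M borel" by (rule measurable_compose[OF _ XD(6)])
  qed
  have marg: "(\<integral>z. \<phi> z \<partial>marginal m (distr P (config_borel N) (T t))) = (\<integral>Z. \<phi> (?f Z) \<partial>P)"
  proof -
    have "marginal m (distr P (config_borel N) (T t)) = distr P (config_borel m) ?f"
      unfolding marginal_def by (subst distr_distr[OF mr P_measurable[OF T_measurable]]) (simp add: o_def)
    then show ?thesis by (simp add: integral_distr[OF mf m\<phi>])
  qed
  have lim: "(\<integral>z. \<phi> z \<partial>tensor_power m (distr \<nu> borel (X t))) = (\<integral>Z. \<phi> (?g Z) \<partial>P)"
  proof -
    have r: "(\<lambda>x. restrict x {..<m}) \<in> tensor_power N \<nu> \<rightarrow>\<^sub>M tensor_power m \<nu>"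
      by (rule measurable_restrict_subset) (use mN in auto)
    have h: "(\<lambda>z. \<lambda>i\<in>{..<m}. X t (z i)) \<in> tensor_power m \<nu> \<rightarrow>\<^sub>M config_borel m"
      by (intro measurable_restrict measurable_compose[OF _ P1_measurable[OF \<nu> XD(6)]] measurable_component_singleton)
    have "tensor_power m (distr \<nu> borel (X t)) = distr (tensor_power m \<nu>) (config_borel m) (\<lambda>z. \<lambda>i\<in>{..<m}. X t (z i))"
      by (rule tensor_power_distr[OF p\<nu> P1_measurable[OF \<nu> XD(6)]])
    also have "tensor_power m \<nu> = distr (tensor_power N \<nu>) (tensor_power m \<nu>) (\<lambda>x. restrict x {..<m})"
      by (rule \<nu>.distr_PiM_restrict_finite[symmetric]) (use mN in auto)
    also have "distr \<dots> (config_borel m) (\<lambda>z. \<lambda>i\<in>{..<m}. X t (z i)) = distr P (config_borel m) ?g"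
      unfolding distr_distr[OF h r] P by (intro distr_cong) (auto simp: fun_eq_iff)
    finally show ?thesis by (simp add: integral_distr[OF mg m\<phi>])
  qed
  have int: "integrable P (\<lambda>Z. \<phi> (q Z))" if q: "q \<in> P \<rightarrow>\<^sub>M config_borel m" for q
  proof (rule P.integrable_const_bound[where B = S])
    show "AE Z in P. norm (\<phi> (q Z)) \<le> S"
      using bd measurable_space[OF q] by (auto simp: space_PiM intro!: AE_I2)
  qed (rule measurable_compose[OF q m\<phi>])
  have id: "integrable P (\<lambda>Z. norm (T t Z i - X t (Z i)))" and ed: "(\<integral>Z. norm (T t Z i - X t (Z i)) \<partial>P) \<le> ?s" if i: "i < N" for i
  proof -
    note cost = particle_coupling_cost[OF \<nu> X P i2 M2 i, of t]
    show int: "integrable P (\<lambda>Z. norm (T t Z i - X t (Z i)))"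
      by (rule integrableI_bounded[OF P_measurable[OF displacement_measurable[OF X i]]])
        (use cost in \<open>auto intro: le_less_trans\<close>)
    show "(\<integral>Z. norm (T t Z i - X t (Z i)) \<partial>P) \<le> ?s"
      using cost s0 by (subst (asm) nn_integral_eq_integral[OF int]) auto
  qed
  have "\<bar>(\<integral>Z. \<phi> (?f Z) \<partial>P) - (\<integral>Z. \<phi> (?g Z) \<partial>P)\<bar> = \<bar>\<integral>Z. \<phi> (?f Z) - \<phi> (?g Z) \<partial>P\<bar>"
    by (simp only: Bochner_Integration.integral_diff[OF int[OF mf] int[OF mg]])
  also have "\<dots> \<le> (\<integral>Z. C * (\<Sum>i<m. norm (T t Z i - X t (Z i))) \<partial>P)"
  proof (rule integral_abs_le)
    show "integrable P (\<lambda>Z. \<phi> (?f Z) - \<phi> (?g Z))" by (rule Bochner_Integration.integrable_diff[OF int[OF mf] int[OF mg]])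
    show "integrable P (\<lambda>Z. C * (\<Sum>i<m. norm (T t Z i - X t (Z i))))"
      using mN by (intro integrable_mult_right Bochner_Integration.integrable_sum id) auto
    show "\<bar>\<phi> (?f Z) - \<phi> (?g Z)\<bar> \<le> C * (\<Sum>i<m. norm (T t Z i - X t (Z i)))" for Z
      using lip[of "?f Z" "?g Z"] by simp
  qed
  also have "\<dots> = C * (\<Sum>i<m. (\<integral>Z. norm (T t Z i - X t (Z i)) \<partial>P))"
  proof -
    have "(\<integral>Z. (\<Sum>i<m. norm (T t Z i - X t (Z i))) \<partial>P) = (\<Sum>i<m. (\<integral>Z. norm (T t Z i - X t (Z i)) \<partial>P))"
      using mN by (intro Bochner_Integration.integral_sum id) auto
    then show ?thesis by simp
  qed
  also have "\<dots> \<le> C * (\<Sum>i<m. ?s)" using mN C by (intro mult_left_mono sum_mono ed) auto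
  finally show ?thesis by (simp add: marg lim)
qed

text \<open>The joint law of particle 0 and its mean-field companion is an admissible coupling. The
  distance is unbounded as an observable, so it is estimated directly from the coupling and not
  through bounded functions.\<close>

lemma iid_first_marginal_dist:
  assumes \<nu>: "\<nu> \<in> P1" and X: "mean_field_flow K L \<nu> X" and P: "P = tensor_power N \<nu>"
    and i2: "integrable \<nu> (\<lambda>x. (norm x)\<^sup>2)" and M2: "(\<integral>x. (norm x)\<^sup>2 \<partial>\<nu>) \<le> M2"
  shows "dist_MK (distr (marginal 1 (distr P (config_borel N) (T t))) borel (\<lambda>z. z 0)) (distr \<nu> borel (X t))
    \<le> ennreal (exp (2 * L * \<bar>t\<bar>) * sqrt (18 * M2 / real N))"
proof -
  note XD = mean_field_flowD[OF X]
  have N0: "0 < N" using N by simp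
  have c: "(\<lambda>Z. Z 0) \<in> borel_measurable (config_borel N)" by (rule measurable_component_singleton) (use N0 in simp)
  have mT: "(\<lambda>Z. T t Z 0) \<in> borel_measurable P" by (rule P_measurable[OF measurable_compose[OF T_measurable c]])
  have mX: "(\<lambda>Z. X t (Z 0)) \<in> borel_measurable P" by (rule P_measurable[OF measurable_compose[OF c XD(6)]])
  have mp: "(\<lambda>Z. (T t Z 0, X t (Z 0))) \<in> borel_measurable P" by (rule borel_measurable_Pair[OF mT mX])
  define \<pi> where "\<pi> = distr P borel (\<lambda>Z. (T t Z 0, X t (Z 0)))"
  have mfs: "(fst :: 'a \<times> 'a \<Rightarrow> 'a) \<in> borel_measurable borel" "(snd :: 'a \<times> 'a \<Rightarrow> 'a) \<in> borel_measurable borel"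
    by (auto intro!: borel_measurable_continuous_onI continuous_intros)
  have "\<pi> \<in> couplings (distr (marginal 1 (distr P (config_borel N) (T t))) borel (\<lambda>z. z 0)) (distr \<nu> borel (X t))"
    unfolding couplings_def mem_Collect_eq
  proof (intro conjI)
    show "sets \<pi> = sets borel" by (simp add: \<pi>_def)
    show "prob_space \<pi>" unfolding \<pi>_def by (rule P.prob_space_distr[OF mp])
    have mr: "(\<lambda>z. restrict z {..<1}) \<in> config_borel N \<rightarrow>\<^sub>M config_borel 1"
      by (rule measurable_restrict) (use N in auto)
    have c1: "(\<lambda>z. z 0) \<in> config_borel 1 \<rightarrow>\<^sub>M (borel :: 'a measure)" by (rule measurable_component_singleton) simp
    have "distr (marginal 1 (distr P (config_borel N) (T t))) borel (\<lambda>z. z 0) = distr P borel (\<lambda>Z. T t Z 0)"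
      unfolding marginal_def
      by (simp only: distr_distr[OF mr P_measurable[OF T_measurable]]
          distr_distr[OF c1 measurable_comp[OF P_measurable[OF T_measurable] mr]]) (simp add: o_def)
    then show "distr \<pi> borel fst = distr (marginal 1 (distr P (config_borel N) (T t))) borel (\<lambda>z. z 0)"
      unfolding \<pi>_def by (subst distr_distr[OF mfs(1) mp]) (simp add: o_def)
    have "distr P \<nu> (\<lambda>Z. Z 0) = \<nu>" unfolding P
      by (rule distr_PiM_component) (use P1D(2)[OF \<nu>] N0 in auto)
    moreover have "(\<lambda>Z. Z 0) \<in> P \<rightarrow>\<^sub>M \<nu>" unfolding P by (rule measurable_component_singleton) (use N0 in simp)
    ultimately have "distr \<nu> borel (X t) = distr P borel (\<lambda>Z. X t (Z 0))"
      using distr_distr[OF P1_measurable[OF \<nu> XD(6)], of "\<lambda>Z. Z 0" P t] by (simp add: o_def)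
    then show "distr \<pi> borel snd = distr \<nu> borel (X t)"
      unfolding \<pi>_def by (subst distr_distr[OF mfs(2) mp]) (simp add: o_def)
  qed
  then have "dist_MK (distr (marginal 1 (distr P (config_borel N) (T t))) borel (\<lambda>z. z 0)) (distr \<nu> borel (X t))
      \<le> (\<integral>\<^sup>+p. ennreal (norm (fst p - snd p)) \<partial>\<pi>)"
    unfolding dist_MK_def by (rule INF_lower)
  also have "\<dots> = (\<integral>\<^sup>+Z. ennreal (norm (T t Z 0 - X t (Z 0))) \<partial>P)"
    unfolding \<pi>_def by (subst nn_integral_distr[OF mp])
      (auto intro!: measurable_compose[OF _ measurable_ennreal] borel_measurable_continuous_onI continuous_intros)
  also have "\<dots> \<le> ennreal (exp (2 * L * \<bar>t\<bar>) * sqrt (18 * M2 / real N))"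
    by (rule particle_coupling_cost[OF \<nu> X P i2 M2 N0])
  finally show ?thesis .
qed

end


section \<open>Moments, rates and the conclusion\<close>

text \<open>Since |z|^2 \<le> 1 + |z|^n for n \<ge> 2 and the density has mass 1, the second moment
  is controlled by a alone.\<close>

lemma second_moment_density:
  fixes g :: "'a::euclidean_space \<Rightarrow> real"
  assumes g: "probability_density g" and a: "has_bochner_integral lborel (\<lambda>z. norm z ^ n * g z) a" and n: "2 \<le> n"
  shows "integrable (density_measure g) (\<lambda>x. (norm x)\<^sup>2)" "(\<integral>x. (norm x)\<^sup>2 \<partial>density_measure g) \<le> 1 + a"
    "0 \<le> a"
proof -
  have g0: "0 \<le> g z" for z using g by (simp add: probability_density_def)
  have ig: "integrable lborel g" "(\<integral>z. g z \<partial>lborel) = 1"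
    using g by (auto simp: probability_density_def has_bochner_integral_iff)
  have mg: "g \<in> borel_measurable lborel" using ig(1) by simp
  have ia: "integrable lborel (\<lambda>z. norm z ^ n * g z)" "(\<integral>z. norm z ^ n * g z \<partial>lborel) = a"
    using a by (auto simp: has_bochner_integral_iff)
  have le: "(norm z)\<^sup>2 \<le> 1 + norm z ^ n" for z :: 'a
  proof (cases "norm z \<le> 1")
    case True
    then have "(norm z)\<^sup>2 \<le> 1" by (simp add: power_le_one)
    then show ?thesis using zero_le_power[OF norm_ge_zero, of z n] by linarith
  next
    case False
    then have "(norm z)\<^sup>2 \<le> norm z ^ n" by (intro power_increasing n) simp
    then show ?thesis by simp
  qed
  have ib: "integrable lborel (\<lambda>z. g z + norm z ^ n * g z)" using ig ia by simp
  have le': "g z * (norm z)\<^sup>2 \<le> g z + norm z ^ n * g z" for z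
    using mult_left_mono[OF le g0, of z] by (simp add: algebra_simps)
  have i2: "integrable lborel (\<lambda>z. g z * (norm z)\<^sup>2)"
  proof (rule Bochner_Integration.integrable_bound[OF ib])
    show "AE z in lborel. norm (g z * (norm z)\<^sup>2) \<le> norm (g z + norm z ^ n * g z)"
      using le' g0 by (intro AE_I2) (simp add: abs_mult)
  qed (use mg in simp)
  then show "integrable (density_measure g) (\<lambda>x. (norm x)\<^sup>2)"
    using g0 mg by (subst integrable_density) auto
  have "(\<integral>x. (norm x)\<^sup>2 \<partial>density_measure g) = (\<integral>z. g z * (norm z)\<^sup>2 \<partial>lborel)"
    using g0 mg by (subst integral_density) auto
  also have "\<dots> \<le> (\<integral>z. g z + norm z ^ n * g z \<partial>lborel)" using i2 ib le' by (rule integral_mono)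
  also have "\<dots> = 1 + a" using ig ia by simp
  finally show "(\<integral>x. (norm x)\<^sup>2 \<partial>density_measure g) \<le> 1 + a" .
  show "0 \<le> a" unfolding ia(2)[symmetric] by (intro integral_nonneg_AE) (simp add: g0)
qed

lemma root_rate_le_powr_rate:
  assumes "0 \<le> A" "1 \<le> N" "2 \<le> q"
  shows "sqrt (A / real N) \<le> sqrt A / real N powr (1 / q)"
proof -
  have "real N powr (1 / q) \<le> real N powr (1 / 2)"
    using assms by (intro powr_mono) (auto simp: field_simps)
  also have "\<dots> = sqrt (real N)" by (rule powr_half_sqrt) simp
  finally have "sqrt A / sqrt (real N) \<le> sqrt A / real N powr (1 / q)"
    using assms by (intro divide_left_mono) auto
  then show ?thesis by (simp add: real_sqrt_divide)
qed

theorem theorem3p1: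
  "\<exists>C :: real \<Rightarrow> real.
    \<forall>(K :: real ^ 'd \<Rightarrow> real ^ 'd \<Rightarrow> real ^ 'd) (L :: real) (fin :: real ^ 'd \<Rightarrow> real)
      (f :: real \<Rightarrow> real ^ 'd \<Rightarrow> real) (N :: nat)
      (T :: real \<Rightarrow> (nat \<Rightarrow> real ^ 'd) \<Rightarrow> (nat \<Rightarrow> real ^ 'd))
      (P :: (nat \<Rightarrow> real ^ 'd) measure).
      interaction_kernel K L \<and>
      1 \<le> N \<and> particle_flow K N T \<and>
      P \<in> config_P1 N \<and> symmetric_measure N P \<and>
      probability_density fin \<and> integrable lborel (\<lambda>z. norm z * fin z) \<and>
      (\<forall>t. f t \<in> borel_measurable borel \<and> (\<forall>z. 0 \<le> f t z)) \<and>
      vlasov_solution K (density_measure fin) (\<lambda>t. density_measure (f t))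
    \<longrightarrow>
      (\<forall>t. \<forall>m\<in>{1..N}.
        \<exists>R :: (nat \<Rightarrow> real ^ 'd) measure.
          sets R = sets (config_borel m) \<and> finite_measure R \<and>
          (\<forall>A\<in>sets (config_borel m).
            emeasure (P \<bind> (\<lambda>Z. tensor_power m (empirical_measure N (T t Z)))) A =
              ennreal (fact N / (fact (N - m) * real N ^ m)) *
                emeasure (marginal m (distr P (config_borel N) (T t))) A + emeasure R A) \<and>
          measure R (space R) = 1 - fact N / (fact (N - m) * real N ^ m) \<and>
          1 - fact N / (fact (N - m) * real N ^ m) \<le> real m * (real m - 1) / (2 * real N))
      \<and>
      (\<forall>t. \<forall>m\<in>{1..N}. \<forall>\<phi> :: (nat \<Rightarrow> real ^ 'd) \<Rightarrow> real.
        Linf_norm m \<phi> < \<infinity> \<and> Lip_const m \<phi> < \<infinity> \<longrightarrow>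
          ennreal \<bar>(\<integral>z. \<phi> z \<partial>marginal m (distr P (config_borel N) (T t)))
                   - (\<integral>z. \<phi> z \<partial>tensor_power m (density_measure (f t)))\<bar>
          \<le> Linf_norm m \<phi> * ennreal (real m * (real m - 1) / real N)
            + ennreal (real m * exp (2 * L * \<bar>t\<bar>)) * Lip_const m \<phi> *
                (\<integral>\<^sup>+Z. dist_MK (empirical_measure N Z) (density_measure fin) \<partial>P))
      \<and>
      (\<forall>a. P = tensor_power N (density_measure fin) \<and>
          has_bochner_integral lborel (\<lambda>z. norm z ^ (CARD('d) + 5) * fin z) a \<longrightarrow>
        (\<forall>t. \<forall>m\<in>{1..N}.
          W_minus_1_1_norm m
            (\<lambda>\<phi>. (\<integral>z. \<phi> z \<partial>marginal m (distr P (config_borel N) (T t)))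
                  - (\<integral>z. \<phi> z \<partial>tensor_power m (density_measure (f t))))
          \<le> ennreal (real m * ((real m - 1) / real N
              + exp (2 * L * \<bar>t\<bar>) * (C a / real N powr (1 / real (CARD('d) + 4))))))
        \<and>
        (\<forall>t.
          dist_MK (distr (marginal 1 (distr P (config_borel N) (T t))) borel (\<lambda>z. z 0))
            (density_measure (f t))
          \<le> ennreal (C a * exp (2 * L * \<bar>t\<bar>) / real N powr (1 / real (CARD('d) + 4)))))"
proof (intro exI[of _ "\<lambda>a. sqrt (18 * (1 + a))"] allI impI, elim conjE)
  \<comment> \<open>The witness \<open>sqrt (18 * (1 + a))\<close> combines 18 from the mean-square
    deviation with the bound 1 + a for the second moment; it involves neither K, L, N nor t.\<close>
  fix K :: "real ^ 'd \<Rightarrow> real ^ 'd \<Rightarrow> real ^ 'd" and L :: real and fin :: "real ^ 'd \<Rightarrow> real"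
    and f :: "real \<Rightarrow> real ^ 'd \<Rightarrow> real" and N :: nat
    and T :: "real \<Rightarrow> (nat \<Rightarrow> real ^ 'd) \<Rightarrow> (nat \<Rightarrow> real ^ 'd)" and P :: "(nat \<Rightarrow> real ^ 'd) measure"
  assume K: "interaction_kernel K L" and N: "1 \<le> N" and flow: "particle_flow K N T"
    and P: "P \<in> config_P1 N" and sym: "symmetric_measure N P" and fin: "probability_density fin"
    and sol: "vlasov_solution K (density_measure fin) (\<lambda>t. density_measure (f t))"
  interpret symmetric_particles K L N T P
    using P by (intro symmetric_particles.intro particles.intro symmetric_particles_axioms.intro K N flow sym)
      (auto simp: config_P1_def)
  let ?\<nu> = "density_measure fin"
  obtain X where X: "mean_field_flow K L ?\<nu> X" and rep: "\<And>t. density_measure (f t) = distr ?\<nu> borel (X t)"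
    using vlasov_mean_field_flow[OF K sol] by blast
  have \<nu>: "?\<nu> \<in> P1" using sol unfolding vlasov_solution_def by metis
  let ?Pm = "\<lambda>m t. marginal m (distr P (config_borel N) (T t))"
  have c: "W_minus_1_1_norm m (\<lambda>\<phi>. (\<integral>z. \<phi> z \<partial>?Pm m t) - (\<integral>z. \<phi> z \<partial>tensor_power m (density_measure (f t))))
      \<le> ennreal (real m * ((real m - 1) / real N
          + exp (2 * L * \<bar>t\<bar>) * (sqrt (18 * (1 + a)) / real N powr (1 / real (CARD('d) + 4)))))"
    and c1: "dist_MK (distr (?Pm 1 t) borel (\<lambda>z. z 0)) (density_measure (f t))
      \<le> ennreal (sqrt (18 * (1 + a)) * exp (2 * L * \<bar>t\<bar>) / real N powr (1 / real (CARD('d) + 4)))"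
    if iid: "P = tensor_power N ?\<nu>" and a: "has_bochner_integral lborel (\<lambda>z. norm z ^ (CARD('d) + 5) * fin z) a"
      and m: "m \<in> {1..N}" for a t m
  proof -
    have n2: "2 \<le> CARD('d) + 5" by simp
    note moment = second_moment_density[OF fin a n2]
    have rate: "sqrt (18 * (1 + a) / real N) \<le> sqrt (18 * (1 + a)) / real N powr (1 / real (CARD('d) + 4))"
      using moment(3) N by (intro root_rate_le_powr_rate) auto
    show "W_minus_1_1_norm m (\<lambda>\<phi>. (\<integral>z. \<phi> z \<partial>?Pm m t) - (\<integral>z. \<phi> z \<partial>tensor_power m (density_measure (f t))))
      \<le> ennreal (real m * ((real m - 1) / real N
          + exp (2 * L * \<bar>t\<bar>) * (sqrt (18 * (1 + a)) / real N powr (1 / real (CARD('d) + 4)))))"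
      unfolding W_minus_1_1_norm_def
    proof (rule SUP_least)
      fix \<phi> :: "(nat \<Rightarrow> real ^ 'd) \<Rightarrow> real"
      assume "\<phi> \<in> {\<phi>. Linf_norm m \<phi> \<le> 1 \<and> Lip_const m \<phi> \<le> 1}"
      then have Linf: "Linf_norm m \<phi> \<le> 1" and Lip: "Lip_const m \<phi> \<le> 1" by auto
      have Lip': "Lip_const m \<phi> < \<infinity>" using Lip by (auto intro: le_less_trans)
      have "enn2real (Lip_const m \<phi>) \<le> 1" using enn2real_mono[OF Lip] by simp
      then have lip: "\<bar>\<phi> x - \<phi> y\<bar> \<le> 1 * (\<Sum>i<m. norm (x i - y i))" if "x \<in> config m" "y \<in> config m" for x y
        by (intro order_trans[OF Lip_const_finite[OF Lip' that] mult_right_mono] sum_nonneg) auto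
      have m\<phi>: "\<phi> \<in> borel_measurable (config_borel m)"
        by (rule config_lipschitz_measurable[where C = 1]) (use lip in \<open>simp add: dist_real_def\<close>)
      have bd: "\<bar>\<phi> z\<bar> \<le> 1" if "z \<in> config m" for z
        using order_trans[OF Linf_norm_upper[of m \<phi> 1 z, OF lip _ that] Linf] by simp
      have "\<bar>(\<integral>z. \<phi> z \<partial>?Pm m t) - (\<integral>z. \<phi> z \<partial>tensor_power m (distr ?\<nu> borel (X t)))\<bar>
          \<le> 1 * (real m * (exp (2 * L * \<bar>t\<bar>) * sqrt (18 * (1 + a) / real N)))"
        by (rule iid_marginal_bound[OF \<nu> X iid moment(1,2) _ m\<phi> lip bd]) (use m in auto)
      also have "\<dots> \<le> real m * ((real m - 1) / real N
          + exp (2 * L * \<bar>t\<bar>) * (sqrt (18 * (1 + a)) / real N powr (1 / real (CARD('d) + 4))))"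
      proof -
        have "exp (2 * L * \<bar>t\<bar>) * sqrt (18 * (1 + a) / real N)
            \<le> exp (2 * L * \<bar>t\<bar>) * (sqrt (18 * (1 + a)) / real N powr (1 / real (CARD('d) + 4)))"
          by (rule mult_left_mono[OF rate]) simp
        \<comment> \<open>The coupling already yields the second summand of the required bound; the
          first is nonnegative because m \<ge> 1, so adding it only weakens the estimate.\<close>
        moreover have "0 \<le> (real m - 1) / real N" using m by simp
        ultimately have "exp (2 * L * \<bar>t\<bar>) * sqrt (18 * (1 + a) / real N) \<le> (real m - 1) / real N
            + exp (2 * L * \<bar>t\<bar>) * (sqrt (18 * (1 + a)) / real N powr (1 / real (CARD('d) + 4)))" by linarith
        from mult_left_mono[OF this, of "real m"] show ?thesis by simp
      qed
      finally show "ennreal \<bar>(\<integral>z. \<phi> z \<partial>?Pm m t) - (\<integral>z. \<phi> z \<partial>tensor_power m (density_measure (f t)))\<bar>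
        \<le> ennreal (real m * ((real m - 1) / real N
          + exp (2 * L * \<bar>t\<bar>) * (sqrt (18 * (1 + a)) / real N powr (1 / real (CARD('d) + 4)))))"
        unfolding rep by (rule ennreal_leI)
    qed
    have "exp (2 * L * \<bar>t\<bar>) * sqrt (18 * (1 + a) / real N)
        \<le> exp (2 * L * \<bar>t\<bar>) * (sqrt (18 * (1 + a)) / real N powr (1 / real (CARD('d) + 4)))"
      by (rule mult_left_mono[OF rate]) simp
    also have "\<dots> = sqrt (18 * (1 + a)) * exp (2 * L * \<bar>t\<bar>) / real N powr (1 / real (CARD('d) + 4))"
      by (simp only: times_divide_eq_right mult.commute)
    finally show "dist_MK (distr (?Pm 1 t) borel (\<lambda>z. z 0)) (density_measure (f t))
      \<le> ennreal (sqrt (18 * (1 + a)) * exp (2 * L * \<bar>t\<bar>) / real N powr (1 / real (CARD('d) + 4)))"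
      unfolding rep
      by (intro order_trans[OF iid_first_marginal_dist[OF \<nu> X iid moment(1,2)] ennreal_leI])
  qed
  show "(\<forall>t. \<forall>m\<in>{1..N}.
        \<exists>R :: (nat \<Rightarrow> real ^ 'd) measure.
          sets R = sets (config_borel m) \<and> finite_measure R \<and>
          (\<forall>A\<in>sets (config_borel m).
            emeasure (P \<bind> (\<lambda>Z. tensor_power m (empirical_measure N (T t Z)))) A =
              ennreal (fact N / (fact (N - m) * real N ^ m)) * emeasure (?Pm m t) A + emeasure R A) \<and>
          measure R (space R) = 1 - fact N / (fact (N - m) * real N ^ m) \<and>
          1 - fact N / (fact (N - m) * real N ^ m) \<le> real m * (real m - 1) / (2 * real N))
      \<and>
      (\<forall>t. \<forall>m\<in>{1..N}. \<forall>\<phi> :: (nat \<Rightarrow> real ^ 'd) \<Rightarrow> real.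
        Linf_norm m \<phi> < \<infinity> \<and> Lip_const m \<phi> < \<infinity> \<longrightarrow>
          ennreal \<bar>(\<integral>z. \<phi> z \<partial>?Pm m t) - (\<integral>z. \<phi> z \<partial>tensor_power m (density_measure (f t)))\<bar>
          \<le> Linf_norm m \<phi> * ennreal (real m * (real m - 1) / real N)
            + ennreal (real m * exp (2 * L * \<bar>t\<bar>)) * Lip_const m \<phi> *
                (\<integral>\<^sup>+Z. dist_MK (empirical_measure N Z) ?\<nu> \<partial>P))
      \<and>
      (\<forall>a. P = tensor_power N ?\<nu> \<and>
          has_bochner_integral lborel (\<lambda>z. norm z ^ (CARD('d) + 5) * fin z) a \<longrightarrow>
        (\<forall>t. \<forall>m\<in>{1..N}.
          W_minus_1_1_norm m
            (\<lambda>\<phi>. (\<integral>z. \<phi> z \<partial>?Pm m t) - (\<integral>z. \<phi> z \<partial>tensor_power m (density_measure (f t))))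
          \<le> ennreal (real m * ((real m - 1) / real N
              + exp (2 * L * \<bar>t\<bar>) * (sqrt (18 * (1 + a)) / real N powr (1 / real (CARD('d) + 4))))))
        \<and>
        (\<forall>t. dist_MK (distr (?Pm 1 t) borel (\<lambda>z. z 0)) (density_measure (f t))
          \<le> ennreal (sqrt (18 * (1 + a)) * exp (2 * L * \<bar>t\<bar>) / real N powr (1 / real (CARD('d) + 4)))))"
  proof (intro conjI allI ballI impI; (elim conjE)?)
    fix t m assume "m \<in> {1..N}"
    then show "\<exists>R :: (nat \<Rightarrow> real ^ 'd) measure.
          sets R = sets (config_borel m) \<and> finite_measure R \<and>
          (\<forall>A\<in>sets (config_borel m).
            emeasure (P \<bind> (\<lambda>Z. tensor_power m (empirical_measure N (T t Z)))) A =
              ennreal (fact N / (fact (N - m) * real N ^ m)) * emeasure (?Pm m t) A + emeasure R A) \<and>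
          measure R (space R) = 1 - fact N / (fact (N - m) * real N ^ m) \<and>
          1 - fact N / (fact (N - m) * real N ^ m) \<le> real m * (real m - 1) / (2 * real N)"
      by (rule mean_empirical_decomposition)
  next
    fix t m and \<phi> :: "(nat \<Rightarrow> real ^ 'd) \<Rightarrow> real"
    assume "m \<in> {1..N}" "Linf_norm m \<phi> < \<infinity>" "Lip_const m \<phi> < \<infinity>"
    then show "ennreal \<bar>(\<integral>z. \<phi> z \<partial>?Pm m t) - (\<integral>z. \<phi> z \<partial>tensor_power m (density_measure (f t)))\<bar>
          \<le> Linf_norm m \<phi> * ennreal (real m * (real m - 1) / real N)
            + ennreal (real m * exp (2 * L * \<bar>t\<bar>)) * Lip_const m \<phi> *
                (\<integral>\<^sup>+Z. dist_MK (empirical_measure N Z) ?\<nu> \<partial>P)"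
      unfolding rep by (rule marginal_chaos_bound[OF \<nu> X])
  next
    fix a t m
    assume "P = tensor_power N ?\<nu>" "has_bochner_integral lborel (\<lambda>z. norm z ^ (CARD('d) + 5) * fin z) a" "m \<in> {1..N}"
    then show "W_minus_1_1_norm m (\<lambda>\<phi>. (\<integral>z. \<phi> z \<partial>?Pm m t) - (\<integral>z. \<phi> z \<partial>tensor_power m (density_measure (f t))))
          \<le> ennreal (real m * ((real m - 1) / real N
              + exp (2 * L * \<bar>t\<bar>) * (sqrt (18 * (1 + a)) / real N powr (1 / real (CARD('d) + 4)))))"
      by (rule c)
  next
    fix a t
    assume "P = tensor_power N ?\<nu>" "has_bochner_integral lborel (\<lambda>z. norm z ^ (CARD('d) + 5) * fin z) a"
    then show "dist_MK (distr (?Pm 1 t) borel (\<lambda>z. z 0)) (density_measure (f t))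
          \<le> ennreal (sqrt (18 * (1 + a)) * exp (2 * L * \<bar>t\<bar>) / real N powr (1 / real (CARD('d) + 4)))"
      by (rule c1[of a 1]) (use N in simp)
  qed
qed

end
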